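(* Let $\Phi$ be a non-autonomous infinite conformal iterated function system (with $I_k=\mathbb N_+$ for every $k$), with initial set $J\subset\mathbb R^d$, satisfying the open set condition, and let $E$ be its non-autonomous infinite conformal set. Suppose that $$\lim_{k\to+\infty}\frac{\log\overline c_k}{\log M_k}=0,$$ and that for all $t\in(0,d)$ and all $\epsilon>0$ the following hold: (1) the sums $\sum_{j\in I_k}\|D\varphi_{k,j}\|^t$ are either infinite for all $k$ or finite for all $k$; (2) if $\sum_{j\in I_k}\|D\varphi_{k,j}\|^t<\infty$ (for all $k$), then $$\lim_{n\to\infty}\frac{\sum_{k\le M_n^{-\epsilon}}\|D\varphi_{n,k}\|^t}{\sum_{j\in I_n}\|D\varphi_{n,j}\|^t}=1;$$ (3) if $\sum_{j\in I_k}\|D\varphi_{k,j}\|^t=\infty$ (for all $k$), then $\lim_{n\to\infty}\sum_{k\le M_n^{-\epsilon}}\|D\varphi_{n,k}\|^t=\infty$. Then $$\overline{\dim}_{\rm B}E\ge\dim_{\rm P}E\ge s^* .$$ Furthermore, if $\mathcal L^d(\partial J)=0$, then $\dim_{\rm H}E=s_*$.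
   Context: $\mathcal L^d$ is $d$-dimensional Lebesgue measure; $\overline{\dim}_{\rm B},\dim_{\rm P},\dim_{\rm H}$ are upper box, packing and Hausdorff dimension. Words. $\{I_k\}_{k\ge 1}$ is a sequence of countably infinite index sets, $I_k=\mathbb N_+$. For $k\ge l\ge 1$, $\Sigma_l^k=\{u_l\cdots u_k: u_j\in I_j\}$; $\Sigma^k=\Sigma_1^k$, $\Sigma^0=\{\emptyset\}$, $\Sigma^*=\bigcup_{k\ge 0}\Sigma^k$. System. $J\subset\mathbb R^d$ is compact with non-empty interior and $\overline{\mathrm{int}(J)}=J$. For each $k\ge1$, $\Phi_k=\{\varphi_{k,i}\}_{i\in I_k}$ is a family of maps $\varphi_{k,i}:J\to J$. For $\mathbf u=u_l\cdots u_k\in\Sigma_l^k$, $\varphi_{\mathbf u}=\varphi_{l,u_l}\circ\cdots\circ\varphi_{k,u_k}$ (and $\varphi_\emptyset=\mathrm{id}$). $\Phi=\{\Phi_k\}_{k\ge1}$, together with a family $\{J_{\mathbf u}:\mathbf u\in\Sigma^*\}$ of closed subsets of $J$, is a non-autonomous infinite iterated function system if: (i) there is $0<c<1$ with $|\varphi_{k,i}(x)-\varphi_{k,i}(y)|\le c|x-y|$ for all $k$, $i\in I_k$, $x,y\in J$; (ii) $J_\emptyset=J$ and $J_{\mathbf u i}\subset J_{\mathbf u}$ for all $\mathbf u\in\Sigma^{k-1}$, $i\in I_k$, $k\ge1$; (iii) for each $\mathbf u\in\Sigma^*$ there is $\omega_{\mathbf u}\in\mathbb R^d$ such that $J_{\mathbf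 u}=\Psi_{\mathbf u}(J)$ with $\Psi_{\mathbf u}=\varphi_{\mathbf u}+\omega_{\mathbf u}$. Its attractor is $E=\bigcap_{k\ge1}\bigcup_{\mathbf u\in\Sigma^k}J_{\mathbf u}$. The open set condition (OSC) means: for all $k\ge0$, $\mathbf u\in\Sigma^k$ and $i\ne j\in I_{k+1}$, $\mathrm{int}(J_{\mathbf ui})\cap\mathrm{int}(J_{\mathbf uj})=\emptyset$. Conformality. $\Phi$ is conformal (and $E$ is called a non-autonomous infinite conformal set) if there is an open connected set $V\supset J$, independent of $k$, such that each $\varphi_{k,j}$ extends to a $C^1$ conformal diffeomorphism of $V$ into $V$ (the derivative at each point is a similarity linear map), and there is $C\ge1$ with $\|D\varphi_{\mathbf u}(x)\|\le C\|D\varphi_{\mathbf u}(y)\|$ for all $x,y\in V$ and all $\mathbf u\in\Sigma_l^k$, $k\ge l\ge1$. Here $\|D\varphi(x)\|$ is the scaling factor of $D\varphi(x)$ and $\|D\varphi\|=\sup_{x\in J}\|D\varphi(x)\|$. Put $M_k=\sup_{\mathbf u\in\Sigma^k}\|D\varphi_{\mathbf u}\|$ and $\overline c_k=\sup_{j\in I_k}\|D\varphi_{k,j}\|$. Pressures (values in $[-\infty,+\infty]$): $\overline P(t)=\limsup_{k\to\infty}\frac1k\log\sum_{\mathbf u\in\Sigma^k}\|D\varphi_{\mathbf u}\|^t$ and $\underline P(t)=\liminf_{k\to\infty}\frac1k\log\sum_{\mathbf u\in\Sigma^k}\|D\varphi_{\mathbf u}\|^t$; $s^*=\inf\{t:\overline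 P(t)<0\}=\sup\{t:\overline P(t)>0\}$ and $s_*=\inf\{t:\underline P(t)<0\}=\sup\{t:\underline P(t)>0\}$. *)

theory Defs
  imports "HOL-Analysis.Analysis"
begin

section \<open>Logarithm with values in the extended reals\<close>

definition eln :: "ennreal \<Rightarrow> ereal" where
  "eln x = (if x = 0 then - \<infinity> else if x = \<infinity> then \<infinity> else ereal (ln (enn2real x)))"

section \<open>Fractal dimensions\<close>

text \<open>The usual conventions: the empty set has gauge \<open>0\<close>, and \<open>diam(U)\<^sup>0 = 1\<close> for \<open>U\<close> nonempty
  (whereas \<open>0 powr 0 = 0\<close>). The requirement \<^const>\<open>bounded\<close> below is needed because
  \<^const>\<open>diameter\<close> is only meaningful for bounded sets.\<close>

definition diam_power :: "real \<Rightarrow> 'a::metric_space set \<Rightarrow> ennreal" where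
  "diam_power s U =
     (if U = {} then 0 else if s = 0 then 1 else ennreal (diameter U powr s))"

definition delta_covers :: "real \<Rightarrow> 'a::metric_space set \<Rightarrow> (nat \<Rightarrow> 'a set) set" where
  "delta_covers \<delta> A =
     {U. A \<subseteq> (\<Union>i. U i) \<and> (\<forall>i. bounded (U i) \<and> diameter (U i) \<le> \<delta>)}"

definition hausdorff_measure :: "real \<Rightarrow> 'a::metric_space set \<Rightarrow> ennreal" where
  "hausdorff_measure s A =
     (SUP \<delta>\<in>{0<..}. INF U\<in>delta_covers \<delta> A. \<Sum>i. diam_power s (U i))"

definition hausdorff_dim :: "'a::metric_space set \<Rightarrow> ereal" where
  "hausdorff_dim A = Inf {ereal s | s. 0 \<le> s \<and> hausdorff_measure s A = 0}"

text \<open>A packing is a family of pairwise disjoint closed balls, encoded by the set of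
  its (centre, radius) pairs; \<open>2 * r\<close> is the diameter of a ball of radius \<open>r\<close> in Euclidean space.\<close>

definition delta_packings :: "real \<Rightarrow> 'a::euclidean_space set \<Rightarrow> ('a \<times> real) set set" where
  "delta_packings \<delta> A =
     {S. S \<subseteq> A \<times> {0<..\<delta>} \<and> disjoint_family_on (\<lambda>(x, r). cball x r) S}"

definition packing_premeasure :: "real \<Rightarrow> 'a::euclidean_space set \<Rightarrow> ennreal" where
  "packing_premeasure s A =
     (INF \<delta>\<in>{0<..}. SUP S\<in>delta_packings \<delta> A.
        \<Sum>\<^sub>\<infinity>(x, r)\<in>S. ennreal ((2 * r) powr s))"

definition packing_measure :: "real \<Rightarrow> 'a::euclidean_space set \<Rightarrow> ennreal" where
  "packing_measure s A =
     (INF B\<in>{B :: nat \<Rightarrow> 'a set. A \<subseteq> (\<Union>i. B i)}. \<Sum>i. packing_premeasure s (B i))"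

definition packing_dim :: "'a::euclidean_space set \<Rightarrow> ereal" where
  "packing_dim A = Inf {ereal s | s. 0 \<le> s \<and> packing_measure s A = 0}"

text \<open>The least number of sets of diameter at most \<open>\<delta>\<close> that cover \<open>A\<close>
  (\<open>\<infinity>\<close> if there is no finite such cover).\<close>

definition covering_number :: "real \<Rightarrow> 'a::metric_space set \<Rightarrow> ennreal" where
  "covering_number \<delta> A =
     (INF C\<in>{C. finite C \<and> A \<subseteq> \<Union>C \<and> (\<forall>U\<in>C. bounded U \<and> diameter U \<le> \<delta>)}.
        of_nat (card C))"

definition upper_box_dim :: "'a::metric_space set \<Rightarrow> ereal" where
  "upper_box_dim A =
     Limsup (at_right 0) (\<lambda>\<delta>. eln (covering_number \<delta> A) / ereal (- ln \<delta>))"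

section \<open>Words and compositions\<close>

text \<open>The index set \<open>I\<^sub>k\<close> is \<open>{1..}\<close> for every \<open>k\<close>, so the set \<open>\<Sigma>\<^sub>l\<^sup>k\<close> of words \<open>u\<^sub>l \<dots> u\<^sub>k\<close> depends only on
  the length \<open>n = k - l + 1\<close>, and is \<open>words n\<close>; the starting level \<open>l\<close> is an argument of
  \<open>word_map\<close> instead. In particular \<open>words k\<close> is \<open>\<Sigma>\<^sup>k\<close>, to be used with \<open>l = 1\<close>.\<close>

definition words :: "nat \<Rightarrow> nat list set" where
  "words n = {u. length u = n \<and> set u \<subseteq> {1..}}"

fun word_map :: "(nat \<Rightarrow> nat \<Rightarrow> 'a \<Rightarrow> 'a) \<Rightarrow> nat \<Rightarrow> nat list \<Rightarrow> 'a \<Rightarrow> 'a" where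
  "word_map \<phi> l [] = id"
| "word_map \<phi> l (i # u) = \<phi> l i \<circ> word_map \<phi> (Suc l) u"

section \<open>Non-autonomous infinite iterated function systems\<close>

text \<open>The map \<open>\<phi>\<^bsub>k,i\<^esub>\<close> is \<open>\<phi> k i\<close> for \<open>k \<ge> 1\<close> and \<open>i \<ge> 1\<close>, a function on the whole space. Here only its
  restriction to \<open>J\<close> matters.\<close>

definition nonautonomous_ifs ::
  "'a::euclidean_space set \<Rightarrow> (nat \<Rightarrow> nat \<Rightarrow> 'a \<Rightarrow> 'a) \<Rightarrow> (nat list \<Rightarrow> 'a set) \<Rightarrow> bool" where
  "nonautonomous_ifs J \<phi> Jw \<longleftrightarrow>
     compact J \<and> interior J \<noteq> {} \<and> closure (interior J) = J \<and>
     (\<forall>k\<ge>1. \<forall>i\<ge>1. \<phi> k i ` J \<subseteq> J) \<and>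
     (\<forall>n. \<forall>u\<in>words n. closed (Jw u) \<and> Jw u \<subseteq> J) \<and>
     (\<exists>c. 0 < c \<and> c < 1 \<and>
        (\<forall>k\<ge>1. \<forall>i\<ge>1. \<forall>x\<in>J. \<forall>y\<in>J. norm (\<phi> k i x - \<phi> k i y) \<le> c * norm (x - y))) \<and>
     Jw [] = J \<and>
     (\<forall>k. \<forall>u\<in>words k. \<forall>i\<ge>1. Jw (u @ [i]) \<subseteq> Jw u) \<and>
     (\<forall>k. \<forall>u\<in>words k. \<exists>\<omega>. Jw u = (\<lambda>x. word_map \<phi> 1 u x + \<omega>) ` J)"

definition attractor :: "(nat list \<Rightarrow> 'a set) \<Rightarrow> 'a set" where
  "attractor Jw = (\<Inter>k\<in>{1..}. \<Union>u\<in>words k. Jw u)"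

definition open_set_condition :: "(nat list \<Rightarrow> 'a::topological_space set) \<Rightarrow> bool" where
  "open_set_condition Jw \<longleftrightarrow>
     (\<forall>k. \<forall>u\<in>words k. \<forall>i\<ge>1. \<forall>j\<ge>1. i \<noteq> j \<longrightarrow>
        interior (Jw (u @ [i])) \<inter> interior (Jw (u @ [j])) = {})"

section \<open>Conformality\<close>

definition similarity_linear :: "('a::euclidean_space \<Rightarrow> 'a) \<Rightarrow> bool" where
  "similarity_linear L \<longleftrightarrow> linear L \<and> (\<exists>r>0. \<forall>v. norm (L v) = r * norm v)"

definition scaling_factor :: "('a::euclidean_space \<Rightarrow> 'a) \<Rightarrow> real" where
  "scaling_factor L = (THE r. \<forall>v. norm (L v) = r * norm v)"

lemma scaling_factor_eq:
  fixes L :: "'a::euclidean_space \<Rightarrow> 'a"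
  assumes "\<And>v. norm (L v) = r * norm v"
  shows "scaling_factor L = r"
  unfolding scaling_factor_def
proof (rule the_equality)
  fix r' assume "\<forall>v. norm (L v) = r' * norm v"
  moreover obtain b :: 'a where "b \<in> Basis" using nonempty_Basis by blast
  ultimately show "r' = r" using assms[of b] by simp
qed (use assms in simp)

definition C1_on :: "'a::euclidean_space set \<Rightarrow> ('a \<Rightarrow> 'a) \<Rightarrow> bool" where
  "C1_on U f \<longleftrightarrow>
     (\<exists>f' :: 'a \<Rightarrow> 'a \<Rightarrow>\<^sub>L 'a. continuous_on U f' \<and>
        (\<forall>x\<in>U. (f has_derivative blinfun_apply (f' x)) (at x)))"

text \<open>A diffeomorphism of \<open>V\<close> into \<open>V\<close> is one of \<open>V\<close> onto an open subset of \<open>V\<close>.\<close>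

definition conformal_diffeo_into :: "'a::euclidean_space set \<Rightarrow> ('a \<Rightarrow> 'a) \<Rightarrow> bool" where
  "conformal_diffeo_into V f \<longleftrightarrow>
     f ` V \<subseteq> V \<and> open (f ` V) \<and> inj_on f V \<and>
     C1_on V f \<and> C1_on (f ` V) (the_inv_into V f) \<and>
     (\<forall>x\<in>V. similarity_linear (frechet_derivative f (at x)))"

definition deriv_norm :: "('a::euclidean_space \<Rightarrow> 'a) \<Rightarrow> 'a \<Rightarrow> real" where
  "deriv_norm f x = scaling_factor (frechet_derivative f (at x))"

definition sup_deriv_norm :: "'a::euclidean_space set \<Rightarrow> ('a \<Rightarrow> 'a) \<Rightarrow> real" where
  "sup_deriv_norm J f = (SUP x\<in>J. deriv_norm f x)"

text \<open>The extension of \<open>\<phi>\<^bsub>k,i\<^esub>\<close> from \<open>J\<close> to \<open>V\<close> is the restriction of the same function \<open>\<phi> k i\<close> to \<open>V\<close>.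
  As \<open>V\<close> is open and contains \<open>J\<close>, it determines the derivatives at the points of \<open>J\<close>.\<close>

definition conformal_system ::
  "'a::euclidean_space set \<Rightarrow> (nat \<Rightarrow> nat \<Rightarrow> 'a \<Rightarrow> 'a) \<Rightarrow> bool" where
  "conformal_system J \<phi> \<longleftrightarrow>
     (\<exists>V. open V \<and> connected V \<and> J \<subseteq> V \<and>
        (\<forall>k\<ge>1. \<forall>i\<ge>1. conformal_diffeo_into V (\<phi> k i)) \<and>
        (\<exists>C\<ge>1. \<forall>l\<ge>1. \<forall>n\<ge>1. \<forall>u\<in>words n. \<forall>x\<in>V. \<forall>y\<in>V.
           deriv_norm (word_map \<phi> l u) x \<le> C * deriv_norm (word_map \<phi> l u) y))"

definition max_deriv ::
  "'a::euclidean_space set \<Rightarrow> (nat \<Rightarrow> nat \<Rightarrow> 'a \<Rightarrow> 'a) \<Rightarrow> nat \<Rightarrow> real" where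
  "max_deriv J \<phi> k = (SUP u\<in>words k. sup_deriv_norm J (word_map \<phi> 1 u))"

definition level_max_deriv ::
  "'a::euclidean_space set \<Rightarrow> (nat \<Rightarrow> nat \<Rightarrow> 'a \<Rightarrow> 'a) \<Rightarrow> nat \<Rightarrow> real" where
  "level_max_deriv J \<phi> k = (SUP j\<in>{1..}. sup_deriv_norm J (\<phi> k j))"

section \<open>Pressures\<close>

definition level_sum ::
  "'a::euclidean_space set \<Rightarrow> (nat \<Rightarrow> nat \<Rightarrow> 'a \<Rightarrow> 'a) \<Rightarrow> real \<Rightarrow> nat \<Rightarrow> ennreal" where
  "level_sum J \<phi> t k = (\<Sum>\<^sub>\<infinity>j\<in>{1..}. ennreal (sup_deriv_norm J (\<phi> k j) powr t))"

definition partial_level_sum ::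
  "'a::euclidean_space set \<Rightarrow> (nat \<Rightarrow> nat \<Rightarrow> 'a \<Rightarrow> 'a) \<Rightarrow> real \<Rightarrow> real \<Rightarrow> nat \<Rightarrow> ennreal" where
  "partial_level_sum J \<phi> t \<epsilon> n =
     (\<Sum>k\<in>{k. 1 \<le> k \<and> real k \<le> max_deriv J \<phi> n powr (- \<epsilon>)}.
        ennreal (sup_deriv_norm J (\<phi> n k) powr t))"

definition word_sum ::
  "'a::euclidean_space set \<Rightarrow> (nat \<Rightarrow> nat \<Rightarrow> 'a \<Rightarrow> 'a) \<Rightarrow> real \<Rightarrow> nat \<Rightarrow> ennreal" where
  "word_sum J \<phi> t k =
     (\<Sum>\<^sub>\<infinity>u\<in>words k. ennreal (sup_deriv_norm J (word_map \<phi> 1 u) powr t))"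

definition upper_pressure ::
  "'a::euclidean_space set \<Rightarrow> (nat \<Rightarrow> nat \<Rightarrow> 'a \<Rightarrow> 'a) \<Rightarrow> real \<Rightarrow> ereal" where
  "upper_pressure J \<phi> t = limsup (\<lambda>k. ereal (1 / real k) * eln (word_sum J \<phi> t k))"

definition lower_pressure ::
  "'a::euclidean_space set \<Rightarrow> (nat \<Rightarrow> nat \<Rightarrow> 'a \<Rightarrow> 'a) \<Rightarrow> real \<Rightarrow> ereal" where
  "lower_pressure J \<phi> t = liminf (\<lambda>k. ereal (1 / real k) * eln (word_sum J \<phi> t k))"

text \<open>\<open>t\<close> ranges over all reals, but for \<open>t \<le> 0\<close> the sums over the infinite sets \<open>words k\<close>
  diverge and the pressures are \<open>\<infinity>\<close>. The pressures are strictly decreasing in \<open>t\<close> where finite, so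
  these infima equal the suprema of the \<open>t\<close> with positive pressure.\<close>

definition upper_critical ::
  "'a::euclidean_space set \<Rightarrow> (nat \<Rightarrow> nat \<Rightarrow> 'a \<Rightarrow> 'a) \<Rightarrow> ereal" where
  "upper_critical J \<phi> = Inf {ereal t | t. upper_pressure J \<phi> t < 0}"

definition lower_critical ::
  "'a::euclidean_space set \<Rightarrow> (nat \<Rightarrow> nat \<Rightarrow> 'a \<Rightarrow> 'a) \<Rightarrow> ereal" where
  "lower_critical J \<phi> = Inf {ereal t | t. lower_pressure J \<phi> t < 0}"

end

theory Submission
  imports Defs
begin

text \<open>
  Write \<open>N(u)\<close> for the supremum over \<open>J\<close> of the derivative of \<open>\<phi>\<^sub>u\<close>. Bounded distortion makes \<open>N\<close>
  multiplicative under concatenation of words up to one constant \<open>C\<close>, contraction gives \<open>N(u) \<le> c\<^sup>n\<close>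
  for words of length \<open>n\<close>, and each cylinder \<open>J\<^sub>u\<close> has diameter at most of the order of \<open>N(u)\<close> and
  contains a ball of radius of this order (\<open>conformal_cylinder_system\<close>). The translations do not
  affect sizes, and the open set condition makes the interiors of the cylinders of one level
  disjoint. The dimension estimates rest on these facts.

  Covering the attractor by the cylinders of one level shows that the Hausdorff dimension is at most
  the lower critical exponent. The lower bounds come from compact subsets of the attractor. Allow at
  level \<open>n\<close> only the letters up to \<open>M\<^sub>n\<close> to the power \<open>- \<epsilon>\<close>, finitely many, where \<open>M\<^sub>n\<close> is the
  supremum of the \<open>N(u)\<close> over the words of length \<open>n\<close>. The hypotheses on the level sums say that the
  letters kept at level \<open>n\<close> carry a proportion tending to \<open>1\<close> of a finite level sum, or a sum
  tending to infinity if the level sums are infinite. In the second case quasi-multiplicativity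
  bounds the truncated sums below by products of factors tending to infinity. In the first case,
  replacing the alphabets one level after the other costs a factor tending to \<open>1\<close> per level, because
  only the current level is affected up to the constant from quasi-multiplicativity
  (\<open>shrink_one_level\<close>). The total loss is subexponential, and it is outweighed by the exponential
  gain from lowering the exponent from \<open>t\<close> to \<open>t'\<close>, since \<open>N(u) \<le> c\<^sup>n\<close>. So below the upper critical
  exponent the truncated sums with exponent \<open>t'\<close> are unbounded, and below the lower critical
  exponent they are bounded away from \<open>0\<close> (\<open>truncated_growth\<close>).

  The packing dimension is at most the upper box dimension because the balls of one dyadic size in a
  packing are no more numerous than the sets in a cover at a comparable scale; the attractor is
  nonempty, so the upper box dimension is not \<open>- \<infinity>\<close> (\<open>packing_dim_le_upper_box_dim\<close>). For the lower
  bound on the packing dimension, a large sum over the words of length \<open>n\<close> forces, by comparison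
  with a geometric series over the dyadic scales, a scale \<open>r\<close> with many words of weight about \<open>r\<close>
  (\<open>large_packing\<close>). Their cylinders overlap boundedly near each point, which yields large packings
  by balls of radius \<open>r\<close>. The same holds inside each cylinder, and Baire's theorem passes from the
  premeasure to the packing measure.

  For the Hausdorff dimension, give each word of length \<open>n\<close> a mass proportional to \<open>N(u)\<close> to the
  power \<open>t'\<close>. A ball of radius \<open>r\<close> meets cylinders of very different sizes. Cut each word at the
  first prefix of weight at most \<open>r\<close>. The parents of these prefixes have cylinders larger than the
  ball, and only logarithmically many levels and scales occur, with boundedly many cylinders for
  each. The number of children of a parent is bounded by the size of the truncated alphabet, and the
  hypothesis on the logarithms bounds this size by a small power of \<open>1 / r\<close> (\<open>card_trunc_bound\<close>).
  Hence the mass of the ball is at most a constant times \<open>r\<close> to the power \<open>s\<close> for each \<open>s < t'\<close>, if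
  \<open>\<epsilon>\<close> is small (\<open>ball_weight_bound\<close>), and the mass distribution principle applies.
\<close>

section \<open>Words over finite alphabets and quasi-multiplicative weights\<close>

definition words_over :: "(nat \<Rightarrow> nat set) \<Rightarrow> nat \<Rightarrow> nat \<Rightarrow> nat list set" where
  "words_over A l n = {u. length u = n \<and> (\<forall>i<n. u ! i \<in> A (l + i))}"

definition alphabets :: "(nat \<Rightarrow> nat set) \<Rightarrow> bool" where
  "alphabets A \<longleftrightarrow> (\<forall>k\<ge>1. finite (A k) \<and> A k \<noteq> {} \<and> A k \<subseteq> {1..})"

lemma alphabetsD:
  assumes "alphabets A" "k \<ge> 1"
  shows "finite (A k)" "A k \<noteq> {}" "A k \<subseteq> {1..}"
  using assms by (auto simp: alphabets_def)

lemma words_over_0 [simp]: "words_over A l 0 = {[]}"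
  by (auto simp: words_over_def)

lemma words_over_1: "words_over A l (Suc 0) = (\<lambda>j. [j]) ` A l"
  by (force simp: words_over_def length_Suc_conv)

lemma append_in_words_over:
  "a \<in> words_over A l m \<Longrightarrow> v \<in> words_over A (l + m) n \<Longrightarrow> a @ v \<in> words_over A l (m + n)"
  unfolding words_over_def by (auto simp: nth_append) (metis add.assoc add_diff_inverse_nat nat_add_left_cancel_less)

lemma words_over_add:
  "bij_betw (\<lambda>(a, v). a @ v) (words_over A l m \<times> words_over A (l + m) n) (words_over A l (m + n))"
proof (rule bij_betw_imageI)
  show "inj_on (\<lambda>(a, v). a @ v) (words_over A l m \<times> words_over A (l + m) n)"
    by (auto simp: inj_on_def words_over_def)
  have "\<exists>a\<in>words_over A l m. \<exists>v\<in>words_over A (l + m) n. w = a @ v" if "w \<in> words_over A l (m + n)" for w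
  proof (intro bexI)
    show "w = take m w @ drop m w" by simp
    show "take m w \<in> words_over A l m" "drop m w \<in> words_over A (l + m) n"
      using that by (auto simp: words_over_def add.assoc)
  qed
  then show "(\<lambda>(a, v). a @ v) ` (words_over A l m \<times> words_over A (l + m) n) = words_over A l (m + n)"
    by (force simp: append_in_words_over)
qed

lemma finite_words_over:
  assumes "alphabets A" "l \<ge> 1" shows "finite (words_over A l n)"
proof (induction n)
  case (Suc n)
  have "finite (words_over A l (n + 1))"
    using bij_betw_finite[OF words_over_add[of A l n 1]] Suc assms
    by (simp add: words_over_1 alphabetsD)
  then show ?case by simp
qed simp

lemma words_over_nonempty:
  assumes "alphabets A" "l \<ge> 1" shows "words_over A l n \<noteq> {}"
proof (induction n)
  case (Suc n)
  then obtain a where "a \<in> words_over A l n" by blast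
  moreover obtain j where "j \<in> A (l + n)" using alphabetsD(2)[OF assms(1), of "l + n"] assms(2) by auto
  ultimately have "a @ [j] \<in> words_over A l (n + 1)"
    by (intro append_in_words_over) (auto simp: words_over_1)
  then show ?case by auto
qed simp

lemma words_over_subset:
  assumes "alphabets A" "l \<ge> 1" "u \<in> words_over A l n" shows "set u \<subseteq> {1..}"
proof
  fix x assume "x \<in> set u"
  then obtain i where "i < n" "x = u ! i" using assms(3) by (auto simp: words_over_def in_set_conv_nth)
  then show "x \<in> {1..}" using assms alphabetsD(3)[OF assms(1), of "l + i"] by (auto simp: words_over_def)
qed

lemma words_over_length: "u \<in> words_over A l n \<Longrightarrow> length u = n"
  by (simp add: words_over_def)

lemma words_over_words: "alphabets A \<Longrightarrow> u \<in> words_over A 1 n \<Longrightarrow> u \<in> words n"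
  using words_over_subset[of A 1 u n] by (auto simp: words_def words_over_length)

lemma take_in_words_over: "u \<in> words_over A l n \<Longrightarrow> m \<le> n \<Longrightarrow> take m u \<in> words_over A l m"
  by (auto simp: words_over_def)

lemma drop_in_words_over: "u \<in> words_over A l n \<Longrightarrow> m \<le> n \<Longrightarrow> drop m u \<in> words_over A (l + m) (n - m)"
  by (auto simp: words_over_def add.assoc)

lemma sum_words_over_add:
  "(\<Sum>u\<in>words_over A l (m + n). f u) = (\<Sum>a\<in>words_over A l m. \<Sum>v\<in>words_over A (l + m) n. f (a @ v))"
  unfolding sum.cartesian_product
  by (rule sum.reindex_bij_betw[OF words_over_add, symmetric, THEN trans])
     (simp add: split_beta)

lemma sum_words_over_1: "(\<Sum>u\<in>words_over A l (Suc 0). f u) = (\<Sum>j\<in>A l. f [j])"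
  unfolding words_over_1 by (subst sum.reindex) (auto simp: inj_on_def)

lemma words_over_cong:
  "(\<And>i. l \<le> i \<Longrightarrow> i < l + n \<Longrightarrow> A i = B i) \<Longrightarrow> words_over A l n = words_over B l n"
  by (auto simp: words_over_def)

text \<open>For factors tending to \<open>1\<close> this will be used with \<open>q\<close> slightly below \<open>1\<close>, for factors tending to
  infinity with \<open>q > 1\<close>. The constant \<open>b\<close> absorbs the finitely many factors below \<open>q\<close>.\<close>

lemma prod_ge_exp:
  fixes g :: "nat \<Rightarrow> real"
  assumes pos: "\<And>k. k \<ge> 1 \<Longrightarrow> 0 < g k" and q: "0 < q" and ev: "eventually (\<lambda>k. q \<le> g k) sequentially"
  shows "\<exists>b>0. \<forall>n. b * q ^ n \<le> (\<Prod>k\<in>{1..n}. g k)"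
proof -
  obtain k0 where k0: "\<And>k. k \<ge> k0 \<Longrightarrow> q \<le> g k" using ev by (auto simp: eventually_sequentially)
  define r where "r = (\<lambda>n. (\<Prod>k\<in>{1..n}. g k) / q ^ n)"
  have rpos: "r n > 0" for n unfolding r_def using pos q by (auto intro!: divide_pos_pos prod_pos)
  have step: "r n \<le> r (Suc n)" if "n \<ge> k0" for n
  proof -
    have "r (Suc n) = r n * (g (Suc n) / q)" using q by (simp add: r_def field_simps)
    moreover have "1 \<le> g (Suc n) / q" using k0[of "Suc n"] that q by (simp add: field_simps)
    ultimately show ?thesis using rpos[of n] by (metis mult.right_neutral mult_left_mono less_imp_le)
  qed
  define b where "b = Min (r ` {..k0})"
  have "b > 0" unfolding b_def using rpos by (subst Min_gr_iff) auto
  moreover have "b \<le> r n" for n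
  proof (cases "n \<le> k0")
    case True then show ?thesis unfolding b_def by (intro Min_le) auto
  next
    case False
    then have "k0 \<le> n" by simp
    then have "r k0 \<le> r n"
      by (induction rule: dec_induct) (use step order_trans in auto)
    moreover have "b \<le> r k0" unfolding b_def by (intro Min_le) auto
    ultimately show ?thesis by simp
  qed
  ultimately show ?thesis using q by (intro exI[of _ b]) (auto simp: r_def field_simps)
qed

text \<open>The number \<open>N l u\<close> stands for the largest derivative of the composition of the maps given by the
  word \<open>u\<close>, whose first letter belongs to level \<open>l\<close>. The constant \<open>C\<close> bounds the distortion, and
  \<open>c\<close> is the contraction ratio.\<close>

locale quasi_multiplicative =
  fixes N :: "nat \<Rightarrow> nat list \<Rightarrow> real" and C c :: real
  assumes C: "C \<ge> 1" and c: "0 < c" "c < 1"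
    and N_pos: "\<And>l u. l \<ge> 1 \<Longrightarrow> set u \<subseteq> {1..} \<Longrightarrow> 0 < N l u"
    and N_Nil: "\<And>l. N l [] = 1"
    and N_append_le: "\<And>l u v. l \<ge> 1 \<Longrightarrow> set u \<subseteq> {1..} \<Longrightarrow> set v \<subseteq> {1..} \<Longrightarrow>
          N l (u @ v) \<le> N l u * N (l + length u) v"
    and N_append_ge: "\<And>l u v. l \<ge> 1 \<Longrightarrow> set u \<subseteq> {1..} \<Longrightarrow> set v \<subseteq> {1..} \<Longrightarrow>
          N l u * N (l + length u) v \<le> C * N l (u @ v)"
    and N_single: "\<And>l j. l \<ge> 1 \<Longrightarrow> j \<ge> 1 \<Longrightarrow> N l [j] \<le> c"
begin

lemma N_le_power:
  assumes "l \<ge> 1" "set u \<subseteq> {1..}" shows "N l u \<le> c ^ length u"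
  using assms
proof (induction u arbitrary: l)
  case (Cons j u)
  have "N l ([j] @ u) \<le> N l [j] * N (l + 1) u"
    using N_append_le[of l "[j]" u] Cons.prems by simp
  also have "\<dots> \<le> c * c ^ length u"
    using Cons N_single[of l j] N_pos[of "l+1" u] c by (intro mult_mono) auto
  finally show ?case by simp
qed (simp add: N_Nil)

lemma N_le_1: "l \<ge> 1 \<Longrightarrow> set u \<subseteq> {1..} \<Longrightarrow> N l u \<le> 1"
  using N_le_power[of l u] c by (meson less_imp_le order_trans power_le_one)

text \<open>As \<open>N 1 u \<le> c ^ n\<close>, lowering the exponent multiplies each term by a factor that grows
  exponentially in \<open>n\<close>.\<close>

lemma powr_exponent_drop:
  assumes "u \<in> words n" "t' \<le> t"
  shows "N 1 u powr t * (c powr (t' - t)) ^ n \<le> N 1 u powr t'"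
proof -
  have u: "0 < N 1 u" "N 1 u \<le> c ^ n"
    using assms N_pos[of 1 u] N_le_power[of 1 u] by (auto simp: words_def)
  have "(c powr (t' - t)) ^ n = (c ^ n) powr (t' - t)"
    using c by (simp add: powr_powr powr_realpow[symmetric] mult.commute)
  also have "\<dots> \<le> N 1 u powr (t' - t)"
    using u assms(2) by (intro powr_mono2') auto
  finally have "N 1 u powr t * (c powr (t' - t)) ^ n \<le> N 1 u powr t * N 1 u powr (t' - t)"
    by (intro mult_left_mono) auto
  also have "\<dots> = N 1 u powr t'" using u by (simp add: powr_add[symmetric])
  finally show ?thesis .
qed

definition wsum :: "(nat \<Rightarrow> nat set) \<Rightarrow> real \<Rightarrow> nat \<Rightarrow> nat \<Rightarrow> real" where
  "wsum A t l n = (\<Sum>u\<in>words_over A l n. N l u powr t)"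

lemma wsum_0 [simp]: "wsum A t l 0 = 1"
  by (simp add: wsum_def N_Nil)

lemma wsum_1: "wsum A t l (Suc 0) = (\<Sum>j\<in>A l. N l [j] powr t)"
  by (simp add: wsum_def sum_words_over_1)

lemma wsum_pos: "alphabets A \<Longrightarrow> l \<ge> 1 \<Longrightarrow> 0 < wsum A t l n"
  unfolding wsum_def using words_over_subset N_pos
  by (intro sum_pos finite_words_over words_over_nonempty) fastforce+

lemma powr_append_le:
  assumes "t \<ge> 0" "l \<ge> 1" "set u \<subseteq> {1..}" "set v \<subseteq> {1..}"
  shows "N l (u @ v) powr t \<le> N l u powr t * N (l + length u) v powr t"
proof -
  have "N l (u @ v) powr t \<le> (N l u * N (l + length u) v) powr t"
    using assms N_pos[of l "u @ v"] N_append_le by (intro powr_mono2) auto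
  then show ?thesis using assms N_pos[of l u] N_pos[of "l + length u" v] by (simp add: powr_mult)
qed

lemma powr_append_ge:
  assumes "t \<ge> 0" "l \<ge> 1" "set u \<subseteq> {1..}" "set v \<subseteq> {1..}"
  shows "N l u powr t * N (l + length u) v powr t \<le> C powr t * N l (u @ v) powr t"
proof -
  have p: "N l u > 0" "N (l + length u) v > 0" "N l (u @ v) > 0" using assms N_pos by auto
  have "(N l u * N (l + length u) v) powr t \<le> (C * N l (u @ v)) powr t"
    using assms p N_append_ge by (intro powr_mono2) auto
  then show ?thesis using p C by (simp add: powr_mult)
qed

lemma wsum_add_ge:
  assumes "alphabets A" "t \<ge> 0" "l \<ge> 1"
  shows "wsum A t l m * wsum A t (l + m) n \<le> C powr t * wsum A t l (m + n)"
proof -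
  have "wsum A t l m * wsum A t (l + m) n =
    (\<Sum>a\<in>words_over A l m. \<Sum>v\<in>words_over A (l + m) n. N l a powr t * N (l + m) v powr t)"
    by (simp add: wsum_def sum_product)
  also have "\<dots> \<le> (\<Sum>a\<in>words_over A l m. \<Sum>v\<in>words_over A (l + m) n. C powr t * N l (a @ v) powr t)"
    using assms powr_append_ge words_over_subset[of A l _ m] words_over_subset[of A "l + m" _ n]
    by (intro sum_mono) (metis words_over_length trans_le_add1)
  also have "\<dots> = C powr t * wsum A t l (m + n)"
    by (simp add: wsum_def sum_words_over_add sum_distrib_left)
  finally show ?thesis .
qed

text \<open>Up to \<open>C powr t\<close>, the levels after \<open>m\<close> contribute the same factor to the extensions of each word
  of length \<open>m\<close>. It cancels in the proportion of the total weight that extends \<open>v\<close>.\<close>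

lemma extension_weight_le:
  assumes "alphabets A" "t \<ge> 0" "v \<in> words_over A 1 m"
  shows "wsum A t 1 m * (\<Sum>w\<in>words_over A (1 + m) n. N 1 (v @ w) powr t)
           \<le> C powr t * N 1 v powr t * wsum A t 1 (m + n)"
proof -
  have "(\<Sum>w\<in>words_over A (1 + m) n. N 1 (v @ w) powr t) \<le>
        (\<Sum>w\<in>words_over A (1 + m) n. N 1 v powr t * N (1 + m) w powr t)"
    using assms words_over_subset[of A 1 v m] words_over_subset[of A "1 + m" _ n]
      powr_append_le[of t 1 v] words_over_length[of v A 1 m]
    by (intro sum_mono) auto
  also have "\<dots> = N 1 v powr t * wsum A t (1 + m) n"
    by (simp add: wsum_def sum_distrib_left)
  finally have "wsum A t 1 m * (\<Sum>w\<in>words_over A (1 + m) n. N 1 (v @ w) powr t)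
      \<le> N 1 v powr t * (wsum A t 1 m * wsum A t (1 + m) n)"
    using wsum_pos[OF assms(1), of 1 t m] by (simp add: mult.left_commute)
  also have "\<dots> \<le> N 1 v powr t * (C powr t * wsum A t 1 (m + n))"
    using wsum_add_ge[OF assms(1,2), of 1 m n] by (intro mult_left_mono) auto
  finally show ?thesis by (simp add: mult_ac)
qed

text \<open>By the same cancellation the extensions of a fixed word keep at least a fixed proportion of the
  total weight, however long they are.\<close>

lemma extension_weight_ge:
  assumes "alphabets A" "t \<ge> 0" "v \<in> words_over A 1 m"
  shows "N 1 v powr t * wsum A t 1 (m + n)
    \<le> C powr t * wsum A t 1 m * (\<Sum>w\<in>words_over A (1 + m) n. N 1 (v @ w) powr t)"
proof -
  have "wsum A t 1 (m + n) \<le> wsum A t 1 m * wsum A t (1 + m) n"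
  proof -
    have "wsum A t 1 (m + n) = (\<Sum>a\<in>words_over A 1 m. \<Sum>v\<in>words_over A (1 + m) n. N 1 (a @ v) powr t)"
      by (simp add: wsum_def sum_words_over_add)
    also have "\<dots> \<le> (\<Sum>a\<in>words_over A 1 m. \<Sum>v\<in>words_over A (1 + m) n. N 1 a powr t * N (1 + m) v powr t)"
      using assms(1,2) words_over_subset[of A 1 _ m] words_over_subset[of A "1 + m" _ n]
      by (intro sum_mono) (metis le_refl le_add1 powr_append_le words_over_length)
    finally show ?thesis by (simp add: wsum_def sum_product)
  qed
  then have "N 1 v powr t * wsum A t 1 (m + n) \<le> wsum A t 1 m * (N 1 v powr t * wsum A t (1 + m) n)"
    by (simp add: mult_left_mono mult.left_commute)
  also have "N 1 v powr t * wsum A t (1 + m) n = (\<Sum>w\<in>words_over A (1 + m) n. N 1 v powr t * N (1 + m) w powr t)"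
    by (simp add: wsum_def sum_distrib_left)
  also have "\<dots> \<le> (\<Sum>w\<in>words_over A (1 + m) n. C powr t * N 1 (v @ w) powr t)"
    using assms words_over_subset[of A 1 v m] words_over_subset[of A "1 + m" _ n]
      powr_append_ge[of t 1 v] words_over_length[of v A 1 m]
    by (intro sum_mono) auto
  finally show ?thesis
    using wsum_pos[OF assms(1), of 1 t m] by (simp add: sum_distrib_left mult_ac)
qed

section \<open>Truncating the alphabets\<close>

text \<open>Shrinking the alphabet of the single level \<open>k = m + 1\<close> from \<open>B\<close> to \<open>A\<close>. Up to the constant
  \<open>C powr (2 * t)\<close>, the weight of a word is the product of the weights of its part before level
  \<open>k\<close>, its letter at level \<open>k\<close> and its part after level \<open>k\<close>. The words lost are therefore at most
  the proportion \<open>C powr (2 * t) * (1 - \<rho>)\<close> of all words, and the words kept are at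
  least the proportion \<open>\<rho> / C powr (2 * t)\<close>. The first estimate leaves a factor near
  \<open>1\<close> for \<open>\<rho>\<close> near \<open>1\<close>, the second one is positive for every \<open>\<rho> > 0\<close>.\<close>

definition loss :: "real \<Rightarrow> real \<Rightarrow> real" where
  "loss t \<rho> = max (\<rho> / C powr (2 * t)) (1 - C powr (2 * t) * (1 - \<rho>))"

lemma shrink_one_level:
  assumes A: "alphabets A" and B: "alphabets B" and sub: "A k \<subseteq> B k"
    and eq: "\<And>i. i \<noteq> k \<Longrightarrow> A i = B i" and k: "k = Suc m" and t: "t \<ge> 0"
    and \<rho>: "\<rho> * (\<Sum>j\<in>B k. N k [j] powr t) \<le> (\<Sum>j\<in>A k. N k [j] powr t)"
  shows "loss t \<rho> * wsum B t 1 (k + n) \<le> wsum A t 1 (k + n)"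
proof -
  define K where "K = C powr (2 * t)"
  define P where "P = words_over B 1 m"
  define Q where "Q = words_over B (Suc k) n"
  define f where "f = (\<lambda>a j v. N 1 (a @ [j] @ v) powr t)"
  define \<beta> where "\<beta> = (\<lambda>X. \<Sum>j\<in>X. N k [j] powr t)"
  define S where "S = (\<lambda>X. \<Sum>a\<in>P. \<Sum>j\<in>X. \<Sum>v\<in>Q. f a j v)"
  have K1: "K \<ge> 1" using C t by (simp add: K_def ge_one_powr_ge_zero)
  have Kt: "K = C powr t * C powr t" by (simp add: K_def powr_add[symmetric])
  have split: "wsum X t 1 (k + n) = S (X k)" if "X = A \<or> X = B" for X
  proof -
    have 1: "words_over X 1 m = P" "words_over X (Suc k) n = Q" unfolding P_def Q_def
      using that eq k by (auto intro!: words_over_cong)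
    have "wsum X t 1 (m + (1 + n)) = S (X k)" unfolding wsum_def sum_words_over_add S_def f_def
      by (simp add: sum_words_over_1 1[simplified] k 1[simplified k])
    then show ?thesis by (simp add: k)
  qed
  have kA: "k \<ge> 1" using k by simp
  have fin: "finite (A k)" "finite (B k)" using alphabetsD(1)[OF A kA] alphabetsD(1)[OF B kA] by auto
  have mem: "set a \<subseteq> {1..}" "length a = m" if "a \<in> P" for a
    using that words_over_subset[OF B, of 1 a m] by (auto simp: P_def words_over_length)
  have memv: "set v \<subseteq> {1..}" if "v \<in> Q" for v
    using that words_over_subset[OF B, of "Suc k" v n] by (auto simp: Q_def)
  have Bk: "j \<ge> 1" if "j \<in> B k" for j using that alphabetsD(3)[OF B kA] by auto
  define Z where "Z = (\<Sum>a\<in>P. N 1 a powr t) * (\<Sum>v\<in>Q. N (Suc k) v powr t)"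
  have Z0: "Z \<ge> 0" unfolding Z_def by (intro mult_nonneg_nonneg sum_nonneg) auto
  have prodform: "Z * \<beta> X = (\<Sum>a\<in>P. \<Sum>j\<in>X. \<Sum>v\<in>Q. N 1 a powr t * N k [j] powr t * N (Suc k) v powr t)" for X
    unfolding Z_def \<beta>_def
    by (simp add: sum_distrib_left sum_distrib_right mult_ac sum.swap[of _ Q X] sum.swap[of _ Q P])
  have up: "S X \<le> Z * \<beta> X" if "X \<subseteq> B k" for X
    unfolding prodform S_def f_def
  proof (intro sum_mono)
    fix a j v assume ajv: "a \<in> P" "j \<in> X" "v \<in> Q"
    have j: "j \<ge> 1" using ajv that Bk by auto
    have "N 1 (a @ [j] @ v) powr t \<le> N 1 a powr t * N k ([j] @ v) powr t"
      using powr_append_le[of t 1 a "[j] @ v"] t mem[OF ajv(1)] memv[OF ajv(3)] j k by simp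
    also have "\<dots> \<le> N 1 a powr t * (N k [j] powr t * N (Suc k) v powr t)"
      using powr_append_le[of t k "[j]" v] t memv[OF ajv(3)] j k by (intro mult_left_mono) auto
    finally show "N 1 (a @ [j] @ v) powr t \<le> N 1 a powr t * N k [j] powr t * N (Suc k) v powr t"
      by (simp add: mult_ac)
  qed
  have low: "Z * \<beta> X \<le> K * S X" if "X \<subseteq> B k" for X
    unfolding prodform S_def f_def sum_distrib_left
  proof (intro sum_mono)
    fix a j v assume ajv: "a \<in> P" "j \<in> X" "v \<in> Q"
    have j: "j \<ge> 1" using ajv that Bk by auto
    have "N 1 a powr t * (N k [j] powr t * N (Suc k) v powr t) \<le> N 1 a powr t * (C powr t * N k ([j] @ v) powr t)"
      using powr_append_ge[of t k "[j]" v] t memv[OF ajv(3)] j k by (intro mult_left_mono) auto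
    also have "\<dots> = C powr t * (N 1 a powr t * N k ([j] @ v) powr t)" by simp
    also have "\<dots> \<le> C powr t * (C powr t * N 1 (a @ [j] @ v) powr t)"
      using powr_append_ge[of t 1 a "[j] @ v"] t mem[OF ajv(1)] memv[OF ajv(3)] j k
      by (intro mult_left_mono) auto
    finally show "N 1 a powr t * N k [j] powr t * N (Suc k) v powr t \<le> K * N 1 (a @ [j] @ v) powr t"
      by (simp add: mult_ac Kt)
  qed
  have diff: "S (B k) = S (A k) + S (B k - A k)" "\<beta> (B k) = \<beta> (A k) + \<beta> (B k - A k)"
    unfolding S_def \<beta>_def sum.distrib[symmetric]
    using fin sub by (auto intro!: sum.cong simp: sum.subset_diff[OF sub] add.commute)
  have \<rho>': "\<rho> * \<beta> (B k) \<le> \<beta> (A k)" using \<rho> by (simp add: \<beta>_def)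
  have S0: "S X \<ge> 0" for X unfolding S_def f_def by (intro sum_nonneg) auto
  have b0: "\<beta> X \<ge> 0" for X unfolding \<beta>_def by (intro sum_nonneg) auto
  have one: "\<rho> / K * S (B k) \<le> S (A k)"
  proof (cases "\<rho> \<ge> 0")
    case True
    have "\<rho> * S (B k) \<le> \<rho> * (Z * \<beta> (B k))" using up[of "B k"] True by (intro mult_left_mono) auto
    also have "\<dots> \<le> Z * \<beta> (A k)" using \<rho>' Z0 by (metis mult.left_commute mult_left_mono)
    also have "\<dots> \<le> K * S (A k)" by (rule low[OF sub])
    finally show ?thesis using K1 by (simp add: field_simps)
  next
    case False
    then have "\<rho> / K * S (B k) \<le> 0" using K1 S0[of "B k"] by (simp add: mult_nonpos_nonneg divide_nonpos_pos)
    then show ?thesis using S0[of "A k"] by linarith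
  qed
  have two: "(1 - K * (1 - \<rho>)) * S (B k) \<le> S (A k)"
  proof (cases "\<rho> \<le> 1")
    case True
    have "S (B k - A k) \<le> Z * \<beta> (B k - A k)" by (intro up) auto
    also have "\<dots> \<le> Z * ((1 - \<rho>) * \<beta> (B k))" using \<rho>' diff(2) Z0 by (intro mult_left_mono) (auto simp: algebra_simps)
    also have "\<dots> \<le> (1 - \<rho>) * (K * S (B k))" using mult_left_mono[OF low[of "B k"], of "1 - \<rho>"] True by (simp add: mult_ac)
    finally show ?thesis using diff(1) by (simp add: algebra_simps)
  next
    case False
    have "\<beta> (B k) > 0" unfolding \<beta>_def using fin alphabetsD(2)[OF B kA] Bk N_pos[of k "[_]"] kA
      by (intro sum_pos) fastforce+
    moreover have "\<beta> (A k) \<le> \<beta> (B k)" using diff(2) b0[of "B k - A k"] by simp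
    ultimately have "\<rho> \<le> 1" using \<rho>' by (metis mult.commute mult_le_cancel_left_pos mult.right_neutral order_trans)
    then show ?thesis using False by simp
  qed
  have "wsum A t 1 (k + n) = S (A k)" "wsum B t 1 (k + n) = S (B k)" by (simp_all only: split simp_thms)
  then show ?thesis unfolding loss_def K_def[symmetric]
    using one two by (simp add: max_def)
qed

lemma shrink_all_levels:
  assumes A: "alphabets A" and B: "alphabets B" and sub: "\<And>k. k \<ge> 1 \<Longrightarrow> A k \<subseteq> B k" and t: "t \<ge> 0"
    and \<rho>0: "\<And>k. k \<ge> 1 \<Longrightarrow> 0 < \<rho> k"
    and \<rho>: "\<And>k. k \<ge> 1 \<Longrightarrow> \<rho> k * (\<Sum>j\<in>B k. N k [j] powr t) \<le> (\<Sum>j\<in>A k. N k [j] powr t)"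
  shows "(\<Prod>k\<in>{1..n}. loss t (\<rho> k)) * wsum B t 1 n \<le> wsum A t 1 n"
proof -
  define X where "X = (\<lambda>k i. if i \<le> k then A i else B i)"
  have X: "alphabets (X k)" for k using A B by (auto simp: alphabets_def X_def)
  have "(\<Prod>k\<in>{1..k}. loss t (\<rho> k)) * wsum (X 0) t 1 n \<le> wsum (X k) t 1 n" if "k \<le> n" for k
    using that
  proof (induction k)
    case (Suc k)
    have lp: "loss t (\<rho> (Suc k)) \<ge> 0"
      using \<rho>0[of "Suc k"] by (auto simp: loss_def intro: max.coboundedI1)
    have "(\<Prod>k\<in>{1..Suc k}. loss t (\<rho> k)) * wsum (X 0) t 1 n
        = loss t (\<rho> (Suc k)) * ((\<Prod>k\<in>{1..k}. loss t (\<rho> k)) * wsum (X 0) t 1 n)"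
      by simp
    also have "\<dots> \<le> loss t (\<rho> (Suc k)) * wsum (X k) t 1 n"
      using Suc lp by (intro mult_left_mono) auto
    also have "\<dots> = loss t (\<rho> (Suc k)) * wsum (X k) t 1 (Suc k + (n - Suc k))"
      using Suc.prems by simp
    also have "\<dots> \<le> wsum (X (Suc k)) t 1 (Suc k + (n - Suc k))"
      by (rule shrink_one_level[OF X X _ _ refl t]) (use sub \<rho> in \<open>auto simp: X_def\<close>)
    finally show ?case using Suc.prems by simp
  qed simp
  from this[of n] show ?thesis
    using words_over_cong[of 1 n "X 0" B] words_over_cong[of 1 n "X n" A]
    by (auto simp: wsum_def X_def)
qed

text \<open>Since \<open>loss t\<close> is continuous and equals \<open>1\<close> at \<open>1\<close>, the factors for the single levels tend to
  \<open>1\<close>. The full alphabets enter only through the finite families \<open>F\<close> of words, whose letters can be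
  added to the alphabets \<open>A\<close> without leaving the finite setting.\<close>

lemma truncation_convergent:
  assumes A: "alphabets A" and t: "t \<ge> 0" and q: "0 < q" "q < 1"
    and \<rho>0: "\<And>k. k \<ge> 1 \<Longrightarrow> 0 < \<rho> k" and \<rho>1: "\<rho> \<longlonglongrightarrow> 1"
    and \<rho>: "\<And>k F. k \<ge> 1 \<Longrightarrow> finite F \<Longrightarrow> F \<subseteq> {1..} \<Longrightarrow>
      \<rho> k * (\<Sum>j\<in>F. N k [j] powr t) \<le> (\<Sum>j\<in>A k. N k [j] powr t)"
  shows "\<exists>b>0. \<forall>n F. finite F \<longrightarrow> F \<subseteq> words n \<longrightarrow> b * q ^ n * (\<Sum>u\<in>F. N 1 u powr t) \<le> wsum A t 1 n"
proof -
  have "(\<lambda>k. loss t (\<rho> k)) \<longlonglongrightarrow> max (1 / C powr (2 * t)) (1 - C powr (2 * t) * (1 - 1))"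
    unfolding loss_def by (intro tendsto_intros \<rho>1) (use C in auto)
  also have "max (1 / C powr (2 * t)) (1 - C powr (2 * t) * (1 - 1)) = 1"
    using C t by (simp add: max_def ge_one_powr_ge_zero field_simps)
  finally have ev: "eventually (\<lambda>k. q \<le> loss t (\<rho> k)) sequentially"
    using q by (auto dest!: order_tendstoD(1)[of _ _ _ q] elim: eventually_mono)
  have "0 < loss t (\<rho> k)" if "k \<ge> 1" for k
    using \<rho>0[OF that] C by (auto simp: loss_def less_max_iff_disj)
  from prod_ge_exp[OF this q(1) ev] obtain b where b: "b > 0"
    "\<And>n. b * q ^ n \<le> (\<Prod>k\<in>{1..n}. loss t (\<rho> k))" by auto
  have "b * q ^ n * (\<Sum>u\<in>F. N 1 u powr t) \<le> wsum A t 1 n" if F: "finite F" "F \<subseteq> words n" for n F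
  proof -
    define L where "L = \<Union> (set ` F)"
    have L: "finite L" "L \<subseteq> {1..}" using F by (auto simp: L_def words_def)
    define B where "B = (\<lambda>k. A k \<union> L)"
    have B: "alphabets B" using A L by (auto simp: alphabets_def B_def)
    have "F \<subseteq> words_over B 1 n" using F nth_mem unfolding words_over_def B_def L_def words_def by fastforce
    then have "(\<Sum>u\<in>F. N 1 u powr t) \<le> wsum B t 1 n" unfolding wsum_def
      by (intro sum_mono2 finite_words_over[OF B]) auto
    moreover have "0 \<le> b * q ^ n" using b(1) q by simp
    ultimately have "b * q ^ n * (\<Sum>u\<in>F. N 1 u powr t) \<le> (\<Prod>k\<in>{1..n}. loss t (\<rho> k)) * wsum B t 1 n"
      using b(2)[of n] by (intro mult_mono sum_nonneg) (auto intro: order_trans)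
    also have "\<dots> \<le> wsum A t 1 n"
      by (rule shrink_all_levels[OF A B _ t \<rho>0]) (use \<rho> alphabetsD[OF B] in \<open>auto simp: B_def\<close>)
    finally show ?thesis .
  qed
  with b(1) show ?thesis by blast
qed

lemma truncation_divergent:
  assumes A: "alphabets A" and t: "t \<ge> 0" and R: "R > 0"
    and lim: "filterlim (\<lambda>k. \<Sum>j\<in>A k. N k [j] powr t) at_top sequentially"
  shows "\<exists>b>0. \<forall>n. b * R ^ n \<le> wsum A t 1 n"
proof -
  define g where "g = (\<lambda>k. (\<Sum>j\<in>A k. N k [j] powr t) / C powr t)"
  have pos: "0 < g k" if "k \<ge> 1" for k
    using wsum_pos[OF A that, of t 1] C by (simp add: g_def wsum_1)
  have "eventually (\<lambda>k. R * C powr t \<le> (\<Sum>j\<in>A k. N k [j] powr t)) sequentially"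
    using lim by (simp add: filterlim_at_top)
  then have ev: "eventually (\<lambda>k. R \<le> g k) sequentially"
    by eventually_elim (use C in \<open>simp add: g_def field_simps\<close>)
  have le: "(\<Prod>k\<in>{1..n}. g k) \<le> wsum A t 1 n" for n
  proof (induction n)
    case (Suc n)
    have "(\<Prod>k\<in>{1..Suc n}. g k) = g (Suc n) * (\<Prod>k\<in>{1..n}. g k)" by simp
    also have "\<dots> \<le> g (Suc n) * wsum A t 1 n" using Suc pos[of "Suc n"] by (intro mult_left_mono) auto
    also have "\<dots> \<le> wsum A t 1 (Suc n)"
      using wsum_add_ge[OF A t, of 1 n 1] C by (simp add: g_def wsum_1 field_simps)
    finally show ?case .
  qed simp
  from prod_ge_exp[OF pos R ev] le show ?thesis by (meson order_trans)
qed

end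

section \<open>Systems of cylinders with disjoint interiors\<close>

lemma disjoint_balls_volume:
  fixes z :: "'i \<Rightarrow> 'a::euclidean_space"
  assumes fin: "finite F" and r: "\<And>u. u \<in> F \<Longrightarrow> 0 \<le> r u" and \<rho>: "\<rho> \<ge> 0"
    and disj: "disjoint_family_on (\<lambda>u. ball (z u) (r u)) F"
    and sub: "\<And>u. u \<in> F \<Longrightarrow> ball (z u) (r u) \<subseteq> ball y \<rho>"
  shows "(\<Sum>u\<in>F. r u ^ DIM('a)) \<le> \<rho> ^ DIM('a)"
proof -
  have "(\<Sum>u\<in>F. measure lborel (ball (z u) (r u))) = measure lborel (\<Union>u\<in>F. ball (z u) (r u))"
    using fin disj by (intro measure_finite_Union[symmetric]) (auto simp: emeasure_ball r)
  also have "\<dots> \<le> measure lborel (ball y \<rho>)"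
    using sub fin by (intro measure_mono_fmeasurable) (auto simp: fmeasurable_def emeasure_ball \<rho> less_top)
  finally have "unit_ball_vol DIM('a) * (\<Sum>u\<in>F. r u ^ DIM('a)) \<le> unit_ball_vol DIM('a) * \<rho> ^ DIM('a)"
    using r \<rho> by (simp add: content_ball sum_distrib_left)
  then show ?thesis using unit_ball_vol_pos[of "DIM('a)"] by simp
qed

text \<open>The geometry of the cylinders in terms of the weights: up to the constants \<open>D\<close> and \<open>a\<close>, the
  cylinder of \<open>u\<close> has diameter at most \<open>N 1 u\<close> and contains a ball of radius \<open>N 1 u\<close>.\<close>

locale cylinder_system = quasi_multiplicative N C c
  for N :: "nat \<Rightarrow> nat list \<Rightarrow> real" and C c :: real +
  fixes Jw :: "nat list \<Rightarrow> 'a::euclidean_space set" and D a :: real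
  assumes D: "D > 0" and a: "a > 0"
    and compact_cyl: "\<And>u. set u \<subseteq> {1..} \<Longrightarrow> compact (Jw u)"
    and nested: "\<And>u i. set u \<subseteq> {1..} \<Longrightarrow> i \<ge> 1 \<Longrightarrow> Jw (u @ [i]) \<subseteq> Jw u"
    and dist_cyl: "\<And>u x y. set u \<subseteq> {1..} \<Longrightarrow> x \<in> Jw u \<Longrightarrow> y \<in> Jw u \<Longrightarrow> dist x y \<le> D * N 1 u"
    and inner_ball: "\<And>u. set u \<subseteq> {1..} \<Longrightarrow> \<exists>z. ball z (a * N 1 u) \<subseteq> Jw u"
    and osc: "\<And>u i j. set u \<subseteq> {1..} \<Longrightarrow> i \<ge> 1 \<Longrightarrow> j \<ge> 1 \<Longrightarrow> i \<noteq> j \<Longrightarrow>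
          interior (Jw (u @ [i])) \<inter> interior (Jw (u @ [j])) = {}"
begin

lemma cyl_nonempty:
  assumes "set u \<subseteq> {1..}" shows "Jw u \<noteq> {}"
proof -
  obtain z where "ball z (a * N 1 u) \<subseteq> Jw u" using inner_ball[OF assms] by blast
  moreover have "z \<in> ball z (a * N 1 u)" using a N_pos[of 1 u] assms by simp
  ultimately show ?thesis by blast
qed

lemma nested_append: "set u \<subseteq> {1..} \<Longrightarrow> set v \<subseteq> {1..} \<Longrightarrow> Jw (u @ v) \<subseteq> Jw u"
proof (induction v rule: rev_induct)
  case (snoc j v)
  have "Jw ((u @ v) @ [j]) \<subseteq> Jw (u @ v)" using snoc by (intro nested) auto
  then show ?case using snoc by auto
qed simp

lemma nested_take:
  assumes "set u \<subseteq> {1..}" shows "Jw u \<subseteq> Jw (take m u)"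
  using nested_append[of "take m u" "drop m u"] assms
  by (metis append_take_drop_id order_trans set_drop_subset set_take_subset)

lemma interiors_disjoint:
  assumes "length u = length v" "u \<noteq> v" "set u \<subseteq> {1..}" "set v \<subseteq> {1..}"
  shows "interior (Jw u) \<inter> interior (Jw v) = {}"
proof -
  obtain p x y us vs where u: "u = p @ [x] @ us" and v: "v = p @ [y] @ vs" and xy: "x \<noteq> y"
    using same_length_different[OF assms(2,1)] by blast
  have "Jw u \<subseteq> Jw (p @ [x])" "Jw v \<subseteq> Jw (p @ [y])"
    using nested_append[of "p @ [x]" us] nested_append[of "p @ [y]" vs] assms u v by auto
  moreover have "interior (Jw (p @ [x])) \<inter> interior (Jw (p @ [y])) = {}"
    using assms u v xy by (intro osc) auto
  ultimately show ?thesis using interior_mono by blast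
qed

lemma volume_bound:
  assumes F: "finite F" "F \<subseteq> words n" and \<rho>: "\<rho> \<ge> 0" and sub: "\<And>u. u \<in> F \<Longrightarrow> Jw u \<subseteq> ball y \<rho>"
  shows "(\<Sum>u\<in>F. (a * N 1 u) ^ DIM('a)) \<le> \<rho> ^ DIM('a)"
proof -
  have w: "set u \<subseteq> {1..}" "length u = n" if "u \<in> F" for u using that F by (auto simp: words_def)
  obtain z where z: "\<And>u. u \<in> F \<Longrightarrow> ball (z u) (a * N 1 u) \<subseteq> Jw u"
    using inner_ball w by metis
  then have zi: "\<And>u. u \<in> F \<Longrightarrow> ball (z u) (a * N 1 u) \<subseteq> interior (Jw u)"
    by (simp add: interior_maximal)
  show ?thesis
  proof (rule disjoint_balls_volume[OF F(1) _ \<rho>])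
    show "0 \<le> a * N 1 u" if "u \<in> F" for u using a N_pos[of 1 u] w[OF that] by simp
    show "disjoint_family_on (\<lambda>u. ball (z u) (a * N 1 u)) F"
      unfolding disjoint_family_on_def
    proof (intro ballI impI)
      fix u v assume uv: "u \<in> F" "v \<in> F" "u \<noteq> v"
      then have "interior (Jw u) \<inter> interior (Jw v) = {}" by (intro interiors_disjoint w) (simp_all add: w)
      then show "ball (z u) (a * N 1 u) \<inter> ball (z v) (a * N 1 v) = {}"
        using zi[OF uv(1)] zi[OF uv(2)] by blast
    qed
    show "ball (z u) (a * N 1 u) \<subseteq> ball y \<rho>" if "u \<in> F" for u using z sub that by blast
  qed
qed

text \<open>Disjoint balls of radius \<open>a * \<sigma>\<close> inside a ball of radius \<open>(R + 2 * D + 1) * \<sigma>\<close> number at most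
  the ratio of the volumes.\<close>

definition overlap :: "real \<Rightarrow> real" where
  "overlap R = ((R + 2 * D + 1) / a) ^ DIM('a)"

lemma overlap_bound:
  assumes F: "finite F" "F \<subseteq> words n" and \<sigma>: "\<sigma> > 0" and R: "R \<ge> 0"
    and size: "\<And>u. u \<in> F \<Longrightarrow> \<sigma> \<le> N 1 u" "\<And>u. u \<in> F \<Longrightarrow> N 1 u \<le> 2 * \<sigma>"
    and meets: "\<And>u. u \<in> F \<Longrightarrow> Jw u \<inter> cball y (R * \<sigma>) \<noteq> {}"
  shows "real (card F) \<le> overlap R"
proof -
  have "Jw u \<subseteq> ball y ((R + 2 * D + 1) * \<sigma>)" if u: "u \<in> F" for u
  proof
    fix q assume q: "q \<in> Jw u"
    obtain p where p: "p \<in> Jw u" "dist y p \<le> R * \<sigma>" using meets[OF u] by auto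
    have "dist p q \<le> D * N 1 u" using p q u F by (intro dist_cyl) (auto simp: words_def)
    also have "\<dots> \<le> D * (2 * \<sigma>)" using size(2)[OF u] D by (intro mult_left_mono) auto
    finally have "dist y q \<le> R * \<sigma> + D * (2 * \<sigma>)" using p dist_triangle[of y q p] by linarith
    then show "q \<in> ball y ((R + 2 * D + 1) * \<sigma>)" using \<sigma> by (simp add: algebra_simps)
  qed
  then have "(\<Sum>u\<in>F. (a * N 1 u) ^ DIM('a)) \<le> ((R + 2 * D + 1) * \<sigma>) ^ DIM('a)"
    using R D \<sigma> by (intro volume_bound[OF F]) auto
  moreover have "(\<Sum>u\<in>F. (a * \<sigma>) ^ DIM('a)) \<le> (\<Sum>u\<in>F. (a * N 1 u) ^ DIM('a))"
    using size(1) a \<sigma> by (intro sum_mono power_mono) auto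
  ultimately have "real (card F) * (a * \<sigma>) ^ DIM('a) \<le> ((R + 2 * D + 1) * \<sigma>) ^ DIM('a)" by simp
  then have "real (card F) \<le> ((R + 2 * D + 1) * \<sigma>) ^ DIM('a) / (a * \<sigma>) ^ DIM('a)"
    using a \<sigma> by (simp add: field_simps)
  also have "\<dots> = overlap R" using \<sigma> by (simp add: overlap_def power_divide[symmetric])
  finally show ?thesis .
qed

lemma overlap_pos: "R \<ge> 0 \<Longrightarrow> overlap R > 0"
  using D a by (simp add: overlap_def)

text \<open>The disjoint balls in the cylinders of one level have bounded total volume, uniformly in the
  level. This bounds the critical exponents by the dimension of the space.\<close>

lemma dim_sum_bounded:
  assumes F: "finite F" "F \<subseteq> words n"
  shows "(\<Sum>u\<in>F. N 1 u powr DIM('a)) \<le> ((D + 1) / a) ^ DIM('a)"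
proof -
  obtain x where x: "x \<in> Jw []" using cyl_nonempty[of "[]"] by auto
  have w: "set u \<subseteq> {1..}" if "u \<in> F" for u using that F by (auto simp: words_def)
  have "Jw u \<subseteq> ball x (D + 1)" if "u \<in> F" for u
  proof
    fix y assume "y \<in> Jw u"
    then have "y \<in> Jw []" using nested_append[of "[]" u] w[OF that] by auto
    then show "y \<in> ball x (D + 1)" using dist_cyl[of "[]" x y] x by (simp add: N_Nil)
  qed
  then have "(\<Sum>u\<in>F. (a * N 1 u) ^ DIM('a)) \<le> (D + 1) ^ DIM('a)"
    using D by (intro volume_bound[OF F]) auto
  moreover have "N 1 u powr DIM('a) = N 1 u ^ DIM('a)" if "u \<in> F" for u
    using N_pos[of 1 u] w[OF that] by (simp add: powr_realpow)
  ultimately show ?thesis using a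
    by (simp add: power_mult_distrib sum_distrib_left[symmetric] power_divide field_simps)
qed

section \<open>Limit sets of finitely many maps per level\<close>

definition limit_set :: "(nat \<Rightarrow> nat set) \<Rightarrow> 'a set" where
  "limit_set A = (\<Inter>n. \<Union>u\<in>words_over A 1 n. Jw u)"

lemma compact_limit_set:
  assumes A: "alphabets A" shows "compact (limit_set A)"
proof -
  have "compact (\<Union>u\<in>words_over A 1 n. Jw u)" for n
    using finite_words_over[OF A, of 1 n] compact_cyl words_over_subset[OF A, of 1 _ n]
    by (intro compact_UN) auto
  then show ?thesis unfolding limit_set_def by (intro compact_Inter) blast+
qed

lemma limit_set_subset:
  assumes "alphabets A" shows "limit_set A \<subseteq> attractor Jw"
proof -
  have "words_over A 1 n \<subseteq> words n" for n
    using words_over_words[OF assms] by blast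
  then have sub: "(\<Union>u\<in>words_over A 1 n. Jw u) \<subseteq> (\<Union>u\<in>words n. Jw u)" for n
    by (intro UN_mono) simp_all
  show ?thesis
  proof
    fix x assume "x \<in> limit_set A"
    then have "x \<in> (\<Union>u\<in>words_over A 1 n. Jw u)" for n
      unfolding limit_set_def by (rule INT_D) simp
    then show "x \<in> attractor Jw"
      unfolding attractor_def by (intro INT_I subsetD[OF sub])
  qed
qed

text \<open>A word is continued by arbitrary allowed letters, which gives a decreasing sequence of nonempty
  compact cylinders.\<close>

lemma limit_set_meets_cyl:
  assumes A: "alphabets A" and u: "u \<in> words_over A 1 n"
  shows "Jw u \<inter> limit_set A \<noteq> {}"
proof -
  define b where "b = (\<lambda>k. SOME j. j \<in> A k)"
  have b: "b k \<in> A k" if "k \<ge> 1" for k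
    using alphabetsD(2)[OF A that] unfolding b_def by (simp add: some_in_eq)
  define w where "w = (\<lambda>k. u @ map (\<lambda>i. b (1 + n + i)) [0..<k])"
  have w: "w k \<in> words_over A 1 (n + k)" for k
    unfolding w_def by (intro append_in_words_over u) (auto simp: words_over_def b)
  have ws: "set (w k) \<subseteq> {1..}" for k using words_over_subset[OF A _ w] by auto
  have step: "Jw (w (Suc k)) \<subseteq> Jw (w k)" for k
  proof -
    have "b (1 + n + k) \<in> {1..}" using alphabetsD(3)[OF A, of "1 + n + k"] b[of "1 + n + k"] by auto
    moreover have "w (Suc k) = w k @ [b (1 + n + k)]" by (simp add: w_def)
    ultimately show ?thesis using nested[OF ws] by simp
  qed
  have anti: "Jw (w k) \<subseteq> Jw (w j)" if "j \<le> k" for j k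
    using lift_Suc_antimono_le[of "\<lambda>k. Jw (w k)"] step that by blast
  have "(\<Inter>k. Jw (w k)) \<noteq> {}"
    using compact_cyl ws cyl_nonempty anti by (intro compact_nest) auto
  then obtain x where x: "\<And>k. x \<in> Jw (w k)" by auto
  have "x \<in> (\<Union>v\<in>words_over A 1 m. Jw v)" for m
  proof
    show "take m (w m) \<in> words_over A 1 m" by (rule take_in_words_over[OF w]) simp
    show "x \<in> Jw (take m (w m))" using x nested_take[OF ws] by blast
  qed
  moreover have "x \<in> Jw u" using x[of 0] by (simp add: w_def)
  ultimately show ?thesis by (auto simp: limit_set_def)
qed

lemma limit_set_small_cyl:
  assumes A: "alphabets A" and x: "x \<in> limit_set A" and e: "e > 0"
  obtains m w where "w \<in> words_over A 1 m" "x \<in> Jw w" "\<And>y. y \<in> Jw w \<Longrightarrow> dist x y < e"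
proof -
  obtain m where m: "c ^ m < e / D" using real_arch_pow_inv[of "e / D" c] c D e by auto
  obtain w where w: "w \<in> words_over A 1 m" "x \<in> Jw w" using x by (auto simp: limit_set_def)
  have ws: "set w \<subseteq> {1..}" using words_over_subset[OF A _ w(1)] by simp
  have "dist x y < e" if "y \<in> Jw w" for y
  proof -
    have "dist x y \<le> D * N 1 w" by (rule dist_cyl[OF ws w(2) that])
    also have "\<dots> \<le> D * c ^ m"
      using N_le_power[OF _ ws, of 1] words_over_length[OF w(1)] D by (intro mult_left_mono) auto
    also have "\<dots> < e" using m D by (simp add: field_simps)
    finally show ?thesis .
  qed
  then show ?thesis using that w by blast
qed

end

section \<open>Lower bound for the Hausdorff dimension\<close>

lemma card_bounded_nats:
  assumes "\<And>m. m \<in> S \<Longrightarrow> real m \<le> x" "x \<ge> 0"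
  shows "real (card S) \<le> x + 1"
proof -
  have sub: "S \<subseteq> {..nat \<lfloor>x\<rfloor>}" using assms by (auto simp: le_nat_floor)
  have "card S \<le> nat \<lfloor>x\<rfloor> + 1" using card_mono[OF _ sub] by simp
  then show "real (card S) \<le> x + 1" using assms(2) by linarith
qed

lemma ln_inverse_le_powr:
  fixes r \<delta> :: real
  assumes "0 < r" "r < 1" "\<delta> > 0" "L > 0"
  shows "ln (1 / r) / L + 1 \<le> (1 / (\<delta> * L) + 1) * r powr (- \<delta>)"
proof -
  have "ln (1 / r) \<le> (1 / r) powr \<delta> / \<delta>" using assms by (intro ln_powr_bound) auto
  also have "(1 / r) powr \<delta> = r powr (- \<delta>)" using assms by (simp add: powr_divide powr_minus_divide)
  finally have "ln (1 / r) / L \<le> r powr (- \<delta>) / (\<delta> * L)" using assms by (simp add: field_simps)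
  moreover have "1 \<le> r powr (- \<delta>)" using assms powr_mono2'[of "- \<delta>" r 1] by simp
  ultimately show ?thesis by (simp add: algebra_simps)
qed

lemma sum_UN_le:
  fixes f :: "'b \<Rightarrow> real"
  assumes "finite I" "\<And>i. i \<in> I \<Longrightarrow> finite (B i)" "\<And>x. f x \<ge> 0"
  shows "sum f (\<Union>i\<in>I. B i) \<le> (\<Sum>i\<in>I. sum f (B i))"
  using assms(1,2)
proof (induction I rule: finite_induct)
  case (insert i I)
  have "sum f (B i \<union> (\<Union>i\<in>I. B i)) + sum f (B i \<inter> (\<Union>i\<in>I. B i)) = sum f (B i) + sum f (\<Union>i\<in>I. B i)"
    using insert by (intro sum.union_inter) auto
  moreover have "sum f (B i \<inter> (\<Union>i\<in>I. B i)) \<ge> 0" using assms(3) by (intro sum_nonneg) auto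
  ultimately show ?case using insert by simp
qed simp

context cylinder_system
begin

text \<open>Cylinders larger than a ball that they meet may be thin near the ball, so their number at one
  level is controlled for each dyadic range of sizes separately. The logarithmic number of ranges
  is harmless.\<close>

lemma large_cylinders_card:
  assumes r: "0 < r" "r < 1" and F: "finite F" "F \<subseteq> words n"
    and meets: "\<And>u. u \<in> F \<Longrightarrow> Jw u \<inter> cball y r \<noteq> {}" and big: "\<And>u. u \<in> F \<Longrightarrow> r < N 1 u"
  shows "real (card F) \<le> overlap 1 * (ln (1 / r) / ln 2 + 1)"
proof -
  define i where "i = (\<lambda>u. nat \<lfloor>log 2 (N 1 u / r)\<rfloor>)"
  have N1: "N 1 u \<le> 1" if "u \<in> F" for u using that F by (intro N_le_1) (auto simp: words_def)
  have lg: "0 \<le> log 2 (N 1 u / r)" "log 2 (N 1 u / r) \<le> ln (1 / r) / ln 2" if u: "u \<in> F" for u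
  proof -
    show "0 \<le> log 2 (N 1 u / r)" using big[OF u] r by simp
    have "log 2 (N 1 u / r) \<le> log 2 (1 / r)" using N1[OF u] big[OF u] r by (simp add: divide_right_mono)
    then show "log 2 (N 1 u / r) \<le> ln (1 / r) / ln 2" by (simp add: log_def)
  qed
  have size: "2 ^ i u * r \<le> N 1 u" "N 1 u \<le> 2 * (2 ^ i u * r)" if u: "u \<in> F" for u
  proof -
    have p: "N 1 u / r > 0" using big[OF u] r by simp
    have e: "N 1 u / r = 2 powr (log 2 (N 1 u / r))" using p by simp
    have fl: "real (i u) \<le> log 2 (N 1 u / r)" "log 2 (N 1 u / r) \<le> real (i u) + 1"
      using lg(1)[OF u] unfolding i_def by linarith+
    have "2 powr real (i u) \<le> N 1 u / r" by (subst e, rule powr_mono[OF fl(1)]) simp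
    moreover have "N 1 u / r \<le> 2 powr (real (i u) + 1)" by (subst e, rule powr_mono[OF fl(2)]) simp
    ultimately show "2 ^ i u * r \<le> N 1 u" "N 1 u \<le> 2 * (2 ^ i u * r)"
      using r by (simp_all add: powr_add powr_realpow field_simps)
  qed
  have I: "real j \<le> ln (1 / r) / ln 2" if j: "j \<in> i ` F" for j
  proof -
    obtain u where u: "u \<in> F" "j = i u" using j by blast
    have "real (i u) \<le> log 2 (N 1 u / r)" using lg(1)[OF u(1)] unfolding i_def by linarith
    then show ?thesis using lg(2)[OF u(1)] u(2) by simp
  qed
  have cls: "real (card {u \<in> F. i u = j}) \<le> overlap 1" for j
  proof (rule overlap_bound[where \<sigma> = "2 ^ j * r" and n = n and y = y])
    fix u assume u: "u \<in> {u \<in> F. i u = j}"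
    have "r \<le> 1 * (2 ^ j * r)" using r one_le_power[of "2::real" j] by simp
    then have "cball y r \<subseteq> cball y (1 * (2 ^ j * r))" by (rule subset_cball)
    then show "Jw u \<inter> cball y (1 * (2 ^ j * r)) \<noteq> {}" using meets[of u] u by blast
    show "2 ^ j * r \<le> N 1 u" "N 1 u \<le> 2 * (2 ^ j * r)" using size[of u] u by auto
  qed (use F r in auto)
  have "real (card F) = (\<Sum>u\<in>F. 1)" by simp
  also have "\<dots> = (\<Sum>j\<in>i ` F. \<Sum>u | u \<in> F \<and> i u = j. 1)" by (rule sum.image_gen[OF F(1)])
  also have "\<dots> = (\<Sum>j\<in>i ` F. real (card {u \<in> F. i u = j}))" by simp
  also have "\<dots> \<le> (\<Sum>j\<in>i ` F. overlap 1)" by (intro sum_mono cls)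
  also have "\<dots> = overlap 1 * real (card (i ` F))" by simp
  also have "\<dots> \<le> overlap 1 * (ln (1 / r) / ln 2 + 1)"
    using card_bounded_nats[of "i ` F" "ln (1 / r) / ln 2"] I r overlap_pos[of 1] by (intro mult_left_mono) auto
  finally show ?thesis .
qed

text \<open>Each word in \<open>H\<close> has a first prefix \<open>v @ [j]\<close> of weight at most \<open>r\<close>. There are few possible \<open>v\<close>, as
  their cylinders meet the ball and are larger than it, and few possible \<open>j\<close>, by the assumption on
  the alphabets. The words extending one \<open>v @ [j]\<close> carry at most about the proportion \<open>r powr t\<close> of the
  total weight. The gap between \<open>s + \<theta>\<close> and \<open>t\<close> absorbs the logarithms from counting \<open>v\<close>.\<close>

lemma ball_weight_bound:
  assumes A: "alphabets A" and s: "0 \<le> s" and \<theta>: "0 \<le> \<theta>" and st: "s + \<theta> < t"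
    and b0: "b0 > 0" "\<And>m. b0 \<le> wsum A t 1 m" and \<kappa>: "\<kappa> > 0"
    and cardA: "\<And>m v. v \<in> words_over A 1 m \<Longrightarrow> real (card (A (Suc m))) \<le> \<kappa> * N 1 v powr (- \<theta>)"
  shows "\<exists>K>0. \<forall>y r n H. 0 < r \<longrightarrow> r < 1 \<longrightarrow> c ^ n \<le> r \<longrightarrow> H \<subseteq> words_over A 1 n \<longrightarrow>
           (\<forall>u\<in>H. Jw u \<inter> cball y r \<noteq> {}) \<longrightarrow>
           (\<Sum>u\<in>H. N 1 u powr t) \<le> K * r powr s * wsum A t 1 n"
proof -
  define \<delta> where "\<delta> = (t - \<theta> - s) / 2"
  have \<delta>: "\<delta> > 0" using st by (simp add: \<delta>_def)
  have t: "t \<ge> 0" using s \<theta> st by simp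
  have lc: "ln (1 / c) > 0" using c by simp
  define K1 where "K1 = overlap 1 * (1 / (\<delta> * ln 2) + 1)"
  define K2 where "K2 = 1 / (\<delta> * ln (1 / c)) + 1"
  define K where "K = K2 * (K1 * \<kappa> * (C powr t / b0))"
  have K1: "K1 > 0" using overlap_pos[of 1] \<delta> by (auto simp: K1_def intro!: mult_pos_pos add_pos_pos)
  have K2: "K2 > 0" using lc \<delta> by (auto simp: K2_def intro!: add_pos_pos)
  have "K > 0" using K1 K2 \<kappa> C b0 by (simp add: K_def)
  moreover have "(\<Sum>u\<in>H. N 1 u powr t) \<le> K * r powr s * wsum A t 1 n"
    if r: "0 < r" "r < 1" and n: "c ^ n \<le> r" and H: "H \<subseteq> words_over A 1 n"
      and meets: "\<forall>u\<in>H. Jw u \<inter> cball y r \<noteq> {}" for y r n H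
  proof -
    \<comment> \<open>\<open>P m\<close>: the large parents of length \<open>m\<close>; \<open>G m\<close>: their small children; \<open>M\<close>: the lengths that occur\<close>
    define P where "P = (\<lambda>m. {v \<in> words_over A 1 m. r < N 1 v \<and> Jw v \<inter> cball y r \<noteq> {}})"
    define G where "G = (\<lambda>m. {v \<in> words_over A 1 (Suc m). N 1 v \<le> r \<and> take m v \<in> P m})"
    define M where "M = {m. m < n \<and> P m \<noteq> {}}"
    have finw: "finite (words_over A 1 m)" for m using finite_words_over[OF A] by simp
    have finP: "finite (P m)" and finG: "finite (G m)" for m
      using finw by (auto simp: P_def G_def)
    have Hn: "set u \<subseteq> {1..}" if "u \<in> words_over A 1 m" for u m
      using words_over_subset[OF A _ that] by simp
    have Msmall: "real m \<le> ln (1 / r) / ln (1 / c)" if m: "m \<in> M" for m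
    proof -
      obtain v where v: "v \<in> words_over A 1 m" "r < N 1 v" using m by (auto simp: M_def P_def)
      have "r < c ^ m" using v N_le_power[OF _ Hn[OF v(1)], of 1] words_over_length[OF v(1)] by simp
      then have "ln r < ln (c ^ m)" using r c by simp
      then have "ln r < real m * ln c" using c by (simp add: ln_realpow)
      then show ?thesis using lc c r by (simp add: ln_div field_simps)
    qed
    have cardM: "real (card M) \<le> K2 * r powr (- \<delta>)"
    proof -
      have "real (card M) \<le> ln (1 / r) / ln (1 / c) + 1"
        using Msmall lc r by (intro card_bounded_nats) auto
      also have "\<dots> \<le> K2 * r powr (- \<delta>)" unfolding K2_def by (rule ln_inverse_le_powr[OF r \<delta> lc])
      finally show ?thesis .
    qed
    have cardP: "real (card (P m)) \<le> K1 * r powr (- \<delta>)" for m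
    proof -
      have "real (card (P m)) \<le> overlap 1 * (ln (1 / r) / ln 2 + 1)"
      proof (rule large_cylinders_card[OF r finP])
        show "P m \<subseteq> words m" using words_over_words[OF A] unfolding P_def by blast
      qed (auto simp: P_def)
      also have "\<dots> \<le> overlap 1 * ((1 / (\<delta> * ln 2) + 1) * r powr (- \<delta>))"
        using overlap_pos[of 1] by (intro mult_left_mono ln_inverse_le_powr r \<delta>) auto
      finally show ?thesis by (simp add: K1_def mult.assoc)
    qed
    have cardG: "real (card (G m)) \<le> K1 * \<kappa> * r powr (- \<delta> - \<theta>)" for m
    proof (cases "P m = {}")
      case True
      then have "G m = {}" by (auto simp: G_def)
      then show ?thesis using K1 \<kappa> by simp
    next
      case False
      then obtain v where v: "v \<in> words_over A 1 m" "r < N 1 v" by (auto simp: P_def)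
      have "G m \<subseteq> (\<lambda>(v, j). v @ [j]) ` (P m \<times> A (Suc m))"
      proof
        fix w assume w: "w \<in> G m"
        then have w': "length w = Suc m" "w ! m \<in> A (Suc m)" "take m w \<in> P m"
          by (auto simp: G_def words_over_def)
        then have "w = take m w @ [w ! m]" by (simp add: take_Suc_conv_app_nth[symmetric])
        then show "w \<in> (\<lambda>(v, j). v @ [j]) ` (P m \<times> A (Suc m))" using w' by force
      qed
      moreover have "finite (P m \<times> A (Suc m))" using finP alphabetsD(1)[OF A, of "Suc m"] by simp
      ultimately have "card (G m) \<le> card (P m \<times> A (Suc m))"
        by (meson card_image_le card_mono finite_imageI order_trans)
      then have "real (card (G m)) \<le> real (card (P m)) * real (card (A (Suc m)))"
        by (metis card_cartesian_product of_nat_le_iff of_nat_mult)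
      also have "\<dots> \<le> (K1 * r powr (- \<delta>)) * (\<kappa> * r powr (- \<theta>))"
      proof (intro mult_mono cardP)
        have "real (card (A (Suc m))) \<le> \<kappa> * N 1 v powr (- \<theta>)" by (rule cardA[OF v(1)])
        also have "\<dots> \<le> \<kappa> * r powr (- \<theta>)" using \<kappa> v r \<theta> by (intro mult_left_mono powr_mono2') auto
        finally show "real (card (A (Suc m))) \<le> \<kappa> * r powr (- \<theta>)" .
      qed (use K1 in auto)
      also have "\<dots> = K1 * \<kappa> * (r powr (- \<delta>) * r powr (- \<theta>))" by simp
      also have "r powr (- \<delta>) * r powr (- \<theta>) = r powr (- \<delta> - \<theta>)" by (simp add: powr_add[symmetric])
      finally show ?thesis by simp
    qed
    define E where "E = (\<lambda>m v. (\<lambda>w. v @ w) ` words_over A (1 + Suc m) (n - Suc m))"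
    have cover: "H \<subseteq> (\<Union>m\<in>M. \<Union>v\<in>G m. E m v)"
    proof
      fix u assume u: "u \<in> H"
      then have uw: "u \<in> words_over A 1 n" using H by auto
      have len: "length u = n" using words_over_length[OF uw] .
      have ex: "N 1 (take n u) \<le> r"
        using N_le_power[OF _ Hn[OF uw], of 1] n len by simp
      define k where "k = (LEAST k. N 1 (take k u) \<le> r)"
      have k: "N 1 (take k u) \<le> r" unfolding k_def by (rule LeastI[where P = "\<lambda>k. N 1 (take k u) \<le> r", OF ex])
      have kn: "k \<le> n" unfolding k_def by (rule Least_le[where P = "\<lambda>k. N 1 (take k u) \<le> r", OF ex])
      have "k \<noteq> 0" using k r by (cases k) (auto simp: N_Nil)
      then obtain m where m: "k = Suc m" by (cases k) auto
      have big: "r < N 1 (take m u)" using not_less_Least[of m "\<lambda>k. N 1 (take k u) \<le> r"] m k_def by simp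
      have "Jw (take m u) \<inter> cball y r \<noteq> {}"
        using meets u nested_take[OF Hn[OF uw], of m] by blast
      then have Pm: "take m u \<in> P m" using big take_in_words_over[OF uw, of m] kn m by (simp add: P_def)
      then have "take k u \<in> G m" using k take_in_words_over[OF uw, of k] kn m by (simp add: G_def min_def)
      moreover have "u \<in> E m (take k u)"
        using drop_in_words_over[OF uw kn] unfolding E_def m
        by (metis append_take_drop_id imageI)
      moreover have "m \<in> M" using Pm kn m by (auto simp: M_def)
      ultimately show "u \<in> (\<Union>m\<in>M. \<Union>v\<in>G m. E m v)" by blast
    qed
    have finM: "finite M" by (auto simp: M_def)
    have finE: "finite (E m v)" for m v using finite_words_over[OF A] by (simp add: E_def)
    have Ew: "(\<Sum>u\<in>E m v. N 1 u powr t) \<le> C powr t / b0 * r powr t * wsum A t 1 n"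
      if m: "m \<in> M" and v: "v \<in> G m" for m v
    proof -
      have vw: "v \<in> words_over A 1 (Suc m)" "N 1 v \<le> r" using v by (auto simp: G_def)
      have mn: "Suc m + (n - Suc m) = n" using m by (auto simp: M_def)
      define Z where "Z = (\<Sum>u\<in>E m v. N 1 u powr t)"
      have "Z = (\<Sum>w\<in>words_over A (1 + Suc m) (n - Suc m). N 1 (v @ w) powr t)"
        unfolding Z_def E_def by (subst sum.reindex) (auto simp: inj_on_def)
      then have "wsum A t 1 (Suc m) * Z \<le> C powr t * N 1 v powr t * wsum A t 1 n"
        using extension_weight_le[OF A t vw(1), of "n - Suc m"] mn by simp
      also have "\<dots> \<le> C powr t * r powr t * wsum A t 1 n"
        using vw N_pos[OF _ Hn[OF vw(1)], of 1] t wsum_pos[OF A, of 1 t n]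
        by (intro mult_right_mono mult_left_mono powr_mono2) auto
      finally have "wsum A t 1 (Suc m) * Z \<le> C powr t * r powr t * wsum A t 1 n" .
      moreover have "b0 * Z \<le> wsum A t 1 (Suc m) * Z"
        using b0(2)[of "Suc m"] by (intro mult_right_mono) (auto simp: Z_def sum_nonneg)
      ultimately have "b0 * Z \<le> C powr t * r powr t * wsum A t 1 n" by linarith
      then show ?thesis using b0(1) by (simp add: Z_def field_simps)
    qed
    define W where "W = C powr t / b0 * r powr t * wsum A t 1 n"
    have W0: "W \<ge> 0" using b0 wsum_pos[OF A, of 1 t n] by (simp add: W_def)
    have "(\<Sum>u\<in>H. N 1 u powr t) \<le> (\<Sum>u\<in>(\<Union>m\<in>M. \<Union>v\<in>G m. E m v). N 1 u powr t)"
      using finM finG finE by (intro sum_mono2 cover) auto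
    also have "\<dots> \<le> (\<Sum>m\<in>M. \<Sum>u\<in>(\<Union>v\<in>G m. E m v). N 1 u powr t)"
      using finM finG finE by (intro sum_UN_le) auto
    also have "\<dots> \<le> (\<Sum>m\<in>M. \<Sum>v\<in>G m. \<Sum>u\<in>E m v. N 1 u powr t)"
      using finG finE by (intro sum_mono sum_UN_le) auto
    also have "\<dots> \<le> (\<Sum>m\<in>M. \<Sum>v\<in>G m. W)"
      using Ew by (intro sum_mono) (auto simp: W_def)
    also have "\<dots> = (\<Sum>m\<in>M. real (card (G m)) * W)" by simp
    also have "\<dots> \<le> (\<Sum>m\<in>M. K1 * \<kappa> * r powr (- \<delta> - \<theta>) * W)"
      using W0 cardG by (intro sum_mono mult_right_mono) auto
    also have "\<dots> = real (card M) * (K1 * \<kappa> * r powr (- \<delta> - \<theta>) * W)" by simp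
    also have "\<dots> \<le> K2 * r powr (- \<delta>) * (K1 * \<kappa> * r powr (- \<delta> - \<theta>) * W)"
      using cardM W0 K1 \<kappa> by (intro mult_right_mono) auto
    also have "\<dots> = K * (r powr (- \<delta>) * r powr (- \<delta> - \<theta>) * r powr t) * wsum A t 1 n"
      by (simp add: K_def W_def)
    also have "r powr (- \<delta>) * r powr (- \<delta> - \<theta>) * r powr t = r powr s"
      by (simp add: powr_add[symmetric] \<delta>_def field_simps)
    finally show ?thesis .
  qed
  ultimately show ?thesis by blast
qed

text \<open>The mass distribution principle, with the weights of the words of a large length \<open>n\<close> in place of a
  limit measure: compactness reduces a cover to finitely many balls, and then one \<open>n\<close> serves for
  all of them.\<close>

lemma hausdorff_measure_limit_set:
  assumes A: "alphabets A" and s: "0 < s" and \<theta>: "0 \<le> \<theta>" and st: "s + \<theta> < t"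
    and b0: "b0 > 0" "\<And>m. b0 \<le> wsum A t 1 m" and \<kappa>: "\<kappa> > 0"
    and cardA: "\<And>m v. v \<in> words_over A 1 m \<Longrightarrow> real (card (A (Suc m))) \<le> \<kappa> * N 1 v powr (- \<theta>)"
    and E: "limit_set A \<subseteq> E"
  shows "hausdorff_measure s E \<noteq> 0"
proof
  assume H0: "hausdorff_measure s E = 0"
  obtain K where K: "K > 0" and bound: "\<And>y r n H. 0 < r \<Longrightarrow> r < 1 \<Longrightarrow> c ^ n \<le> r \<Longrightarrow>
      H \<subseteq> words_over A 1 n \<Longrightarrow> (\<forall>u\<in>H. Jw u \<inter> cball y r \<noteq> {}) \<Longrightarrow>
      (\<Sum>u\<in>H. N 1 u powr t) \<le> K * r powr s * wsum A t 1 n"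
    using ball_weight_bound[OF A less_imp_le[OF s] \<theta> st b0 \<kappa> cardA] by blast
  \<comment> \<open>\<open>e\<close> bounds both the sum of the cover and the loss from enlarging its sets to balls, so that
    the balls have total mass at most \<open>2 * K * e = 1/2\<close>\<close>
  define e where "e = 1 / (4 * K)"
  have e: "e > 0" using K by (simp add: e_def)
  have "(INF U\<in>delta_covers (1/2) E. \<Sum>i. diam_power s (U i)) \<le> hausdorff_measure s E"
    unfolding hausdorff_measure_def by (rule SUP_upper) simp
  then have "(INF U\<in>delta_covers (1/2) E. \<Sum>i. diam_power s (U i)) < ennreal e"
    using H0 e by simp
  then obtain U where U: "U \<in> delta_covers (1/2) E" and Ue: "(\<Sum>i. diam_power s (U i)) < ennreal e"
    by (auto simp: INF_less_iff)
  have U1: "E \<subseteq> (\<Union>i. U i)" and U2: "bounded (U i)" "diameter (U i) \<le> 1/2" for i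
    using U by (auto simp: delta_covers_def)
  define d where "d = (\<lambda>i. diameter (U i))"
  have d0: "d i \<ge> 0" for i using U2 by (simp add: d_def diameter_ge_0)
  have "\<exists>\<rho>. d i < \<rho> \<and> \<rho> < 1 \<and> \<rho> powr s \<le> d i powr s + e * (1/2) ^ Suc i" for i
  proof -
    have "((\<lambda>x. x powr s) \<longlongrightarrow> d i powr s) (at_right (d i))"
    proof (rule tendsto_powr')
      show "((\<lambda>x. x) \<longlongrightarrow> d i) (at_right (d i))" by (rule tendsto_ident_at)
      show "d i \<noteq> 0 \<or> 0 < s \<and> (\<forall>\<^sub>F x in at_right (d i). 0 \<le> x)"
        using s d0[of i] by (auto simp: eventually_at_right_less[THEN eventually_mono])
    qed auto
    then have "\<forall>\<^sub>F x in at_right (d i). x powr s < d i powr s + e * (1/2) ^ Suc i"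
      using e by (intro order_tendstoD(2)) auto
    moreover have "\<forall>\<^sub>F x in at_right (d i). x < 1"
      using U2(2)[of i] by (intro order_tendstoD(2)[OF tendsto_ident_at]) (auto simp: d_def)
    moreover have "\<forall>\<^sub>F x in at_right (d i). d i < x" by (rule eventually_at_right_less)
    ultimately have "\<forall>\<^sub>F x in at_right (d i). d i < x \<and> x < 1 \<and> x powr s \<le> d i powr s + e * (1/2) ^ Suc i"
      by eventually_elim auto
    then show ?thesis by (rule eventually_happens'[OF trivial_limit_at_right_real])
  qed
  then obtain \<rho> where \<rho>: "\<And>i. d i < \<rho> i" "\<And>i. \<rho> i < 1"
      "\<And>i. \<rho> i powr s \<le> d i powr s + e * (1/2) ^ Suc i" by metis
  have \<rho>0: "0 < \<rho> i" for i using \<rho>(1)[of i] d0[of i] by linarith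
  define y where "y = (\<lambda>i. SOME x. x \<in> U i)"
  have y: "y i \<in> U i" if "U i \<noteq> {}" for i unfolding y_def using that by (simp add: some_in_eq)
  have Ub: "U i \<subseteq> ball (y i) (\<rho> i)" for i
  proof
    fix x assume x: "x \<in> U i"
    then have "dist (y i) x \<le> d i" unfolding d_def using y by (intro diameter_bounded_bound U2) auto
    then show "x \<in> ball (y i) (\<rho> i)" using \<rho>(1)[of i] by simp
  qed
  have "limit_set A \<subseteq> (\<Union>i\<in>{i. U i \<noteq> {}}. ball (y i) (\<rho> i))"
  proof
    fix x assume "x \<in> limit_set A"
    then obtain i where i: "x \<in> U i" using E U1 by blast
    then have "x \<in> ball (y i) (\<rho> i)" using Ub by (rule subsetD[rotated])
    then show "x \<in> (\<Union>i\<in>{i. U i \<noteq> {}}. ball (y i) (\<rho> i))" using i by (intro UN_I[of i]) auto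
  qed
  then obtain I where I: "I \<subseteq> {i. U i \<noteq> {}}" "finite I" "limit_set A \<subseteq> (\<Union>i\<in>I. ball (y i) (\<rho> i))"
    using compactE_image[OF compact_limit_set[OF A], of "{i. U i \<noteq> {}}" "\<lambda>i. ball (y i) (\<rho> i)"] by auto
  have "\<forall>\<^sub>F n in sequentially. c ^ n < \<rho> i" for i
    using c \<rho>0 by (intro order_tendstoD(2)[OF LIMSEQ_power_zero]) auto
  then have "\<forall>\<^sub>F n in sequentially. \<forall>i\<in>I. c ^ n < \<rho> i" by (intro eventually_ball_finite I) auto
  then obtain n where n: "\<And>i. i \<in> I \<Longrightarrow> c ^ n < \<rho> i" by (auto simp: eventually_sequentially)
  define H where "H = (\<lambda>i. {u \<in> words_over A 1 n. Jw u \<inter> cball (y i) (\<rho> i) \<noteq> {}})"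
  have finH: "finite (H i)" for i unfolding H_def using finite_words_over[OF A, of 1 n] by simp
  have "words_over A 1 n \<subseteq> (\<Union>i\<in>I. H i)"
  proof
    fix u assume u: "u \<in> words_over A 1 n"
    obtain x where x: "x \<in> Jw u" "x \<in> limit_set A" using limit_set_meets_cyl[OF A u] by blast
    then obtain i where "i \<in> I" "x \<in> ball (y i) (\<rho> i)" using I(3) by blast
    then have "u \<in> H i" using u x ball_subset_cball unfolding H_def by blast
    then show "u \<in> (\<Union>i\<in>I. H i)" using \<open>i \<in> I\<close> by blast
  qed
  then have "wsum A t 1 n \<le> (\<Sum>u\<in>(\<Union>i\<in>I. H i). N 1 u powr t)"
    unfolding wsum_def using I finH by (intro sum_mono2) auto
  also have "\<dots> \<le> (\<Sum>i\<in>I. \<Sum>u\<in>H i. N 1 u powr t)" using I finH by (intro sum_UN_le) auto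
  also have "\<dots> \<le> (\<Sum>i\<in>I. K * \<rho> i powr s * wsum A t 1 n)"
    using n \<rho> \<rho>0 by (intro sum_mono bound[where y = "y _"]) (auto simp: H_def less_imp_le)
  also have "\<dots> = (K * (\<Sum>i\<in>I. \<rho> i powr s)) * wsum A t 1 n" by (simp add: sum_distrib_left sum_distrib_right)
  finally have "1 \<le> K * (\<Sum>i\<in>I. \<rho> i powr s)" using wsum_pos[OF A, of 1 t n] by simp
  also have "\<dots> \<le> K * ((\<Sum>i\<in>I. d i powr s) + e * (\<Sum>i\<in>I. (1/2) ^ Suc i))"
    using \<rho>(3) K by (intro mult_left_mono) (auto simp: sum.distrib[symmetric] sum_distrib_left intro!: sum_mono)
  also have "\<dots> \<le> K * (e + e * 1)"
  proof (intro mult_left_mono add_mono)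
    have "diam_power s (U i) = ennreal (d i powr s)" if "i \<in> I" for i
      using I(1) s that by (auto simp: diam_power_def d_def)
    then have "ennreal (\<Sum>i\<in>I. d i powr s) = (\<Sum>i\<in>I. diam_power s (U i))" by simp
    also have "\<dots> \<le> (\<Sum>i. diam_power s (U i))" by (intro sum_le_suminf I) auto
    finally have "ennreal (\<Sum>i\<in>I. d i powr s) < ennreal e" using Ue by (rule le_less_trans)
    then show "(\<Sum>i\<in>I. d i powr s) \<le> e" using ennreal_less_iff[of "\<Sum>i\<in>I. d i powr s" e] by (simp add: sum_nonneg)
    have "(\<Sum>i\<in>I. (1/2::real) ^ Suc i) \<le> (\<Sum>i. (1/2) ^ Suc i)"
      using power_half_series by (intro sum_le_suminf I) (auto simp: sums_iff)
    also have "\<dots> = 1" using power_half_series by (simp add: sums_iff)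
    finally show "(\<Sum>i\<in>I. (1/2::real) ^ Suc i) \<le> 1" .
  qed (use e K in auto)
  also have "\<dots> = 1/2" using K by (simp add: e_def)
  finally show False by simp
qed

end

section \<open>Lower bound for the packing dimension\<close>

lemma ennreal_SUP_eq_top:
  fixes f :: "'b \<Rightarrow> ennreal"
  assumes "\<And>n::nat. \<exists>i\<in>I. of_nat n \<le> f i" shows "(SUP i\<in>I. f i) = \<infinity>"
proof (rule ccontr)
  assume "(SUP i\<in>I. f i) \<noteq> \<infinity>"
  then have "(SUP i\<in>I. f i) < top" by (simp only: less_top infinity_ennreal_def)
  then obtain n :: nat where n: "(SUP i\<in>I. f i) < of_nat n" using ennreal_Ex_less_of_nat by blast
  obtain i where "i \<in> I" "of_nat n \<le> f i" using assms by blast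
  then have "of_nat n \<le> (SUP i\<in>I. f i)" by (rule SUP_upper2)
  then show False using n by (simp only: not_le[symmetric] simp_thms)
qed

text \<open>Finite packings are insensitive to small perturbations of the centres, so it suffices to find
  large finite packings centred in the closure.\<close>

lemma packing_premeasure_infinite:
  fixes B :: "'a::euclidean_space set"
  assumes *: "\<And>\<delta> X. 0 < \<delta> \<Longrightarrow> \<exists>G r. finite G \<and> G \<subseteq> closure B \<and> 0 < r \<and> r \<le> \<delta> \<and>
      (\<forall>x\<in>G. \<forall>y\<in>G. x \<noteq> y \<longrightarrow> 2 * r < dist x y) \<and> X \<le> real (card G) * (2 * r) powr s"
  shows "packing_premeasure s B = \<infinity>"
proof -
  have "(SUP S\<in>delta_packings \<delta> B. \<Sum>\<^sub>\<infinity>(x, r)\<in>S. ennreal ((2 * r) powr s)) = \<infinity>" if \<delta>: "\<delta> > 0" for \<delta>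
  proof (rule ennreal_SUP_eq_top)
    fix X :: nat
    obtain G r where G: "finite G" "G \<subseteq> closure B" "0 < r" "r \<le> \<delta>"
      and sep: "\<And>x y. x \<in> G \<Longrightarrow> y \<in> G \<Longrightarrow> x \<noteq> y \<Longrightarrow> 2 * r < dist x y"
      and X: "real X \<le> real (card G) * (2 * r) powr s"
      using *[OF \<delta>, of "real X"] by blast
    have "\<forall>\<^sub>F k in at_right 0. 2 * r + 2 * k < dist x y" if "x \<in> G" "y \<in> G" "x \<noteq> y" for x y
    proof -
      have "((\<lambda>k. 2 * r + 2 * k) \<longlongrightarrow> 2 * r + 2 * 0) (at_right 0)" by (intro tendsto_intros)
      then show ?thesis using sep[OF that] by (intro order_tendstoD(2)[where y = "2 * r + 2 * 0"]) auto
    qed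
    then have "\<forall>\<^sub>F k in at_right 0. \<forall>x\<in>G. \<forall>y\<in>G. x \<noteq> y \<longrightarrow> 2 * r + 2 * k < dist x y"
      by (intro eventually_ball_finite G ballI) (auto intro: eventually_mono)
    then have "\<forall>\<^sub>F k in at_right 0. 0 < k \<and> (\<forall>x\<in>G. \<forall>y\<in>G. x \<noteq> y \<longrightarrow> 2 * r + 2 * k < dist x y)"
      by (intro eventually_conj eventually_at_right_less)
    then have "\<exists>k. 0 < k \<and> (\<forall>x\<in>G. \<forall>y\<in>G. x \<noteq> y \<longrightarrow> 2 * r + 2 * k < dist x y)"
      by (rule eventually_happens'[OF trivial_limit_at_right_real])
    then obtain k where k0: "0 < k" and k1: "\<forall>x\<in>G. \<forall>y\<in>G. x \<noteq> y \<longrightarrow> 2 * r + 2 * k < dist x y"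
      by (elim exE conjE) (rule that)
    note k = k0 k1[rule_format]
    have "\<forall>x\<in>G. \<exists>z. z \<in> B \<and> dist z x < k" using G(2) k(1) closure_approachable by blast
    then obtain f where "\<forall>x\<in>G. f x \<in> B \<and> dist (f x) x < k" by (rule bchoice[THEN exE])
    then have f: "f x \<in> B" "dist (f x) x < k" if "x \<in> G" for x using that by auto
    have fd: "2 * r < dist (f x) (f y)" if "x \<in> G" "y \<in> G" "x \<noteq> y" for x y
      using k(2)[OF that] f(2)[OF that(1)] f(2)[OF that(2)] dist_triangle[of x y "f x"]
        dist_triangle[of "f x" y "f y"] by (simp add: dist_commute)
    define S where "S = (\<lambda>x. (f x, r)) ` G"
    have inj: "inj_on (\<lambda>x. (f x, r)) G" using fd G(3) by (force simp: inj_on_def)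
    have "S \<in> delta_packings \<delta> B"
      unfolding delta_packings_def mem_Collect_eq
    proof
      show "S \<subseteq> B \<times> {0<..\<delta>}" using f(1) G by (auto simp: S_def)
      show "disjoint_family_on (\<lambda>(x, r). cball x r) S"
        unfolding disjoint_family_on_def
      proof (intro ballI impI)
        fix p q assume "p \<in> S" "q \<in> S" "p \<noteq> q"
        then obtain x y where xy: "x \<in> G" "y \<in> G" "p = (f x, r)" "q = (f y, r)" "x \<noteq> y" by (auto simp: S_def)
        have "z \<notin> cball (f x) r \<inter> cball (f y) r" for z
          using fd[OF xy(1,2,5)] dist_triangle[of "f x" "f y" z] by (auto simp: dist_commute)
        then show "(case p of (x, r) \<Rightarrow> cball x r) \<inter> (case q of (x, r) \<Rightarrow> cball x r) = {}" using xy by auto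
      qed
    qed
    moreover have "of_nat X \<le> (\<Sum>\<^sub>\<infinity>(x, r)\<in>S. ennreal ((2 * r) powr s))"
    proof -
      have "(\<Sum>\<^sub>\<infinity>(x, r)\<in>S. ennreal ((2 * r) powr s)) = (\<Sum>(x, r)\<in>S. ennreal ((2 * r) powr s))"
        using G by (intro infsum_finite) (simp add: S_def)
      also have "\<dots> = (\<Sum>x\<in>G. ennreal ((2 * r) powr s))"
        unfolding S_def by (subst sum.reindex[OF inj]) simp
      also have "\<dots> = ennreal (real (card G) * (2 * r) powr s)"
        by (simp add: ennreal_mult ennreal_of_nat_eq_real_of_nat)
      finally show ?thesis using X by (simp add: ennreal_of_nat_eq_real_of_nat ennreal_leI)
    qed
    ultimately show "\<exists>S\<in>delta_packings \<delta> B. of_nat X \<le> (\<Sum>\<^sub>\<infinity>(x, r)\<in>S. ennreal ((2 * r) powr s))" by blast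
  qed
  then have "packing_premeasure s B = (INF \<delta>\<in>{0::real<..}. \<infinity>)"
    unfolding packing_premeasure_def by (intro INF_cong) auto
  then show ?thesis by simp
qed

text \<open>If each relatively open piece of a compact set has infinite premeasure, then by Baire's
  theorem the set is no countable union of sets of finite premeasure.\<close>

lemma packing_measure_Baire:
  fixes E :: "'a::euclidean_space set"
  assumes L: "compact L" "L \<noteq> {}" "L \<subseteq> E"
    and *: "\<And>x e B. x \<in> L \<Longrightarrow> 0 < e \<Longrightarrow> L \<inter> ball x e \<subseteq> closure B \<Longrightarrow> packing_premeasure s B = \<infinity>"
  shows "packing_measure s E \<noteq> 0"
proof
  assume "packing_measure s E = 0"
  then have "packing_measure s E < 1" by simp
  then obtain B where B: "E \<subseteq> (\<Union>i. B i)" "(\<Sum>i. packing_premeasure s (B i)) < 1"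
    unfolding packing_measure_def INF_less_iff by blast
  have fin: "packing_premeasure s (B i) \<noteq> \<infinity>" for i
  proof -
    have "packing_premeasure s (B i) \<le> (\<Sum>i. packing_premeasure s (B i))"
      using sum_le_suminf[of "\<lambda>i. packing_premeasure s (B i)" "{i}"] by simp
    then show ?thesis using B(2) by (auto simp: top_unique)
  qed
  define \<G> where "\<G> = range (\<lambda>i. L - closure (B i))"
  have "L \<subseteq> closure (\<Inter>\<G>)"
  proof (rule Baire)
    show "closed L" using L(1) by (rule compact_imp_closed)
    show "countable \<G>" by (simp add: \<G>_def)
    fix T assume "T \<in> \<G>"
    then obtain i where T: "T = L - closure (B i)" by (auto simp: \<G>_def)
    have "openin (top_of_set L) T" unfolding T Diff_eq by (intro openin_open_Int open_Compl closed_closure)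
    moreover have "L \<subseteq> closure T"
    proof
      fix x assume x: "x \<in> L"
      show "x \<in> closure T" unfolding closure_approachable
      proof (intro allI impI)
        fix e :: real assume e: "e > 0"
        have "\<not> L \<inter> ball x e \<subseteq> closure (B i)" using *[OF x e] fin by blast
        then show "\<exists>y\<in>T. dist y x < e" by (auto simp: T dist_commute)
      qed
    qed
    ultimately show "openin (top_of_set L) T \<and> L \<subseteq> closure T" by simp
  qed
  moreover have "\<Inter>\<G> = {}"
  proof -
    have "L \<subseteq> (\<Union>i. closure (B i))" using L(3) B(1) closure_subset by blast
    then have "x \<notin> \<Inter>\<G>" for x unfolding \<G>_def by (cases "x \<in> L") auto
    then show ?thesis by blast
  qed
  ultimately show False using L(2) by simp
qed

context cylinder_system
begin

text \<open>A maximal separated set of centres: each word has its point close to one of the centres, and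
  each centre is close to the points of boundedly many words.\<close>

lemma separated_subset:
  assumes F: "finite F" "F \<subseteq> words n" and \<sigma>: "\<sigma> > 0"
    and size: "\<And>u. u \<in> F \<Longrightarrow> \<sigma> \<le> N 1 u" "\<And>u. u \<in> F \<Longrightarrow> N 1 u \<le> 2 * \<sigma>"
    and x: "\<And>u. u \<in> F \<Longrightarrow> x u \<in> Jw u"
  shows "\<exists>G. finite G \<and> G \<subseteq> x ` F \<and> (\<forall>p\<in>G. \<forall>q\<in>G. p \<noteq> q \<longrightarrow> 2 * \<sigma> < dist p q) \<and>
           real (card F) \<le> overlap 2 * real (card G)"
proof -
  define sep where "sep = (\<lambda>G. G \<subseteq> x ` F \<and> (\<forall>p\<in>G. \<forall>q\<in>G. p \<noteq> q \<longrightarrow> 2 * \<sigma> < dist p q))"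
  have fin: "finite {G. sep G}" by (rule finite_subset[of _ "Pow (x ` F)"]) (auto simp: sep_def F)
  moreover have "{G. sep G} \<noteq> {}" by (auto simp: sep_def)
  ultimately obtain G where G: "sep G" and max: "\<And>G'. sep G' \<Longrightarrow> G \<subseteq> G' \<Longrightarrow> G' = G"
    using finite_has_maximal[of "{G. sep G}"] by auto
  have finG: "finite G" using G F by (auto simp: sep_def intro: finite_subset)
  define V where "V = (\<lambda>p. {u \<in> F. dist p (x u) \<le> 2 * \<sigma>})"
  have "F \<subseteq> (\<Union>p\<in>G. V p)"
  proof
    fix u assume u: "u \<in> F"
    show "u \<in> (\<Union>p\<in>G. V p)"
    proof (rule ccontr)
      assume "u \<notin> (\<Union>p\<in>G. V p)"
      then have far: "2 * \<sigma> < dist p (x u)" if "p \<in> G" for p using that u by (force simp: V_def)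
      then have "sep (insert (x u) G)" using G u by (auto simp: sep_def dist_commute)
      then have "x u \<in> G" using max by blast
      then show False using far[of "x u"] \<sigma> by simp
    qed
  qed
  then have "card F \<le> card (\<Union>p\<in>G. V p)" using F finG by (intro card_mono) (auto simp: V_def)
  also have "\<dots> \<le> (\<Sum>p\<in>G. card (V p))" by (rule card_UN_le[OF finG])
  finally have "real (card F) \<le> (\<Sum>p\<in>G. real (card (V p)))" by (simp flip: of_nat_sum)
  also have "\<dots> \<le> (\<Sum>p\<in>G. overlap 2)"
  proof (rule sum_mono)
    fix p assume "p \<in> G"
    show "real (card (V p)) \<le> overlap 2"
    proof (rule overlap_bound[where \<sigma> = \<sigma> and y = p and n = n])
      fix u assume "u \<in> V p"
      then have "x u \<in> Jw u \<inter> cball p (2 * \<sigma>)" using x by (auto simp: V_def)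
      then show "Jw u \<inter> cball p (2 * \<sigma>) \<noteq> {}" by blast
    qed (use F \<sigma> size in \<open>auto simp: V_def\<close>)
  qed
  finally have "real (card F) \<le> overlap 2 * real (card G)" by (simp add: mult.commute)
  then show ?thesis using G finG unfolding sep_def by blast
qed

text \<open>If at each dyadic scale \<open>r\<close> there were fewer than about \<open>r powr (- s)\<close> words of weight about \<open>r\<close>, the
  total weight with exponent \<open>t > s\<close> would be bounded by a geometric series. So some scale has more,
  it is small because \<open>N 1 u \<le> c ^ n\<close>, and boundedly many of the cylinders at this scale can be close
  to each other.\<close>

lemma large_packing:
  assumes s: "0 \<le> s" "s < t" and \<delta>: "\<delta> > 0"
  shows "\<exists>n0 Y. \<forall>n F x. n0 \<le> n \<longrightarrow> finite F \<longrightarrow> F \<subseteq> words n \<longrightarrow> (\<forall>u\<in>F. x u \<in> Jw u) \<longrightarrow> Y < (\<Sum>u\<in>F. N 1 u powr t) \<longrightarrow>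
     (\<exists>G r. finite G \<and> G \<subseteq> x ` F \<and> 0 < r \<and> r \<le> \<delta> \<and>
      (\<forall>p\<in>G. \<forall>q\<in>G. p \<noteq> q \<longrightarrow> 2 * r < dist p q) \<and> X \<le> real (card G) * (2 * r) powr s)"
proof -
  define X' where "X' = max X 1"
  define \<eta> where "\<eta> = (1/2) powr (t - s)"
  have \<eta>: "0 < \<eta>" "\<eta> < 1" using s by (simp_all add: \<eta>_def powr01_less_one)
  define Z where "Z = overlap 2 * X'"
  have Z: "Z > 0" using overlap_pos[of 2] by (simp add: Z_def X'_def)
  obtain n0 where n0: "c ^ n0 < \<delta>" using real_arch_pow_inv[OF \<delta> c(2)] by blast
  have "\<exists>G r. finite G \<and> G \<subseteq> x ` F \<and> 0 < r \<and> r \<le> \<delta> \<and>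
      (\<forall>p\<in>G. \<forall>q\<in>G. p \<noteq> q \<longrightarrow> 2 * r < dist p q) \<and> X \<le> real (card G) * (2 * r) powr s"
    if n: "n0 \<le> n" and F: "finite F" "F \<subseteq> words n" and x: "\<forall>u\<in>F. x u \<in> Jw u"
      and Y: "Z / (1 - \<eta>) < (\<Sum>u\<in>F. N 1 u powr t)" for n F x
  proof -
    have w: "set u \<subseteq> {1..}" "length u = n" if "u \<in> F" for u using that F by (auto simp: words_def)
    have Np: "0 < N 1 u" "N 1 u \<le> 1" if "u \<in> F" for u
      using N_pos[of 1 u] N_le_1[of 1 u] w[OF that] by auto
    define i where "i = (\<lambda>u. nat \<lfloor>log 2 (1 / N 1 u)\<rfloor>)"
    have size: "(1/2) ^ Suc (i u) \<le> N 1 u" "N 1 u \<le> (1/2) ^ i u" if u: "u \<in> F" for u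
    proof -
      have l0: "0 \<le> log 2 (1 / N 1 u)" using Np[OF u] by simp
      have fl: "real (i u) \<le> log 2 (1 / N 1 u)" "log 2 (1 / N 1 u) \<le> real (Suc (i u))"
        using l0 unfolding i_def by linarith+
      have e: "1 / N 1 u = 2 powr (log 2 (1 / N 1 u))" using Np[OF u] by simp
      have "2 powr real (i u) \<le> 1 / N 1 u" by (subst e, rule powr_mono[OF fl(1)]) simp
      moreover have "1 / N 1 u \<le> 2 powr real (Suc (i u))" by (subst e, rule powr_mono[OF fl(2)]) simp
      ultimately have "2 ^ i u \<le> 1 / N 1 u" "1 / N 1 u \<le> 2 ^ Suc (i u)"
        by (simp_all only: powr_realpow zero_less_numeral)
      then show "(1/2) ^ Suc (i u) \<le> N 1 u" "N 1 u \<le> (1/2) ^ i u"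
        using Np[OF u] by (simp_all add: power_divide field_simps)
    qed
    define Fj where "Fj = (\<lambda>j. {u \<in> F. i u = j})"
    have "\<exists>j. Z < real (card (Fj j)) * ((1/2) ^ j) powr s"
    proof (rule ccontr)
      assume "\<not> ?thesis"
      then have small: "real (card (Fj j)) * ((1/2) ^ j) powr s \<le> Z" for j by (simp add: not_less)
      have eta: "((1/2) ^ j) powr t = ((1/2) ^ j) powr s * \<eta> ^ j" for j
      proof -
        have "\<eta> ^ j = ((1/2) ^ j) powr (t - s)"
          by (simp add: \<eta>_def powr_powr powr_realpow[symmetric] mult.commute)
        then show ?thesis by (simp add: powr_add[symmetric])
      qed
      have "(\<Sum>u\<in>F. N 1 u powr t) \<le> (\<Sum>u\<in>F. ((1/2) ^ i u) powr t)"
        using size(2) Np s by (intro sum_mono powr_mono2) (auto simp: less_imp_le)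
      also have "\<dots> = (\<Sum>j\<in>i ` F. \<Sum>u | u \<in> F \<and> i u = j. ((1/2) ^ i u) powr t)"
        by (rule sum.image_gen[OF F(1)])
      also have "\<dots> = (\<Sum>j\<in>i ` F. (real (card (Fj j)) * ((1/2) ^ j) powr s) * \<eta> ^ j)"
        by (intro sum.cong refl) (simp add: Fj_def eta[symmetric] mult.assoc)
      also have "\<dots> \<le> (\<Sum>j\<in>i ` F. Z * \<eta> ^ j)"
        using small \<eta> by (intro sum_mono mult_right_mono) auto
      also have "\<dots> \<le> (\<Sum>j. Z * \<eta> ^ j)"
        using \<eta> Z F by (intro sum_le_suminf) (auto intro!: summable_mult summable_geometric)
      also have "\<dots> = Z / (1 - \<eta>)" using \<eta> by (simp add: suminf_mult suminf_geometric)
      finally show False using Y by simp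
    qed
    then obtain j where j: "Z < real (card (Fj j)) * ((1/2) ^ j) powr s" by blast
    define r :: real where "r = (1/2) ^ Suc j"
    have r: "r > 0" "2 * r = (1/2) ^ j" by (simp_all add: r_def)
    have Fj: "finite (Fj j)" "Fj j \<subseteq> words n" using F by (auto simp: Fj_def)
    have sz: "r \<le> N 1 u" "N 1 u \<le> 2 * r" if "u \<in> Fj j" for u
      using size[of u] that unfolding r(2) by (auto simp: Fj_def r_def)
    obtain G where G: "finite G" "G \<subseteq> x ` Fj j" "\<forall>p\<in>G. \<forall>q\<in>G. p \<noteq> q \<longrightarrow> 2 * r < dist p q"
        "real (card (Fj j)) \<le> overlap 2 * real (card G)"
      using separated_subset[OF Fj r(1) sz, of x] x by (auto simp: Fj_def)
    have "Fj j \<noteq> {}" using j Z by auto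
    then obtain u where u: "u \<in> Fj j" by blast
    have "r \<le> c ^ n" using sz(1)[OF u] N_le_power[of 1 u] w[of u] u by (auto simp: Fj_def)
    also have "\<dots> \<le> c ^ n0" using n c by (intro power_decreasing) auto
    finally have "r \<le> \<delta>" using n0 by simp
    moreover have "overlap 2 * X' \<le> overlap 2 * (real (card G) * (2 * r) powr s)"
    proof -
      have "Z < real (card (Fj j)) * (2 * r) powr s" using j by (simp only: r(2))
      also have "\<dots> \<le> overlap 2 * real (card G) * (2 * r) powr s"
        using G(4) by (rule mult_right_mono) simp
      finally have "Z \<le> overlap 2 * real (card G) * (2 * r) powr s" by simp
      then show ?thesis by (simp add: Z_def mult.assoc)
    qed
    then have "X \<le> real (card G) * (2 * r) powr s"
      using overlap_pos[of 2] by (simp add: X'_def)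
    ultimately show ?thesis using G r(1) by (intro exI[of _ G] exI[of _ r]) (auto simp: Fj_def)
  qed
  then show ?thesis by blast
qed

text \<open>By quasi-multiplicativity the extensions of each word \<open>w\<close> also have unbounded total weight, so
  every relatively open piece of the limit set contains arbitrarily large packings.\<close>

lemma packing_measure_limit_set:
  assumes A: "alphabets A" and s: "0 \<le> s" "s < t"
    and unbounded: "\<And>Y n0. \<exists>n\<ge>n0. Y < wsum A t 1 n"
    and E: "limit_set A \<subseteq> E"
  shows "packing_measure s E \<noteq> 0"
proof (rule packing_measure_Baire[OF compact_limit_set[OF A] _ E])
  show "limit_set A \<noteq> {}" using limit_set_meets_cyl[OF A, of "[]" 0] by auto
  fix z e B assume z: "z \<in> limit_set A" "0 < e" "limit_set A \<inter> ball z e \<subseteq> closure B"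
  obtain m w where w: "w \<in> words_over A 1 m" "\<And>y. y \<in> Jw w \<Longrightarrow> dist z y < e"
    using limit_set_small_cyl[OF A z(1,2)] by blast
  have ws: "set w \<subseteq> {1..}" using words_over_subset[OF A _ w(1)] by simp
  have t: "t \<ge> 0" using s by simp
  define x where "x = (\<lambda>u. SOME p. p \<in> Jw u \<inter> limit_set A)"
  have x: "x u \<in> Jw u \<inter> limit_set A" if "u \<in> words_over A 1 n" for u n
    unfolding x_def using limit_set_meets_cyl[OF A that] by (simp only: some_in_eq simp_thms)
  show "packing_premeasure s B = \<infinity>"
  proof (rule packing_premeasure_infinite)
    fix \<delta> X :: real assume \<delta>: "0 < \<delta>"
    obtain n0 Y where "\<forall>n F x. n0 \<le> n \<longrightarrow> finite F \<longrightarrow> F \<subseteq> words n \<longrightarrow> (\<forall>u\<in>F. x u \<in> Jw u) \<longrightarrow>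
       Y < (\<Sum>u\<in>F. N 1 u powr t) \<longrightarrow>
       (\<exists>G r. finite G \<and> G \<subseteq> x ` F \<and> 0 < r \<and> r \<le> \<delta> \<and>
        (\<forall>p\<in>G. \<forall>q\<in>G. p \<noteq> q \<longrightarrow> 2 * r < dist p q) \<and> X \<le> real (card G) * (2 * r) powr s)"
      using large_packing[OF s \<delta>, of X] by (elim exE) (rule that)
    note large = this[THEN spec, THEN spec, THEN spec, THEN mp, THEN mp, THEN mp, THEN mp, THEN mp]
    define k where "k = N 1 w powr t / (C powr t * wsum A t 1 m)"
    have k: "k > 0" using N_pos[OF _ ws, of 1] C wsum_pos[OF A, of 1 t m] by (simp add: k_def)
    obtain n where n: "n \<ge> max n0 m" "Y / k < wsum A t 1 n" using unbounded by blast
    define F where "F = (\<lambda>v. w @ v) ` words_over A (1 + m) (n - m)"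
    have Fw: "F \<subseteq> words_over A 1 n"
      using append_in_words_over[OF w(1), of _ "n - m"] n by (auto simp: F_def)
    have finF: "finite F" using finite_words_over[OF A] by (simp add: F_def)
    have "N 1 w powr t * wsum A t 1 n \<le> C powr t * wsum A t 1 m * (\<Sum>u\<in>F. N 1 u powr t)"
      using extension_weight_ge[OF A t w(1), of "n - m"] n(1)
      unfolding F_def by (subst sum.reindex) (auto simp: inj_on_def)
    then have "k * wsum A t 1 n \<le> (\<Sum>u\<in>F. N 1 u powr t)"
      using C wsum_pos[OF A, of 1 t m] by (simp add: k_def field_simps)
    moreover have "Y < k * wsum A t 1 n" using n(2) k by (simp add: field_simps)
    ultimately have Y: "Y < (\<Sum>u\<in>F. N 1 u powr t)" by simp
    have Fwords: "F \<subseteq> words n" using Fw words_over_words[OF A] by blast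
    have n0n: "n0 \<le> n" using n(1) by simp
    have xF: "\<forall>u\<in>F. x u \<in> Jw u" using x Fw by blast
    from large[OF n0n finF Fwords xF Y] obtain G r where G: "finite G" "G \<subseteq> x ` F" "0 < r" "r \<le> \<delta>"
        "\<forall>p\<in>G. \<forall>q\<in>G. p \<noteq> q \<longrightarrow> 2 * r < dist p q" "X \<le> real (card G) * (2 * r) powr s"
      by (elim exE conjE) (rule that)
    have "x u \<in> closure B" if "u \<in> F" for u
    proof -
      have u: "x u \<in> Jw u" "x u \<in> limit_set A" using x Fw that by blast+
      obtain v where v: "u = w @ v" "v \<in> words_over A (1 + m) (n - m)" using \<open>u \<in> F\<close> by (auto simp: F_def)
      have "Jw u \<subseteq> Jw w" unfolding v(1)
        using words_over_subset[OF A _ v(2)] by (intro nested_append ws) auto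
      then have "dist z (x u) < e" using w(2) u by blast
      then show ?thesis using z(3) u by auto
    qed
    then have "G \<subseteq> closure B" using G(2) by blast
    then show "\<exists>G r. finite G \<and> G \<subseteq> closure B \<and> 0 < r \<and> r \<le> \<delta> \<and>
        (\<forall>x\<in>G. \<forall>y\<in>G. x \<noteq> y \<longrightarrow> 2 * r < dist x y) \<and> X \<le> real (card G) * (2 * r) powr s"
      using G by (intro exI[of _ G] exI[of _ r] conjI)
  qed
qed

end

section \<open>Packing and upper box dimension\<close>

lemma eln_le_iff: "eln x \<le> ereal y \<longleftrightarrow> x \<le> ennreal (exp y)"
proof (cases x)
  case (real r)
  show ?thesis
  proof (cases "r = 0")
    case False
    then have "r > 0" using real by simp
    then have "ln r \<le> y \<longleftrightarrow> r \<le> exp y" using ln_le_cancel_iff[of r "exp y"] by simp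
    then show ?thesis using real \<open>r > 0\<close> by (simp add: eln_def)
  qed (use real in \<open>simp add: eln_def\<close>)
qed (simp add: eln_def top_unique)

lemma eln_less_imp_le:
  assumes "eln x < ereal y" shows "x \<le> ennreal (exp y)"
  using assms eln_le_iff less_imp_le by blast

lemma disjoint_cballs_dist:
  fixes x y :: "'a::euclidean_space"
  assumes "cball x r \<inter> cball y r' = {}" "0 < r" "0 < r'"
  shows "r + r' < dist x y"
proof (rule ccontr)
  assume "\<not> ?thesis"
  then have le: "dist x y \<le> r + r'" by simp
  define z where "z = x + (r / (r + r')) *\<^sub>R (y - x)"
  have "dist x z = r / (r + r') * dist x y"
    using assms by (simp add: z_def dist_norm norm_minus_commute)
  also have "\<dots> \<le> r / (r + r') * (r + r')" using le assms by (intro mult_left_mono) auto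
  finally have 1: "dist x z \<le> r" using assms by simp
  have "y - z = (r' / (r + r')) *\<^sub>R (y - x)"
  proof -
    have "1 - r / (r + r') = r' / (r + r')" using assms by (simp add: field_simps)
    then show ?thesis unfolding z_def by (metis (no_types) diff_diff_eq scaleR_left_diff_distrib scaleR_one)
  qed
  then have "dist y z = r' / (r + r') * dist x y" using assms by (simp add: dist_norm norm_minus_commute)
  also have "\<dots> \<le> r' / (r + r') * (r + r')" using le assms by (intro mult_left_mono) auto
  finally have "dist y z \<le> r'" using assms by simp
  then show False using 1 assms(1) by auto
qed

text \<open>The centres of disjoint balls with radii larger than \<open>\<epsilon> / 2\<close> are at distances larger than \<open>\<epsilon>\<close>, so no
  set of diameter at most \<open>\<epsilon>\<close> contains two of them.\<close>

lemma card_packing_le_covering_number: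
  fixes A :: "'a::euclidean_space set"
  assumes S: "finite S" "S \<subseteq> A \<times> {\<epsilon>/2<..}" "disjoint_family_on (\<lambda>(x, r). cball x r) S" and \<epsilon>: "\<epsilon> > 0"
  shows "of_nat (card S) \<le> covering_number \<epsilon> A"
  unfolding covering_number_def
proof (rule INF_greatest)
  fix C assume "C \<in> {C. finite C \<and> A \<subseteq> \<Union>C \<and> (\<forall>U\<in>C. bounded U \<and> diameter U \<le> \<epsilon>)}"
  then have C: "finite C" "A \<subseteq> \<Union>C" "\<And>U. U \<in> C \<Longrightarrow> bounded U \<and> diameter U \<le> \<epsilon>" by auto
  have "\<forall>p\<in>S. \<exists>U. U \<in> C \<and> fst p \<in> U" using S(2) C(2) by fastforce
  then obtain f where "\<forall>p\<in>S. f p \<in> C \<and> fst p \<in> f p" by (rule bchoice[THEN exE])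
  then have f: "f p \<in> C" "fst p \<in> f p" if "p \<in> S" for p using that by auto
  have "inj_on f S"
  proof (rule inj_onI, rule ccontr)
    fix p q assume pq: "p \<in> S" "q \<in> S" "f p = f q" "p \<noteq> q"
    have r: "\<epsilon> / 2 < snd p" "\<epsilon> / 2 < snd q" using S(2) pq by auto
    have "cball (fst p) (snd p) \<inter> cball (fst q) (snd q) = {}"
      using S(3) pq unfolding disjoint_family_on_def by (auto simp: split_beta)
    then have "snd p + snd q < dist (fst p) (fst q)" using disjoint_cballs_dist[of "fst p" "snd p" "fst q" "snd q"] r \<epsilon> by simp
    moreover have "dist (fst p) (fst q) \<le> diameter (f p)"
      using C(3)[OF f(1)[OF pq(1)]] f(2)[OF pq(1)] f(2)[OF pq(2)] pq(3) by (intro diameter_bounded_bound) auto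
    moreover have "diameter (f p) \<le> \<epsilon>" using C(3)[OF f(1)[OF pq(1)]] by simp
    ultimately show False using r by linarith
  qed
  then have "card S \<le> card C" using f C(1) by (intro card_inj_on_le[of f]) auto
  then show "(of_nat (card S) :: ennreal) \<le> of_nat (card C)" by simp
qed

text \<open>The balls of a packing are grouped by dyadic size. Each group is no larger than a covering
  number, and as \<open>t < s\<close> the resulting bounds form a convergent geometric series.\<close>

lemma packing_premeasure_le_geometric:
  fixes A :: "'a::euclidean_space set"
  assumes ts: "0 < t" "t < s"
    and N: "\<And>i. i > k0 \<Longrightarrow> covering_number ((1/2) ^ i) A \<le> ennreal (((1/2) ^ i) powr (- t))"
  shows "packing_premeasure s A \<le> ennreal (2 powr (s + t) * ((1/2) powr (s - t)) ^ k0 / (1 - (1/2) powr (s - t)))"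
proof -
  define q where "q = (1/2::real) powr (s - t)"
  have q: "0 < q" "q < 1" using ts by (simp_all add: q_def powr01_less_one)
  have "(\<Sum>\<^sub>\<infinity>(x, r)\<in>S. ennreal ((2 * r) powr s)) \<le> ennreal (2 powr (s + t) * q ^ k0 / (1 - q))"
    if S: "S \<in> delta_packings ((1/2) ^ k0) A" for S
  proof -
    have "(\<Sum>(x, r)\<in>F. ennreal ((2 * r) powr s)) \<le> ennreal (2 powr (s + t) * q ^ k0 / (1 - q))"
      if F: "finite F" "F \<subseteq> S" for F
    proof -
      have Fr: "0 < snd p" "snd p \<le> (1/2) ^ k0" "fst p \<in> A" if "p \<in> F" for p
        using S F that by (auto simp: delta_packings_def)
      have Fd: "disjoint_family_on (\<lambda>(x, r). cball x r) F"
        using S F(2) by (auto simp: delta_packings_def intro: disjoint_family_on_mono)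
      define i where "i = (\<lambda>p :: 'a \<times> real. nat \<lfloor>log 2 (1 / snd p)\<rfloor>)"
      have size: "(1/2) ^ Suc (i p) < snd p" "snd p \<le> (1/2) ^ i p" "k0 \<le> i p" if p: "p \<in> F" for p
      proof -
        have e: "1 / snd p = 2 powr (log 2 (1 / snd p))" using Fr[OF p] by simp
        have "2 ^ k0 \<le> 1 / snd p" using Fr(1,2)[OF p] by (simp add: power_divide field_simps)
        then have "log 2 (2 ^ k0) \<le> log 2 (1 / snd p)" using Fr(1)[OF p] by (intro log_le_cancel_iff[THEN iffD2]) auto
        then have k0: "real k0 \<le> log 2 (1 / snd p)" by (simp add: log_nat_power)
        then show "k0 \<le> i p" unfolding i_def by (simp add: le_nat_iff le_floor_iff)
        have fl: "real (i p) \<le> log 2 (1 / snd p)" "log 2 (1 / snd p) < real (Suc (i p))"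
          using k0 unfolding i_def by linarith+
        have "2 powr real (i p) \<le> 1 / snd p" by (subst e, rule powr_mono[OF fl(1)]) simp
        moreover have "1 / snd p < 2 powr real (Suc (i p))" by (subst e, rule powr_less_mono[OF fl(2)]) simp
        ultimately have "2 ^ i p \<le> 1 / snd p" "1 / snd p < 2 ^ Suc (i p)"
          by (simp_all only: powr_realpow zero_less_numeral)
        then show "(1/2) ^ Suc (i p) < snd p" "snd p \<le> (1/2) ^ i p"
          using Fr[OF p] by (simp_all add: power_divide field_simps)
      qed
      have cls: "real (card {p \<in> F. i p = j}) \<le> ((1/2) ^ Suc j) powr (- t)" if j: "j \<in> i ` F" for j
      proof -
        have kj: "Suc j > k0" using size(3) j by (auto simp: less_Suc_eq_le)
        have "of_nat (card {p \<in> F. i p = j}) \<le> covering_number ((1/2) ^ Suc j) A"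
        proof (rule card_packing_le_covering_number)
          show "{p \<in> F. i p = j} \<subseteq> A \<times> {(1/2) ^ Suc j / 2<..}"
          proof
            fix p assume p: "p \<in> {p \<in> F. i p = j}"
            have "(1/2::real) ^ Suc j / 2 \<le> (1/2) ^ Suc j" by simp
            also have "\<dots> < snd p" using size(1)[of p] p by auto
            finally show "p \<in> A \<times> {(1/2) ^ Suc j / 2<..}" using Fr(3)[of p] p by (cases p) auto
          qed
          show "disjoint_family_on (\<lambda>(x, r). cball x r) {p \<in> F. i p = j}"
            using Fd by (rule disjoint_family_on_mono[rotated]) auto
        qed (use F in auto)
        also have "\<dots> \<le> ennreal (((1/2) ^ Suc j) powr (- t))" by (rule N[OF kj])
        finally show ?thesis by (simp add: ennreal_of_nat_eq_real_of_nat)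
      qed
      have summand: "((1/2) ^ Suc j) powr (- t) * (2 * (1/2) ^ j) powr s = 2 powr (s + t) * q ^ j" for j
      proof -
        have "((1/2::real) ^ Suc j) powr (- t) = 2 powr (real (Suc j) * t)"
          by (simp add: powr_realpow[symmetric] powr_powr powr_divide powr_minus_divide del: power_Suc of_nat_Suc)
        moreover have "(2 * (1/2::real) ^ j) powr s = 2 powr s * 2 powr (- real j * s)"
          by (simp add: powr_mult powr_realpow[symmetric] powr_powr powr_divide powr_minus_divide)
        moreover have "q ^ j = 2 powr (- real j * (s - t))"
          by (simp add: q_def powr_realpow[symmetric] powr_powr powr_divide powr_minus_divide mult.commute)
        ultimately show ?thesis by (simp add: powr_add[symmetric] algebra_simps)
      qed
      have "(\<Sum>p\<in>F. (2 * snd p) powr s) \<le> (\<Sum>p\<in>F. (2 * (1/2) ^ i p) powr s)"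
        using size(2) Fr(1) ts by (intro sum_mono powr_mono2) (auto simp: less_imp_le)
      also have "\<dots> = (\<Sum>j\<in>i ` F. \<Sum>p | p \<in> F \<and> i p = j. (2 * (1/2) ^ i p) powr s)"
        by (rule sum.image_gen[OF F(1)])
      also have "\<dots> = (\<Sum>j\<in>i ` F. real (card {p \<in> F. i p = j}) * (2 * (1/2) ^ j) powr s)"
        by (intro sum.cong refl) simp
      also have "\<dots> \<le> (\<Sum>j\<in>i ` F. ((1/2) ^ Suc j) powr (- t) * (2 * (1/2) ^ j) powr s)"
        using cls by (intro sum_mono mult_right_mono) auto
      also have "\<dots> = (\<Sum>j\<in>i ` F. 2 powr (s + t) * q ^ j)" by (simp only: summand)
      also have "\<dots> = (\<Sum>j\<in>(\<lambda>p. i p - k0) ` F. 2 powr (s + t) * q ^ (j + k0))"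
        using size(3) by (intro sum.reindex_bij_witness[of _ "\<lambda>j. j + k0" "\<lambda>j. j - k0"]) force+
      also have "\<dots> \<le> (\<Sum>j. 2 powr (s + t) * q ^ (j + k0))"
        using q F by (intro sum_le_suminf) (auto simp: power_add intro!: summable_mult summable_mult2 summable_geometric)
      also have "\<dots> = (\<Sum>j. (2 powr (s + t) * q ^ k0) * q ^ j)" by (simp add: power_add mult_ac)
      also have "\<dots> = 2 powr (s + t) * q ^ k0 / (1 - q)"
        using q by (subst suminf_mult) (auto simp: suminf_geometric)
      finally have "(\<Sum>p\<in>F. (2 * snd p) powr s) \<le> 2 powr (s + t) * q ^ k0 / (1 - q)" .
      moreover have "(\<Sum>(x, r)\<in>F. ennreal ((2 * r) powr s)) = ennreal (\<Sum>p\<in>F. (2 * snd p) powr s)"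
        by (simp add: split_beta)
      ultimately show ?thesis by (simp add: ennreal_leI)
    qed
    then show ?thesis
      by (subst nonneg_infsum_complete) (auto intro!: SUP_least)
  qed
  then have "(SUP S\<in>delta_packings ((1/2) ^ k0) A. \<Sum>\<^sub>\<infinity>(x, r)\<in>S. ennreal ((2 * r) powr s))
      \<le> ennreal (2 powr (s + t) * q ^ k0 / (1 - q))" by (rule SUP_least)
  moreover have "packing_premeasure s A \<le> (SUP S\<in>delta_packings ((1/2) ^ k0) A. \<Sum>\<^sub>\<infinity>(x, r)\<in>S. ennreal ((2 * r) powr s))"
    unfolding packing_premeasure_def by (rule INF_lower) simp
  ultimately show ?thesis by (simp add: q_def)
qed

lemma packing_measure_0:
  fixes A :: "'a::euclidean_space set"
  assumes "upper_box_dim A < ereal t" "0 < t" "t < s"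
  shows "packing_measure s A = 0"
proof -
  have "\<forall>\<^sub>F \<delta> in at_right 0. eln (covering_number \<delta> A) / ereal (- ln \<delta>) < ereal t"
    using assms(1) unfolding upper_box_dim_def by (rule Limsup_lessD)
  then obtain b where b: "b > 0" "\<And>\<delta>. 0 < \<delta> \<Longrightarrow> \<delta> < b \<Longrightarrow> eln (covering_number \<delta> A) / ereal (- ln \<delta>) < ereal t"
    unfolding eventually_at_right_field by auto
  have N: "covering_number \<delta> A \<le> ennreal (\<delta> powr (- t))" if \<delta>: "0 < \<delta>" "\<delta> < b" "\<delta> < 1" for \<delta>
  proof -
    have "eln (covering_number \<delta> A) < ereal t * ereal (- ln \<delta>)"
      using b(2)[OF \<delta>(1,2)] \<delta> by (subst (asm) ereal_divide_less_iff) auto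
    then have "eln (covering_number \<delta> A) < ereal (t * (- ln \<delta>))" by simp
    then have "covering_number \<delta> A \<le> ennreal (exp (t * (- ln \<delta>)))" by (rule eln_less_imp_le)
    then show ?thesis using \<delta> by (simp add: powr_def)
  qed
  define q where "q = (1/2::real) powr (s - t)"
  have q: "0 < q" "q < 1" using assms by (simp_all add: q_def powr01_less_one)
  obtain m where m: "(1/2) ^ m < b" using real_arch_pow_inv[OF b(1), of "1/2"] by auto
  have bound: "packing_premeasure s A \<le> ennreal (2 powr (s + t) * q ^ k / (1 - q))" if k: "k \<ge> m" for k
    unfolding q_def
  proof (rule packing_premeasure_le_geometric[OF assms(2,3)])
    fix i assume i: "k < i"
    have im: "(1/2::real) ^ i \<le> (1/2) ^ m" using i k by (intro power_decreasing) auto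
    then show "covering_number ((1/2) ^ i) A \<le> ennreal (((1/2) ^ i) powr (- t))"
      using le_less_trans[OF im m] i by (intro N) (auto simp: power_less_one_iff)
  qed
  have "(\<lambda>k. ennreal (2 powr (s + t) * q ^ k / (1 - q))) \<longlonglongrightarrow> ennreal (2 powr (s + t) * 0 / (1 - q))"
    using q by (intro tendsto_ennrealI tendsto_intros LIMSEQ_power_zero) auto
  then have "packing_premeasure s A \<le> ennreal (2 powr (s + t) * 0 / (1 - q))"
    by (rule LIMSEQ_le_const) (use bound in blast)
  then have A0: "packing_premeasure s A = 0" by simp
  have E0: "packing_premeasure s ({} :: 'a set) = 0"
  proof -
    have "packing_premeasure s ({} :: 'a set) \<le> (SUP S\<in>delta_packings 1 ({} :: 'a set). \<Sum>\<^sub>\<infinity>(x, r)\<in>S. ennreal ((2 * r) powr s))"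
      unfolding packing_premeasure_def by (rule INF_lower) simp
    also have "\<dots> \<le> 0" by (rule SUP_least) (auto simp: delta_packings_def)
    finally show ?thesis by simp
  qed
  define B where "B = (\<lambda>i::nat. if i = 0 then A else {})"
  have "packing_premeasure s (B i) = 0" for i by (simp add: B_def A0 E0)
  then have "(\<Sum>i. packing_premeasure s (B i)) = 0" by simp
  moreover have "A \<subseteq> (\<Union>i. B i)" by (auto simp: B_def intro: exI[of _ 0])
  ultimately have "packing_measure s A \<le> 0" unfolding packing_measure_def
    by (intro INF_lower2[of B]) auto
  then show ?thesis by simp
qed

lemma packing_dim_le_upper_box_dim:
  fixes A :: "'a::euclidean_space set"
  assumes "A \<noteq> {}"
  shows "packing_dim A \<le> upper_box_dim A"
proof (rule dense_ge)
  fix w assume w: "upper_box_dim A < w"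
  have one: "1 \<le> covering_number \<delta> A" for \<delta>
    unfolding covering_number_def
  proof (rule INF_greatest)
    fix C assume "C \<in> {C. finite C \<and> A \<subseteq> \<Union>C \<and> (\<forall>U\<in>C. bounded U \<and> diameter U \<le> \<delta>)}"
    then have "finite C" "C \<noteq> {}" using assms by auto
    then have "1 \<le> card C" by (simp add: Suc_le_eq card_gt_0_iff)
    then have "of_nat 1 \<le> (of_nat (card C) :: ennreal)" by (rule of_nat_mono)
    then show "(1 :: ennreal) \<le> of_nat (card C)" by simp
  qed
  have "0 \<le> eln (covering_number \<delta> A) / ereal (- ln \<delta>)" if \<delta>: "0 < \<delta>" "\<delta> < 1" for \<delta>
  proof -
    have "\<not> eln (covering_number \<delta> A) < 0"
    proof
      assume "eln (covering_number \<delta> A) < 0"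
      then obtain z where z: "eln (covering_number \<delta> A) < ereal z" "ereal z < 0" using ereal_dense2 by blast
      then have "covering_number \<delta> A \<le> ennreal (exp z)" by (intro eln_less_imp_le)
      also have "\<dots> < 1" using z by (simp add: ennreal_less_one_iff)
      finally show False using one[of \<delta>] by simp
    qed
    then show ?thesis using \<delta> by (intro zero_le_divide_ereal) (auto simp: not_less)
  qed
  then have "\<forall>\<^sub>F \<delta> in at_right 0. 0 \<le> eln (covering_number \<delta> A) / ereal (- ln \<delta>)"
    unfolding eventually_at_right_field by (intro exI[of _ 1]) auto
  then have ub0: "0 \<le> upper_box_dim A"
    unfolding upper_box_dim_def by (intro le_Limsup) auto
  obtain s where s: "upper_box_dim A < ereal s" "ereal s < w" using ereal_dense2[OF w] by blast
  obtain t where t: "upper_box_dim A < ereal t" "ereal t < ereal s" using ereal_dense2[OF s(1)] by blast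
  have t0: "0 < t" using ub0 t(1) by (metis ereal_less(2) le_less_trans)
  have "packing_measure s A = 0" using t t0 by (intro packing_measure_0) auto
  then have "packing_dim A \<le> ereal s" unfolding packing_dim_def
    using t t0 by (intro Inf_lower) auto
  then show "packing_dim A \<le> w" using s(2) by simp
qed

section \<open>Pressure\<close>

text \<open>At \<open>k = 0\<close> the factor \<open>1 / real k\<close> vanishes, hence the restriction to \<open>k \<ge> 1\<close>.\<close>

lemma scaled_eln_le_iff:
  assumes "k \<ge> 1"
  shows "ereal (1 / real k) * eln x \<le> ereal y \<longleftrightarrow> x \<le> ennreal (exp (y * real k))"
proof -
  have "ereal (1 / real k) * eln x \<le> ereal y \<longleftrightarrow> eln x \<le> ereal (y * real k)"
    using assms by (cases "eln x") (auto simp: field_simps)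
  then show ?thesis by (simp only: eln_le_iff)
qed

lemma scaled_eln_less_iff:
  assumes "k \<ge> 1"
  shows "ereal y < ereal (1 / real k) * eln x \<longleftrightarrow> ennreal (exp (y * real k)) < x"
  using scaled_eln_le_iff[OF assms, of x y] by (simp only: not_le[symmetric])

lemma limsup_pressure_nonneg:
  assumes "\<not> limsup (\<lambda>k. ereal (1 / real k) * eln (w k)) < 0" "\<eta> > 0"
  shows "\<exists>n\<ge>m. ennreal (exp (- \<eta> * real n)) < w n"
proof (rule ccontr)
  assume "\<not> ?thesis"
  then have "ereal (1 / real n) * eln (w n) \<le> ereal (- \<eta>)" if "n \<ge> max 1 m" for n
    using that by (subst scaled_eln_le_iff) (auto simp: not_less)
  then have "limsup (\<lambda>k. ereal (1 / real k) * eln (w k)) \<le> ereal (- \<eta>)"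
    by (intro Limsup_bounded) (auto simp: eventually_sequentially intro!: exI[of _ "max 1 m"])
  also have "\<dots> < 0" using assms(2) by simp
  finally show False using assms(1) by simp
qed

lemma liminf_pressure_nonneg:
  assumes "\<not> liminf (\<lambda>k. ereal (1 / real k) * eln (w k)) < 0" "\<eta> > 0"
  shows "\<exists>m. \<forall>n\<ge>m. ennreal (exp (- \<eta> * real n)) < w n"
proof -
  have "ereal (- \<eta>) < 0" using assms(2) by simp
  also have "0 \<le> liminf (\<lambda>k. ereal (1 / real k) * eln (w k))" using assms(1) by (simp add: not_less)
  finally have "\<forall>\<^sub>F k in sequentially. ereal (- \<eta>) < ereal (1 / real k) * eln (w k)" by (rule less_LiminfD)
  then obtain m where m: "\<And>k. k \<ge> m \<Longrightarrow> ereal (- \<eta>) < ereal (1 / real k) * eln (w k)"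
    by (auto simp: eventually_sequentially)
  have "ennreal (exp (- \<eta> * real n)) < w n" if "n \<ge> max 1 m" for n
  proof -
    have "1 \<le> n" "m \<le> n" using that by auto
    then show ?thesis using m scaled_eln_less_iff by blast
  qed
  then show ?thesis by blast
qed

lemma liminf_pressure_neg:
  assumes "liminf (\<lambda>k. ereal (1 / real k) * eln (w k)) < 0"
  shows "\<exists>\<eta>>0. \<forall>m. \<exists>n\<ge>m. w n \<le> ennreal (exp (- \<eta> * real n))"
proof -
  obtain y where y: "liminf (\<lambda>k. ereal (1 / real k) * eln (w k)) < ereal y" "ereal y < 0"
    using ereal_dense2[OF assms] by blast
  have "\<exists>n\<ge>m. w n \<le> ennreal (exp (- (- y) * real n))" for m
  proof (rule ccontr)
    assume none: "\<not> ?thesis"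
    have "ereal y < ereal (1 / real n) * eln (w n)" if "n \<ge> max 1 m" for n
    proof -
      have "\<not> w n \<le> ennreal (exp (- (- y) * real n))" "1 \<le> n" using none that by auto
      then show ?thesis using scaled_eln_le_iff[of n "w n" y] by (subst scaled_eln_less_iff) (auto simp: not_le)
    qed
    then have "ereal y \<le> liminf (\<lambda>k. ereal (1 / real k) * eln (w k))"
      by (intro Liminf_bounded) (auto simp: eventually_sequentially less_imp_le intro!: exI[of _ "max 1 m"])
    then show False using y(1) by simp
  qed
  then show ?thesis using y(2) by (intro exI[of _ "- y"]) auto
qed

lemma limsup_pressure_neg:
  assumes "\<And>n. n \<ge> 1 \<Longrightarrow> w n \<le> ennreal (K * q ^ n)" "K > 0" "0 < q" "q < 1"
  shows "limsup (\<lambda>k. ereal (1 / real k) * eln (w k)) < 0"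
proof -
  have "(\<lambda>n. ln K / real n + ln q) \<longlonglongrightarrow> 0 + ln q"
    by (intro tendsto_intros lim_const_over_n)
  then have "\<forall>\<^sub>F n in sequentially. ln K / real n + ln q < ln q / 2"
    using assms by (intro order_tendstoD(2)) auto
  then have "\<forall>\<^sub>F n in sequentially. ereal (1 / real n) * eln (w n) \<le> ereal (ln q / 2)"
    using eventually_ge_at_top[of 1]
  proof eventually_elim
    case (elim n)
    have "K * q ^ n = exp (ln K + real n * ln q)"
      using assms by (simp add: exp_add exp_of_nat_mult)
    also have "\<dots> \<le> exp (ln q / 2 * real n)" using elim by (simp add: field_simps)
    finally have "w n \<le> ennreal (exp (ln q / 2 * real n))"
      using assms(1)[OF elim(2)] by (meson ennreal_leI order_trans)
    then show ?case using elim by (subst scaled_eln_le_iff) auto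
  qed
  then have "limsup (\<lambda>k. ereal (1 / real k) * eln (w k)) \<le> ereal (ln q / 2)" by (rule Limsup_bounded)
  also have "\<dots> < 0" using assms by simp
  finally show ?thesis .
qed

lemma words_nonempty: "words n \<noteq> {}"
proof -
  have "replicate n 1 \<in> words n" by (auto simp: words_def)
  then show ?thesis by blast
qed

lemma infinite_words:
  assumes "n \<ge> 1" shows "infinite (words n)"
proof
  assume "finite (words n)"
  moreover have "range (\<lambda>j. replicate n (Suc j)) \<subseteq> words n" by (auto simp: words_def)
  ultimately have "finite (range (\<lambda>j. replicate n (Suc j)))" by (rule rev_finite_subset)
  moreover have "inj (\<lambda>j. replicate n (Suc j))" using assms by (auto simp: inj_def)
  ultimately show False by (simp add: finite_image_iff)
qed

lemma ennreal_infsum: "infsum f A = (SUP F\<in>{F. finite F \<and> F \<subseteq> A}. sum f F)" for f :: "'b \<Rightarrow> ennreal"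
  by (rule nonneg_infsum_complete) simp

lemma sum_le_infsum_ennreal:
  fixes f :: "'b \<Rightarrow> ennreal"
  shows "finite F \<Longrightarrow> F \<subseteq> A \<Longrightarrow> sum f F \<le> infsum f A"
  unfolding ennreal_infsum by (intro SUP_upper) auto

context quasi_multiplicative
begin

definition full_sum :: "real \<Rightarrow> nat \<Rightarrow> ennreal" where
  "full_sum t n = (\<Sum>\<^sub>\<infinity>u\<in>words n. ennreal (N 1 u powr t))"

definition letter_sum :: "real \<Rightarrow> nat \<Rightarrow> ennreal" where
  "letter_sum t k = (\<Sum>\<^sub>\<infinity>j\<in>{1..}. ennreal (N k [j] powr t))"

definition word_sup :: "nat \<Rightarrow> real" where
  "word_sup k = (SUP u\<in>words k. N 1 u)"

definition letter_sup :: "nat \<Rightarrow> real" where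
  "letter_sup k = (SUP j\<in>{1..}. N k [j])"

definition trunc :: "real \<Rightarrow> nat \<Rightarrow> nat set" where
  "trunc \<epsilon> k = {j. 1 \<le> j \<and> real j \<le> word_sup k powr (- \<epsilon>)}"

text \<open>There are infinitely many words and their weights are at most \<open>1\<close>. Hence exponents with negative
  lower pressure are positive.\<close>

lemma full_sum_nonpos:
  assumes "t \<le> 0" "n \<ge> 1" shows "full_sum t n = \<infinity>"
proof -
  have "of_nat k \<le> full_sum t n" for k
  proof -
    obtain F where F: "F \<subseteq> words n" "finite F" "card F = k"
      using infinite_arbitrarily_large[OF infinite_words[OF assms(2)]] by blast
    have "1 \<le> N 1 u powr t" if "u \<in> F" for u
      using powr_mono2'[of t "N 1 u" 1] that F assms N_pos[of 1 u] N_le_1[of 1 u] by (auto simp: words_def)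
    then have "(\<Sum>u\<in>F. 1) \<le> (\<Sum>u\<in>F. ennreal (N 1 u powr t))"
      by (intro sum_mono) (metis ennreal_1 ennreal_leI)
    also have "\<dots> \<le> full_sum t n" unfolding full_sum_def using F by (intro sum_le_infsum_ennreal) auto
    finally show ?thesis using F by simp
  qed
  then have "(SUP i\<in>{()}. full_sum t n) = \<infinity>" by (intro ennreal_SUP_eq_top) auto
  then show ?thesis by simp
qed

lemma bdd_above_words: "bdd_above (N 1 ` words k)"
  by (rule bdd_aboveI2[of _ _ 1]) (use N_le_1[of 1] in \<open>auto simp: words_def\<close>)

lemma N_le_word_sup: "u \<in> words k \<Longrightarrow> N 1 u \<le> word_sup k"
  unfolding word_sup_def by (intro cSUP_upper bdd_above_words)

lemma word_sup_pos: "0 < word_sup k"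
proof -
  obtain u where u: "u \<in> words k" using words_nonempty by blast
  then have "0 < N 1 u" by (intro N_pos) (auto simp: words_def)
  then show ?thesis using N_le_word_sup[OF u] by linarith
qed

lemma word_sup_le: "word_sup k \<le> c ^ k"
  unfolding word_sup_def using words_nonempty N_le_power[of 1] by (intro cSUP_least) (auto simp: words_def)

lemma word_sup_le_1: "word_sup k \<le> 1"
  using word_sup_le[of k] c power_le_one[of c k] by linarith

lemma card_trunc_le: "finite (trunc \<epsilon> k)" "real (card (trunc \<epsilon> k)) \<le> word_sup k powr (- \<epsilon>)"
proof -
  have sub: "trunc \<epsilon> k \<subseteq> {1..nat \<lfloor>word_sup k powr (- \<epsilon>)\<rfloor>}" by (auto simp: trunc_def le_nat_floor)
  then show "finite (trunc \<epsilon> k)" by (rule finite_subset) simp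
  have "card (trunc \<epsilon> k) \<le> nat \<lfloor>word_sup k powr (- \<epsilon>)\<rfloor>" using card_mono[OF _ sub] by simp
  then have "real (card (trunc \<epsilon> k)) \<le> real (nat \<lfloor>word_sup k powr (- \<epsilon>)\<rfloor>)" by (rule of_nat_mono)
  also have "\<dots> \<le> word_sup k powr (- \<epsilon>)" by (rule of_nat_floor) simp
  finally show "real (card (trunc \<epsilon> k)) \<le> word_sup k powr (- \<epsilon>)" .
qed

lemma alphabets_trunc:
  assumes "\<epsilon> \<ge> 0" shows "alphabets (trunc \<epsilon>)"
proof -
  have "1 \<in> trunc \<epsilon> k" for k
    using powr_mono2'[of "- \<epsilon>" "word_sup k" 1] word_sup_pos[of k] word_sup_le_1[of k] assms by (simp add: trunc_def)
  then show ?thesis using card_trunc_le(1) unfolding alphabets_def by (auto simp: trunc_def)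
qed

text \<open>A word \<open>v\<close> of length \<open>m\<close> followed by the best letter gives a word of length \<open>m + 1\<close>, so
  \<open>word_sup (m + 1)\<close> is at least of the order of \<open>N 1 v * letter_sup (m + 1)\<close>. For large \<open>m\<close> the
  hypothesis bounds \<open>letter_sup (m + 1)\<close> below by the square root of \<open>word_sup (m + 1)\<close>, which makes
  \<open>word_sup (m + 1)\<close> at least of the order of the square of \<open>N 1 v\<close>. This is the origin of the
  exponent \<open>2 * \<epsilon>\<close>.\<close>

lemma card_trunc_bound:
  assumes lim: "(\<lambda>k. ln (letter_sup k) / ln (word_sup k)) \<longlonglongrightarrow> 0" and \<epsilon>: "\<epsilon> > 0"
  shows "\<exists>\<kappa>>0. \<forall>m v. v \<in> words m \<longrightarrow> real (card (trunc \<epsilon> (Suc m))) \<le> \<kappa> * N 1 v powr (- (2 * \<epsilon>))"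
proof -
  have "\<forall>\<^sub>F k in sequentially. ln (letter_sup k) / ln (word_sup k) < 1/2"
    using lim by (rule order_tendstoD(2)) simp
  then obtain k0 where k0: "\<And>k. k \<ge> k0 \<Longrightarrow> ln (letter_sup k) / ln (word_sup k) < 1/2"
    by (auto simp: eventually_sequentially)
  define \<kappa> where "\<kappa> = C powr (2 * \<epsilon>) + (\<Sum>k\<le>k0. word_sup k powr (- \<epsilon>))"
  have sum0: "(\<Sum>k\<le>k0. word_sup k powr (- \<epsilon>)) \<ge> 0" by (intro sum_nonneg) simp
  have "\<kappa> > 0" using sum0 C by (auto simp: \<kappa>_def intro!: add_pos_nonneg)
  moreover have "real (card (trunc \<epsilon> (Suc m))) \<le> \<kappa> * N 1 v powr (- (2 * \<epsilon>))" if v: "v \<in> words m" for m v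
  proof -
    define k where "k = Suc m"
    define M where "M = word_sup k"
    have M: "0 < M" "M < 1"
      using word_sup_pos[of k] word_sup_le[of k] power_Suc_less_one[of c m] c by (auto simp: M_def k_def)
    have vs: "set v \<subseteq> {1..}" "length v = m" using v by (auto simp: words_def)
    have Nv: "0 < N 1 v" "N 1 v \<le> 1" using N_pos[of 1 v] N_le_1[of 1 v] vs by auto
    have "M powr (- \<epsilon>) \<le> \<kappa> * N 1 v powr (- (2 * \<epsilon>))"
    proof (cases "k \<le> k0")
      case True
      have "M powr (- \<epsilon>) \<le> (\<Sum>k\<le>k0. word_sup k powr (- \<epsilon>))"
        unfolding M_def using True by (intro member_le_sum) auto
      also have "\<dots> \<le> \<kappa>" using C by (simp add: \<kappa>_def)
      also have "\<dots> \<le> \<kappa> * N 1 v powr (- (2 * \<epsilon>))"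
        using \<open>\<kappa> > 0\<close> powr_mono2'[of "- (2 * \<epsilon>)" "N 1 v" 1] Nv \<epsilon> by simp
      finally show ?thesis .
    next
      case False
      have letter: "N k [j] \<le> C * M / N 1 v" if j: "j \<ge> 1" for j
      proof -
        have "N 1 v * N (1 + length v) [j] \<le> C * N 1 (v @ [j])" using vs j by (intro N_append_ge) auto
        also have "N 1 (v @ [j]) \<le> M" unfolding M_def k_def
          using vs j by (intro N_le_word_sup) (auto simp: words_def)
        finally show ?thesis using Nv C vs by (simp add: k_def field_simps)
      qed
      have lpos: "0 < letter_sup k"
      proof -
        have "bdd_above ((\<lambda>j. N k [j]) ` {1..})" by (rule bdd_aboveI2[of _ _ "C * M / N 1 v"]) (use letter in auto)
        then have "N k [1] \<le> letter_sup k" unfolding letter_sup_def by (intro cSUP_upper) auto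
        moreover have "0 < N k [1]" by (intro N_pos) (auto simp: k_def)
        ultimately show ?thesis by linarith
      qed
      have le: "letter_sup k \<le> C * M / N 1 v"
        unfolding letter_sup_def using letter by (intro cSUP_least) auto
      have "ln (letter_sup k) / ln M < 1/2" using k0[of k] False by (simp add: M_def)
      then have "ln M / 2 < ln (letter_sup k)" using M by (simp add: divide_less_eq)
      then have "exp (ln M / 2) < letter_sup k" using lpos by (metis exp_less_mono exp_ln)
      then have half: "M powr (1/2) \<le> C * M / N 1 v" using le M by (simp add: powr_def)
      have "M powr (1/2) * (N 1 v / C) \<le> M" using half Nv C by (simp add: field_simps)
      also have "M = M powr (1/2) * M powr (1/2)" using M by (simp add: powr_add[symmetric])
      finally have "N 1 v / C \<le> M powr (1/2)" by (rule mult_left_le_imp_le) (use M in simp)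
      then have "(M powr (1/2)) powr (- (2 * \<epsilon>)) \<le> (N 1 v / C) powr (- (2 * \<epsilon>))"
        using Nv C \<epsilon> by (intro powr_mono2') auto
      then have "M powr (- \<epsilon>) \<le> C powr (2 * \<epsilon>) * N 1 v powr (- (2 * \<epsilon>))"
        using Nv C by (simp add: powr_powr powr_divide powr_minus field_simps)
      also have "\<dots> \<le> \<kappa> * N 1 v powr (- (2 * \<epsilon>))" using sum0 by (intro mult_right_mono) (auto simp: \<kappa>_def)
      finally show ?thesis .
    qed
    then show ?thesis using card_trunc_le(2)[of \<epsilon> k] by (simp add: M_def k_def)
  qed
  ultimately show ?thesis by blast
qed

text \<open>Truncation together with a decrease of the exponent: the exponential gain from the exponent
  outweighs the subexponential loss from the truncation.\<close>

lemma truncated_growth: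
  assumes t: "0 < t'" "t' < t" and \<epsilon>: "\<epsilon> > 0"
    and hyp: "(\<forall>k\<ge>1. letter_sum t' k < \<infinity>) \<and>
        (\<lambda>n. (\<Sum>j\<in>trunc \<epsilon> n. ennreal (N n [j] powr t')) / letter_sum t' n) \<longlonglongrightarrow> 1 \<or>
      (\<lambda>n. \<Sum>j\<in>trunc \<epsilon> n. ennreal (N n [j] powr t')) \<longlonglongrightarrow> \<infinity>"
  shows "\<exists>\<eta>>0. \<exists>b>0. \<exists>q>1. \<forall>n. ennreal (exp (- \<eta> * real n)) < full_sum t n \<longrightarrow> b * q ^ n \<le> wsum (trunc \<epsilon>) t' 1 n"
  using hyp
proof
  have A: "alphabets (trunc \<epsilon>)" using \<epsilon> by (intro alphabets_trunc) simp
  define S where "S = (\<lambda>k. \<Sum>j\<in>trunc \<epsilon> k. N k [j] powr t')"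
  have S: "(\<Sum>j\<in>trunc \<epsilon> k. ennreal (N k [j] powr t')) = ennreal (S k)" for k by (simp add: S_def)
  have Spos: "0 < S k" if "k \<ge> 1" for k using wsum_pos[OF A that, of t' 1] by (simp add: S_def wsum_1)
  {
    assume "(\<lambda>n. \<Sum>j\<in>trunc \<epsilon> n. ennreal (N n [j] powr t')) \<longlonglongrightarrow> \<infinity>"
    then have lim: "(\<lambda>n. ennreal (S n)) \<longlonglongrightarrow> \<infinity>" by (simp only: S)
    have "filterlim S at_top sequentially"
      unfolding filterlim_at_top
    proof
      fix Z :: real
      have "\<forall>\<^sub>F n in sequentially. ennreal \<bar>Z\<bar> < ennreal (S n)"
        using lim by (rule order_tendstoD(1)) (simp add: less_top)
      then show "\<forall>\<^sub>F n in sequentially. Z \<le> S n"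
        by eventually_elim (simp add: ennreal_less_iff)
    qed
    then obtain b where "b > 0" "\<And>n. b * 2 ^ n \<le> wsum (trunc \<epsilon>) t' 1 n"
      using truncation_divergent[OF A less_imp_le[OF t(1)], of 2] unfolding S_def by auto
    then show ?thesis by (intro exI[of _ 1] conjI exI[of _ b] exI[of _ 2]) auto
  next
    assume *: "(\<forall>k\<ge>1. letter_sum t' k < \<infinity>) \<and>
        (\<lambda>n. (\<Sum>j\<in>trunc \<epsilon> n. ennreal (N n [j] powr t')) / letter_sum t' n) \<longlonglongrightarrow> 1"
    define \<rho> where "\<rho> = (\<lambda>k. enn2real (ennreal (S k) / letter_sum t' k))"
    have \<rho>1: "\<rho> \<longlonglongrightarrow> 1"
      using tendsto_enn2real[of "\<lambda>n. ennreal (S n) / letter_sum t' n" 1 sequentially] *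
      by (simp add: \<rho>_def S)
    define \<l> where "\<l> = (\<lambda>k. enn2real (letter_sum t' k))"
    have \<l>: "letter_sum t' k = ennreal (\<l> k)" if "k \<ge> 1" for k using * that by (simp add: \<l>_def)
    have Fl: "(\<Sum>j\<in>F. N k [j] powr t') \<le> \<l> k" if "k \<ge> 1" "finite F" "F \<subseteq> {1..}" for k F
    proof -
      have "ennreal (\<Sum>j\<in>F. N k [j] powr t') = (\<Sum>j\<in>F. ennreal (N k [j] powr t'))" by simp
      also have "\<dots> \<le> letter_sum t' k" unfolding letter_sum_def using that by (intro sum_le_infsum_ennreal) auto
      finally have "ennreal (\<Sum>j\<in>F. N k [j] powr t') \<le> ennreal (\<l> k)" by (simp only: \<l>[OF that(1)])
      moreover have "0 \<le> \<l> k" by (simp add: \<l>_def)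
      ultimately show ?thesis by (simp only: ennreal_le_iff)
    qed
    have Sl: "S k \<le> \<l> k" if "k \<ge> 1" for k
      unfolding S_def using alphabetsD[OF A that] that by (intro Fl) auto
    have \<rho>eq: "\<rho> k = S k / \<l> k" if "k \<ge> 1" for k
      using Spos[OF that] Sl[OF that] by (simp add: \<rho>_def \<l>[OF that] divide_ennreal)
    \<comment> \<open>\<open>exp (\<kappa> * n)\<close> is the gain from the exponent; a quarter of the rate each is given up to the
      hypothesis on \<open>full_sum\<close> and to the truncation\<close>
    define \<kappa> where "\<kappa> = (t - t') * ln (1 / c)"
    have \<kappa>: "\<kappa> > 0" using t c by (simp add: \<kappa>_def)
    have "\<exists>b>0. \<forall>n F. finite F \<longrightarrow> F \<subseteq> words n \<longrightarrow> b * exp (- \<kappa> / 4) ^ n * (\<Sum>u\<in>F. N 1 u powr t') \<le> wsum (trunc \<epsilon>) t' 1 n"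
    proof (rule truncation_convergent[OF A less_imp_le[OF t(1)] _ _ _ \<rho>1])
      show "0 < \<rho> k" if "k \<ge> 1" for k
        using Spos[OF that] Sl[OF that] by (simp add: \<rho>eq[OF that])
      show "\<rho> k * (\<Sum>j\<in>F. N k [j] powr t') \<le> (\<Sum>j\<in>trunc \<epsilon> k. N k [j] powr t')"
        if "k \<ge> 1" "finite F" "F \<subseteq> {1..}" for k F
      proof -
        have "\<rho> k * (\<Sum>j\<in>F. N k [j] powr t') \<le> \<rho> k * \<l> k"
          using Fl[OF that] by (intro mult_left_mono) (auto simp: \<rho>_def)
        also have "\<dots> = S k" using Spos[OF that(1)] Sl[OF that(1)] by (simp add: \<rho>eq[OF that(1)])
        finally show ?thesis by (simp add: S_def)
      qed
    qed (use \<kappa> in auto)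
    then obtain b where b: "b > 0" "\<And>n F. finite F \<Longrightarrow> F \<subseteq> words n \<Longrightarrow>
        b * exp (- \<kappa> / 4) ^ n * (\<Sum>u\<in>F. N 1 u powr t') \<le> wsum (trunc \<epsilon>) t' 1 n" by blast
    have "b * exp (\<kappa> / 2) ^ n \<le> wsum (trunc \<epsilon>) t' 1 n" if big: "ennreal (exp (- (\<kappa> / 4) * real n)) < full_sum t n" for n
    proof -
      obtain F where F: "finite F" "F \<subseteq> words n" and less: "ennreal (exp (- (\<kappa> / 4) * real n)) < (\<Sum>u\<in>F. ennreal (N 1 u powr t))"
        using big unfolding full_sum_def ennreal_infsum less_SUP_iff by blast
      have "exp (- (\<kappa> / 4) * real n) < (\<Sum>u\<in>F. N 1 u powr t)"
        using less by (simp add: ennreal_less_iff)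
      then have "exp (- (\<kappa> / 4) * real n) * exp (\<kappa> * real n) \<le> (\<Sum>u\<in>F. N 1 u powr t) * exp (\<kappa> * real n)"
        by (intro mult_right_mono) auto
      also have "\<dots> = (\<Sum>u\<in>F. N 1 u powr t * (c powr (t' - t)) ^ n)"
      proof -
        have "c powr (t' - t) = exp \<kappa>" using c by (simp add: \<kappa>_def powr_def ln_div algebra_simps)
        then show ?thesis by (simp add: sum_distrib_right exp_of_nat2_mult[symmetric])
      qed
      also have "\<dots> \<le> (\<Sum>u\<in>F. N 1 u powr t')"
        using F t by (intro sum_mono powr_exponent_drop) auto
      also have "exp (- (\<kappa> / 4) * real n) * exp (\<kappa> * real n) = exp (3 * \<kappa> / 4 * real n)"
        by (simp add: exp_add[symmetric] field_simps)
      finally have "exp (3 * \<kappa> / 4 * real n) \<le> (\<Sum>u\<in>F. N 1 u powr t')" .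
      then have "b * exp (- \<kappa> / 4) ^ n * exp (3 * \<kappa> / 4 * real n) \<le> b * exp (- \<kappa> / 4) ^ n * (\<Sum>u\<in>F. N 1 u powr t')"
        using b(1) by (intro mult_left_mono) auto
      also have "\<dots> \<le> wsum (trunc \<epsilon>) t' 1 n" by (rule b(2)[OF F])
      also have "b * exp (- \<kappa> / 4) ^ n * exp (3 * \<kappa> / 4 * real n) = b * exp (\<kappa> / 2) ^ n"
        by (simp add: exp_of_nat_mult[symmetric] exp_add[symmetric] field_simps)
      finally show ?thesis .
    qed
    moreover have "\<kappa> / 4 > 0" "exp (\<kappa> / 2) > 1" using \<kappa> by auto
    ultimately show ?thesis using b(1) by blast
  }
qed

end

section \<open>Dimensions of the attractor\<close>

context cylinder_system
begin

text \<open>The cylinders of level \<open>n\<close> cover the attractor, and their diameters tend to \<open>0\<close> uniformly as \<open>n\<close>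
  grows.\<close>

lemma hausdorff_measure_attractor:
  assumes t: "t > 0" and small: "\<And>e m. e > 0 \<Longrightarrow> \<exists>n\<ge>m. full_sum t n \<le> ennreal e"
  shows "hausdorff_measure t (attractor Jw) = 0"
proof -
  have "(INF U\<in>delta_covers \<delta> (attractor Jw). \<Sum>i. diam_power t (U i)) \<le> 0" if \<delta>: "\<delta> > 0" for \<delta>
  proof (rule ennreal_le_epsilon)
    fix e :: real assume e: "e > 0"
    obtain m where m: "c ^ m < \<delta> / D" using real_arch_pow_inv[of "\<delta> / D" c] c D \<delta> by auto
    obtain n where n: "n \<ge> max 1 m" "full_sum t n \<le> ennreal (e / D powr t)"
      using small[of "e / D powr t" "max 1 m"] e D by auto
    define h where "h = from_nat_into (words n)"
    have h: "bij_betw h UNIV (words n)" unfolding h_def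
      using infinite_words[of n] n(1) by (intro bij_betw_from_nat_into) auto
    have hw: "h i \<in> words n" for i using h by (auto simp: bij_betw_def)
    then have hs: "set (h i) \<subseteq> {1..}" "length (h i) = n" for i by (auto simp: words_def)
    have dm: "diameter (Jw (h i)) \<le> D * N 1 (h i)" for i
      using dist_cyl[OF hs(1)] D N_pos[of 1 "h i"] hs cyl_nonempty[OF hs(1)]
      by (intro diameter_le) (auto simp: dist_norm)
    have "(\<lambda>i. Jw (h i)) \<in> delta_covers \<delta> (attractor Jw)"
      unfolding delta_covers_def mem_Collect_eq
    proof (intro conjI allI)
      have "attractor Jw \<subseteq> (\<Union>u\<in>words n. Jw u)" unfolding attractor_def using n(1) by (intro INF_lower) auto
      also have "words n = range h" using h by (auto simp: bij_betw_def)
      finally show "attractor Jw \<subseteq> (\<Union>i. Jw (h i))" by auto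
      fix i
      show "bounded (Jw (h i))" using compact_cyl[OF hs(1)] by (rule compact_imp_bounded)
      have "D * N 1 (h i) \<le> D * c ^ n" using N_le_power[of 1 "h i"] hs D by (intro mult_left_mono) auto
      also have "\<dots> \<le> D * c ^ m" using n(1) c D by (intro mult_left_mono power_decreasing) auto
      also have "\<dots> \<le> \<delta>" using m D by (simp add: field_simps)
      finally show "diameter (Jw (h i)) \<le> \<delta>" using dm[of i] by simp
    qed
    then have "(INF U\<in>delta_covers \<delta> (attractor Jw). \<Sum>i. diam_power t (U i)) \<le> (\<Sum>i. diam_power t (Jw (h i)))"
      by (rule INF_lower)
    also have "\<dots> \<le> (\<Sum>i. ennreal (D powr t) * ennreal (N 1 (h i) powr t))"
    proof (intro suminf_le allI)
      fix i
      have "diameter (Jw (h i)) powr t \<le> (D * N 1 (h i)) powr t"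
        using dm[of i] t compact_cyl[OF hs(1), of i] by (intro powr_mono2 diameter_ge_0 compact_imp_bounded) auto
      also have "\<dots> = D powr t * N 1 (h i) powr t" using D N_pos[of 1 "h i"] hs by (simp add: powr_mult)
      finally show "diam_power t (Jw (h i)) \<le> ennreal (D powr t) * ennreal (N 1 (h i) powr t)"
        using t by (simp add: diam_power_def ennreal_mult[symmetric] ennreal_leI)
    qed auto
    also have "\<dots> = ennreal (D powr t) * (\<Sum>i. ennreal (N 1 (h i) powr t))" by simp
    also have "(\<Sum>i. ennreal (N 1 (h i) powr t)) \<le> full_sum t n"
      unfolding suminf_eq_SUP
    proof (rule SUP_least)
      fix k
      have "(\<Sum>i<k. ennreal (N 1 (h i) powr t)) = (\<Sum>u\<in>h ` {..<k}. ennreal (N 1 u powr t))"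
        using h by (intro sum.reindex[symmetric, unfolded o_def]) (auto simp: bij_betw_def intro: inj_on_subset)
      also have "\<dots> \<le> full_sum t n" unfolding full_sum_def using hw by (intro sum_le_infsum_ennreal) auto
      finally show "(\<Sum>i<k. ennreal (N 1 (h i) powr t)) \<le> full_sum t n" .
    qed
    also note n(2)
    also have "ennreal (D powr t) * ennreal (e / D powr t) = ennreal e"
      using D e by (simp add: ennreal_mult[symmetric])
    finally show "(INF U\<in>delta_covers \<delta> (attractor Jw). \<Sum>i. diam_power t (U i)) \<le> 0 + ennreal e"
      by (simp add: mult_left_mono)
  qed
  then have "hausdorff_measure t (attractor Jw) \<le> 0"
    unfolding hausdorff_measure_def by (intro SUP_least) auto
  then show ?thesis by simp
qed

lemma full_sum_above_dim:
  fixes t :: real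
  assumes "t > DIM('a)"
  shows "full_sum t n \<le> ennreal (((D + 1) / a) ^ DIM('a) * (c powr (t - DIM('a))) ^ n)"
  unfolding full_sum_def ennreal_infsum
proof (rule SUP_least)
  fix F assume "F \<in> {F. finite F \<and> F \<subseteq> words n}"
  then have F: "finite F" "F \<subseteq> words n" by auto
  define q where "q = c powr (t - DIM('a))"
  have q: "q > 0" "c powr (DIM('a) - t) = inverse q" using c by (simp_all add: q_def powr_minus[symmetric])
  have "N 1 u powr t \<le> N 1 u powr DIM('a) * q ^ n" if "u \<in> F" for u
    using powr_exponent_drop[OF subsetD[OF F(2) that], of "DIM('a)" t] assms q by (simp add: power_inverse field_simps)
  then have "(\<Sum>u\<in>F. N 1 u powr t) \<le> (\<Sum>u\<in>F. N 1 u powr DIM('a)) * q ^ n"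
    unfolding sum_distrib_right by (rule sum_mono)
  also have "\<dots> \<le> ((D + 1) / a) ^ DIM('a) * q ^ n"
    using dim_sum_bounded[OF F] q by (intro mult_right_mono) auto
  finally show "(\<Sum>u\<in>F. ennreal (N 1 u powr t)) \<le> ennreal (((D + 1) / a) ^ DIM('a) * q ^ n)"
    by (simp add: ennreal_leI)
qed

lemma attractor_nonempty: "attractor Jw \<noteq> {}"
proof -
  have A: "alphabets (\<lambda>_. {1})" by (simp add: alphabets_def)
  have "[] \<in> words_over (\<lambda>_. {1}) 1 0" by simp
  then show ?thesis using limit_set_meets_cyl[OF A] limit_set_subset[OF A] by blast
qed

lemma hausdorff_measure_0_attractor: "hausdorff_measure 0 (attractor Jw) \<noteq> 0"
proof
  assume "hausdorff_measure 0 (attractor Jw) = 0"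
  moreover have "(INF U\<in>delta_covers 1 (attractor Jw). \<Sum>i. diam_power 0 (U i)) \<le> hausdorff_measure 0 (attractor Jw)"
    unfolding hausdorff_measure_def by (rule SUP_upper) simp
  ultimately have "(INF U\<in>delta_covers 1 (attractor Jw). \<Sum>i. diam_power 0 (U i)) < 1" by simp
  then obtain U where U: "U \<in> delta_covers 1 (attractor Jw)" "(\<Sum>i. diam_power 0 (U i)) < 1"
    unfolding INF_less_iff by blast
  have "U i = {}" for i
  proof (rule ccontr)
    assume "U i \<noteq> {}"
    then have "1 \<le> (\<Sum>i\<in>{i}. diam_power 0 (U i))" by (simp add: diam_power_def)
    also have "\<dots> \<le> (\<Sum>i. diam_power 0 (U i))" by (intro sum_le_suminf) auto
    finally show False using U(2) by simp
  qed
  then show False using U(1) attractor_nonempty by (auto simp: delta_covers_def)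
qed

end

text \<open>The hypotheses on the weights that control the truncation.\<close>

locale tame_cylinder_system = cylinder_system N C c Jw D a
  for N :: "nat \<Rightarrow> nat list \<Rightarrow> real" and C c :: real and Jw :: "nat list \<Rightarrow> 'a::euclidean_space set" and D a :: real +
  assumes lim: "(\<lambda>k. ln (letter_sup k) / ln (word_sup k)) \<longlonglongrightarrow> 0"
    and dichotomy: "\<And>t :: real. 0 < t \<Longrightarrow> t < DIM('a) \<Longrightarrow>
       (\<forall>k\<ge>1. letter_sum t k = \<infinity>) \<or> (\<forall>k\<ge>1. letter_sum t k < \<infinity>)"
    and convergent: "\<And>(t :: real) \<epsilon>. 0 < t \<Longrightarrow> t < DIM('a) \<Longrightarrow> 0 < \<epsilon> \<Longrightarrow> (\<forall>k\<ge>1. letter_sum t k < \<infinity>) \<Longrightarrow>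
       (\<lambda>n. (\<Sum>j\<in>trunc \<epsilon> n. ennreal (N n [j] powr t)) / letter_sum t n) \<longlonglongrightarrow> 1"
    and divergent: "\<And>(t :: real) \<epsilon>. 0 < t \<Longrightarrow> t < DIM('a) \<Longrightarrow> 0 < \<epsilon> \<Longrightarrow> (\<forall>k\<ge>1. letter_sum t k = \<infinity>) \<Longrightarrow>
       (\<lambda>n. \<Sum>j\<in>trunc \<epsilon> n. ennreal (N n [j] powr t)) \<longlonglongrightarrow> \<infinity>"
begin

abbreviation pressure_seq :: "real \<Rightarrow> nat \<Rightarrow> ereal" where
  "pressure_seq t \<equiv> (\<lambda>k. ereal (1 / real k) * eln (full_sum t k))"

lemma growth:
  fixes t t' :: real
  assumes "0 < t'" "t' < t" "t' < DIM('a)" "\<epsilon> > 0"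
  shows "\<exists>\<eta>>0. \<exists>b>0. \<exists>q>1. \<forall>n. ennreal (exp (- \<eta> * real n)) < full_sum t n \<longrightarrow> b * q ^ n \<le> wsum (trunc \<epsilon>) t' 1 n"
  using truncated_growth[OF assms(1,2,4)] dichotomy[OF assms(1,3)]
    convergent[OF assms(1,3,4)] divergent[OF assms(1,3,4)] by blast

lemma upper_critical_le_dim: "Inf {ereal t | t. limsup (pressure_seq t) < 0} \<le> ereal (DIM('a))"
proof (rule dense_ge)
  fix w assume "ereal (DIM('a)) < w"
  then obtain t where t: "ereal (DIM('a)) < ereal t" "ereal t < w" using ereal_dense2 by blast
  have "limsup (pressure_seq t) < 0"
    using full_sum_above_dim[of t] t(1) D a c
    by (intro limsup_pressure_neg[where K = "((D + 1) / a) ^ DIM('a)" and q = "c powr (t - DIM('a))"])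
       (auto simp: powr01_less_one)
  then have "Inf {ereal t | t. limsup (pressure_seq t) < 0} \<le> ereal t" by (intro Inf_lower) auto
  then show "Inf {ereal t | t. limsup (pressure_seq t) < 0} \<le> w" using t(2) by simp
qed

lemma critical_le: "Inf {ereal t | t. liminf (pressure_seq t) < 0} \<le> Inf {ereal t | t. limsup (pressure_seq t) < 0}"
proof (rule Inf_superset_mono)
  have "liminf (pressure_seq t) < 0" if "limsup (pressure_seq t) < 0" for t
    using le_less_trans[OF Liminf_le_Limsup that] by simp
  then show "{ereal t | t. limsup (pressure_seq t) < 0} \<subseteq> {ereal t | t. liminf (pressure_seq t) < 0}" by blast
qed

text \<open>The exponent \<open>t\<close> has nonnegative pressure, and the smaller exponent \<open>t'\<close> is the one for which the
  truncated sums grow.\<close>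

lemma exponents_below:
  assumes s: "0 \<le> s" "ereal s < Inf {ereal t | t. P t}" "Inf {ereal t | t. P t} \<le> ereal (DIM('a))"
  obtains t' t where "s < t'" "t' < t" "t' < DIM('a)" "\<not> P t"
proof -
  obtain t where t: "ereal s < ereal t" "ereal t < Inf {ereal t | t. P t}" using ereal_dense2[OF s(2)] by blast
  have "\<not> P t"
  proof
    assume "P t"
    then have "Inf {ereal t | t. P t} \<le> ereal t" by (intro Inf_lower) auto
    then show False using t(2) by simp
  qed
  moreover have "ereal t < ereal (DIM('a))" using t(2) s(3) by (rule less_le_trans)
  ultimately show ?thesis using that[of "(s + t) / 2" t] t(1) by (simp add: field_simps)
qed

lemma packing_dim_ge: "Inf {ereal t | t. limsup (pressure_seq t) < 0} \<le> packing_dim (attractor Jw)"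
  unfolding packing_dim_def
proof (rule Inf_greatest, clarify, rule ccontr)
  fix s :: real assume s: "0 \<le> s" "packing_measure s (attractor Jw) = 0"
    and "\<not> Inf {ereal t | t. limsup (pressure_seq t) < 0} \<le> ereal s"
  then have "ereal s < Inf {ereal t | t. limsup (pressure_seq t) < 0}" by simp
  then obtain t' t where t: "s < t'" "t' < t" "t' < DIM('a)" "\<not> limsup (pressure_seq t) < 0"
    using exponents_below[OF s(1) _ upper_critical_le_dim] by blast
  obtain \<eta> b q where g: "\<eta> > 0" "b > 0" "q > 1"
    "\<And>n. ennreal (exp (- \<eta> * real n)) < full_sum t n \<Longrightarrow> b * q ^ n \<le> wsum (trunc 1) t' 1 n"
    using growth[of t' t 1] s t by auto
  have "\<exists>n\<ge>n0. Y < wsum (trunc 1) t' 1 n" for Y n0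
  proof -
    obtain k where k: "Y / b < q ^ k" using real_arch_pow[OF g(3)] by blast
    obtain n where n: "n \<ge> max n0 k" "ennreal (exp (- \<eta> * real n)) < full_sum t n"
      using limsup_pressure_nonneg[OF t(4) g(1)] by blast
    have "q ^ k \<le> q ^ n" using n(1) g(3) by (intro power_increasing) auto
    then have "Y / b < q ^ n" using k by (rule less_le_trans[rotated])
    then have "Y < b * q ^ n" using g(2) by (simp add: field_simps)
    then show ?thesis using g(4)[OF n(2)] n(1) by (intro exI[of _ n]) auto
  qed
  then have "packing_measure s (attractor Jw) \<noteq> 0"
    using alphabets_trunc[of 1] s(1) t(1) limit_set_subset[of "trunc 1"]
    by (intro packing_measure_limit_set[where A = "trunc 1" and t = t']) auto
  then show False using s(2) by simp
qed

lemma hausdorff_dim_ge: "Inf {ereal t | t. liminf (pressure_seq t) < 0} \<le> hausdorff_dim (attractor Jw)"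
  unfolding hausdorff_dim_def
proof (rule Inf_greatest, clarify, rule ccontr)
  fix s :: real assume s: "0 \<le> s" "hausdorff_measure s (attractor Jw) = 0"
    and "\<not> Inf {ereal t | t. liminf (pressure_seq t) < 0} \<le> ereal s"
  then have "ereal s < Inf {ereal t | t. liminf (pressure_seq t) < 0}" by simp
  moreover have "Inf {ereal t | t. liminf (pressure_seq t) < 0} \<le> ereal (DIM('a))"
    using critical_le upper_critical_le_dim by (rule order_trans)
  ultimately obtain t' t where t: "s < t'" "t' < t" "t' < DIM('a)" "\<not> liminf (pressure_seq t) < 0"
    using exponents_below[OF s(1), of "\<lambda>t. liminf (pressure_seq t) < 0"] by blast
  have s0: "s > 0" using s hausdorff_measure_0_attractor by (cases "s = 0") auto
  \<comment> \<open>the truncated alphabets cost \<open>2 * \<epsilon>\<close> in the exponent\<close>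
  define \<epsilon> where "\<epsilon> = (t' - s) / 4"
  have \<epsilon>: "\<epsilon> > 0" "s + 2 * \<epsilon> < t'" using t(1) by (simp_all add: \<epsilon>_def field_simps)
  have A: "alphabets (trunc \<epsilon>)" using \<epsilon> by (intro alphabets_trunc) simp
  obtain \<eta> b q where g: "\<eta> > 0" "b > 0" "q > 1"
    "\<And>n. ennreal (exp (- \<eta> * real n)) < full_sum t n \<Longrightarrow> b * q ^ n \<le> wsum (trunc \<epsilon>) t' 1 n"
    using growth[of t' t \<epsilon>] s0 t \<epsilon> by auto
  obtain m where m: "\<And>n. n \<ge> m \<Longrightarrow> ennreal (exp (- \<eta> * real n)) < full_sum t n"
    using liminf_pressure_nonneg[OF t(4) g(1)] by blast
  define b0 where "b0 = min b (Min (wsum (trunc \<epsilon>) t' 1 ` {..m}))"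
  have b0: "b0 > 0" using g(2) wsum_pos[OF A] by (auto simp: b0_def)
  have b0le: "b0 \<le> wsum (trunc \<epsilon>) t' 1 n" for n
  proof (cases "n \<le> m")
    case True
    then have "Min (wsum (trunc \<epsilon>) t' 1 ` {..m}) \<le> wsum (trunc \<epsilon>) t' 1 n" by (intro Min_le) auto
    then show ?thesis by (simp add: b0_def)
  next
    case False
    then have "b * q ^ n \<le> wsum (trunc \<epsilon>) t' 1 n" by (intro g(4) m) simp
    moreover have "b * 1 \<le> b * q ^ n" using g by (intro mult_left_mono one_le_power) auto
    ultimately show ?thesis by (simp add: b0_def)
  qed
  obtain \<kappa> where \<kappa>: "\<kappa> > 0" "\<And>m v. v \<in> words m \<Longrightarrow> real (card (trunc \<epsilon> (Suc m))) \<le> \<kappa> * N 1 v powr (- (2 * \<epsilon>))"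
    using card_trunc_bound[OF lim \<epsilon>(1)] by blast
  have "hausdorff_measure s (attractor Jw) \<noteq> 0"
    using \<epsilon> by (intro hausdorff_measure_limit_set[OF A s0 _ \<epsilon>(2) b0 b0le \<kappa>(1) \<kappa>(2) limit_set_subset[OF A]])
      (auto intro: words_over_words[OF A])
  then show False using s(2) by simp
qed

lemma hausdorff_dim_le: "hausdorff_dim (attractor Jw) \<le> Inf {ereal t | t. liminf (pressure_seq t) < 0}"
proof (rule Inf_greatest, clarify)
  fix t assume neg: "liminf (pressure_seq t) < 0"
  obtain \<eta> where \<eta>: "\<eta> > 0" "\<And>m. \<exists>n\<ge>m. full_sum t n \<le> ennreal (exp (- \<eta> * real n))"
    using liminf_pressure_neg[OF neg] by blast
  have t: "t > 0"
  proof (rule ccontr)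
    assume "\<not> t > 0"
    then have "full_sum t n = \<infinity>" if "n \<ge> 1" for n using that by (intro full_sum_nonpos) auto
    then show False using \<eta>(2)[of 1] by (auto simp: top_unique)
  qed
  have "\<exists>n\<ge>m. full_sum t n \<le> ennreal e" if e: "e > 0" for e m
  proof -
    have "exp (- \<eta>) < 1" using \<eta>(1) by simp
    then obtain k where k: "exp (- \<eta>) ^ k < e" using real_arch_pow_inv[OF e] by blast
    obtain n where n: "n \<ge> max m k" "full_sum t n \<le> ennreal (exp (- \<eta> * real n))" using \<eta>(2) by blast
    have "exp (- \<eta> * real n) = exp (- \<eta>) ^ n" by (simp add: exp_of_nat_mult[symmetric] mult.commute)
    also have "\<dots> \<le> exp (- \<eta>) ^ k" using n(1) \<eta>(1) by (intro power_decreasing) auto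
    finally have "ennreal (exp (- \<eta> * real n)) \<le> ennreal e" using k by (intro ennreal_leI) simp
    then show ?thesis using n by (meson max.boundedE order_trans)
  qed
  then have "hausdorff_measure t (attractor Jw) = 0" by (intro hausdorff_measure_attractor t) blast
  then show "hausdorff_dim (attractor Jw) \<le> ereal t"
    unfolding hausdorff_dim_def using t by (intro Inf_lower) auto
qed

end

section \<open>Conformal maps of an open set into itself\<close>

text \<open>These properties hold for the maps of the system and are preserved by composition. The inverse is
  given pointwise, by a function that is differentiable at the image points.\<close>

definition conformal_map :: "'a::euclidean_space set \<Rightarrow> ('a \<Rightarrow> 'a) \<Rightarrow> bool" where
  "conformal_map V f \<longleftrightarrow> f ` V \<subseteq> V \<and> inj_on f V \<and> continuous_on V (deriv_norm f) \<and>
     (\<forall>x\<in>V. f differentiable (at x) \<and> similarity_linear (frechet_derivative f (at x))) \<and>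
     (\<exists>g. \<forall>x\<in>V. g (f x) = x \<and> g differentiable (at (f x)))"

lemma similarity_linearD:
  assumes "similarity_linear L"
  shows "linear L" "0 < scaling_factor L" "norm (L v) = scaling_factor L * norm v"
proof -
  obtain r where r: "r > 0" "\<And>v. norm (L v) = r * norm v"
    using assms by (auto simp: similarity_linear_def)
  then have "scaling_factor L = r" by (intro scaling_factor_eq) auto
  then show "0 < scaling_factor L" "norm (L v) = scaling_factor L * norm v" using r by auto
  show "linear L" using assms by (simp add: similarity_linear_def)
qed

lemma conformal_mapD:
  assumes "conformal_map V f" "x \<in> V"
  shows "f x \<in> V" "(f has_derivative frechet_derivative f (at x)) (at x)"
    "norm (frechet_derivative f (at x) v) = deriv_norm f x * norm v" "0 < deriv_norm f x"
    "linear (frechet_derivative f (at x))"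
proof -
  have *: "f ` V \<subseteq> V" "f differentiable (at x)" "similarity_linear (frechet_derivative f (at x))"
    using assms by (auto simp: conformal_map_def)
  show "f x \<in> V" using * assms(2) by auto
  show "(f has_derivative frechet_derivative f (at x)) (at x)"
    using *(2) by (simp add: frechet_derivative_works)
  show "norm (frechet_derivative f (at x) v) = deriv_norm f x * norm v" "0 < deriv_norm f x"
    "linear (frechet_derivative f (at x))"
    using similarity_linearD[OF *(3)] by (simp_all add: deriv_norm_def)
qed

lemma conformal_map_continuous: "conformal_map V f \<Longrightarrow> continuous_on V f"
  by (meson conformal_mapD(2) continuous_at_imp_continuous_on has_derivative_continuous)

lemma deriv_norm_eq:
  assumes "(f has_derivative L) (at x)" "\<And>v. norm (L v) = r * norm v"
  shows "deriv_norm f x = r"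
  using frechet_derivative_at[OF assms(1)] scaling_factor_eq[of L r] assms(2) by (simp add: deriv_norm_def)

lemma deriv_norm_id: "deriv_norm id x = 1"
  by (rule deriv_norm_eq[of _ "\<lambda>v. v"]) (auto simp: id_def)

lemma conformal_map_id: "conformal_map V id"
proof -
  have d: "(id has_derivative (\<lambda>v. v)) (at x)" for x :: 'a by (simp add: id_def)
  have "frechet_derivative id (at x) = (\<lambda>v. v)" for x :: 'a using frechet_derivative_at[OF d] by simp
  moreover have "similarity_linear (\<lambda>v::'a. v)"
    unfolding similarity_linear_def by (intro conjI exI[of _ 1]) (auto simp: linear_iff)
  moreover have "id differentiable (at x)" for x :: 'a using d differentiableI by blast
  moreover have "deriv_norm id = (\<lambda>_::'a. 1)" using deriv_norm_id by blast
  ultimately show ?thesis unfolding conformal_map_def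
    by (intro conjI exI[of _ id] ballI) auto
qed

lemma
  assumes f: "conformal_map V f" and g: "conformal_map V g"
  shows deriv_norm_comp: "x \<in> V \<Longrightarrow> deriv_norm (f \<circ> g) x = deriv_norm f (g x) * deriv_norm g x"
    and conformal_map_comp: "conformal_map V (f \<circ> g)"
proof -
  have d: "((f \<circ> g) has_derivative (frechet_derivative f (at (g x)) \<circ> frechet_derivative g (at x))) (at x)"
    and n: "norm ((frechet_derivative f (at (g x)) \<circ> frechet_derivative g (at x)) v) = (deriv_norm f (g x) * deriv_norm g x) * norm v"
    if x: "x \<in> V" for x v
  proof -
    have gx: "g x \<in> V" by (rule conformal_mapD(1)[OF g x])
    show "((f \<circ> g) has_derivative (frechet_derivative f (at (g x)) \<circ> frechet_derivative g (at x))) (at x)"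
      by (rule diff_chain_at[OF conformal_mapD(2)[OF g x] conformal_mapD(2)[OF f gx]])
    show "norm ((frechet_derivative f (at (g x)) \<circ> frechet_derivative g (at x)) v) = (deriv_norm f (g x) * deriv_norm g x) * norm v"
      by (simp add: conformal_mapD(3)[OF g x] conformal_mapD(3)[OF f gx])
  qed
  show comp: "deriv_norm (f \<circ> g) x = deriv_norm f (g x) * deriv_norm g x" if "x \<in> V" for x
    by (rule deriv_norm_eq[OF d[OF that] n[OF that]])
  have cont: "continuous_on V (deriv_norm (f \<circ> g))"
  proof -
    have gV: "g ` V \<subseteq> V" using g by (simp add: conformal_map_def)
    have "continuous_on V (\<lambda>x. deriv_norm f (g x) * deriv_norm g x)"
      using f g conformal_map_continuous[OF g] gV unfolding conformal_map_def
      by (intro continuous_intros continuous_on_compose2[of V "deriv_norm f" V g]) auto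
    then show ?thesis by (rule continuous_on_eq) (simp add: comp)
  qed
  have sim: "similarity_linear (frechet_derivative (f \<circ> g) (at x))" if x: "x \<in> V" for x
  proof -
    have gx: "g x \<in> V" by (rule conformal_mapD(1)[OF g x])
    have "linear (frechet_derivative f (at (g x)) \<circ> frechet_derivative g (at x))"
      by (intro linear_compose conformal_mapD(5)[OF g x] conformal_mapD(5)[OF f gx])
    moreover have "deriv_norm f (g x) * deriv_norm g x > 0"
      using conformal_mapD(4)[OF g x] conformal_mapD(4)[OF f gx] by simp
    ultimately show ?thesis
      unfolding frechet_derivative_at[OF d[OF x], symmetric] similarity_linear_def
      using n[OF x] by blast
  qed
  have "\<exists>h. \<forall>x\<in>V. h (f x) = x \<and> h differentiable (at (f x))"
    using f unfolding conformal_map_def by (elim conjE)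
  then obtain f' where "\<forall>x\<in>V. f' (f x) = x \<and> f' differentiable (at (f x))" by (elim exE) (rule that)
  note f' = this[rule_format]
  have "\<exists>h. \<forall>x\<in>V. h (g x) = x \<and> h differentiable (at (g x))"
    using g unfolding conformal_map_def by (elim conjE)
  then obtain g' where "\<forall>x\<in>V. g' (g x) = x \<and> g' differentiable (at (g x))" by (elim exE) (rule that)
  note g' = this[rule_format]
  have inv: "(g' \<circ> f') ((f \<circ> g) x) = x \<and> (g' \<circ> f') differentiable (at ((f \<circ> g) x))" if x: "x \<in> V" for x
  proof -
    have gx: "g x \<in> V" by (rule conformal_mapD(1)[OF g x])
    show ?thesis using f'[OF gx] g'[OF x] by (auto intro!: differentiable_chain_at)
  qed
  have "(f \<circ> g) ` V \<subseteq> V" using f g by (auto simp: conformal_map_def)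
  moreover have "inj_on (f \<circ> g) V"
    using f g unfolding conformal_map_def by (meson comp_inj_on inj_on_subset)
  moreover have "(f \<circ> g) differentiable (at x)" if "x \<in> V" for x using d[OF that] by (rule differentiableI)
  ultimately show "conformal_map V (f \<circ> g)"
    unfolding conformal_map_def using cont sim inv by (intro conjI ballI exI[of _ "g' \<circ> f'"]) auto
qed

lemma conformal_diffeo_imp_conformal_map:
  fixes f :: "'a::euclidean_space \<Rightarrow> 'a"
  assumes "conformal_diffeo_into V f" shows "conformal_map V f"
proof -
  have *: "f ` V \<subseteq> V" "inj_on f V" "C1_on V f" "C1_on (f ` V) (the_inv_into V f)"
    "\<And>x. x \<in> V \<Longrightarrow> similarity_linear (frechet_derivative f (at x))"
    using assms by (auto simp: conformal_diffeo_into_def)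
  obtain f' :: "'a \<Rightarrow> 'a \<Rightarrow>\<^sub>L 'a" where f': "continuous_on V f'"
    "\<And>x. x \<in> V \<Longrightarrow> (f has_derivative blinfun_apply (f' x)) (at x)"
    using *(3) by (auto simp: C1_on_def)
  obtain b :: 'a where b: "b \<in> Basis" using nonempty_Basis by blast
  have "deriv_norm f x = norm (blinfun_apply (f' x) b)" if "x \<in> V" for x
    using similarity_linearD(3)[OF *(5)[OF that], of b] frechet_derivative_at[OF f'(2)[OF that]] b
    by (simp add: deriv_norm_def)
  moreover have "continuous_on V (\<lambda>x. norm (blinfun_apply (f' x) b))"
    using f'(1) by (intro continuous_intros)
  ultimately have "continuous_on V (deriv_norm f)" by (metis (no_types, lifting) continuous_on_eq)
  moreover have "the_inv_into V f (f x) = x \<and> the_inv_into V f differentiable (at (f x))" if "x \<in> V" for x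
    using *(2,4) that the_inv_into_f_f unfolding C1_on_def by (metis differentiableI imageI)
  moreover have "f differentiable (at x)" if "x \<in> V" for x using f'(2)[OF that] by (rule differentiableI)
  ultimately show ?thesis
    unfolding conformal_map_def using * by (intro conjI ballI exI[of _ "the_inv_into V f"]) auto
qed

lemma conformal_map_lipschitz:
  assumes f: "conformal_map V f" and S: "convex S" "S \<subseteq> V" and M: "\<And>x. x \<in> S \<Longrightarrow> deriv_norm f x \<le> M"
    and "x \<in> S" "y \<in> S"
  shows "norm (f x - f y) \<le> M * norm (x - y)"
proof (rule differentiable_bound[OF S(1)])
  fix z assume z: "z \<in> S"
  then have zV: "z \<in> V" using S by auto
  show "(f has_derivative frechet_derivative f (at z)) (at z within S)"
    using conformal_mapD(2)[OF f zV] by (rule has_derivative_at_withinI)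
  show "onorm (frechet_derivative f (at z)) \<le> M"
    using M[OF z] conformal_mapD(3)[OF f zV] by (intro onorm_le) (simp add: mult_right_mono)
qed (use assms in auto)

text \<open>The domain need not be convex, so the mean value inequality only holds on balls. But the points
  at which a uniform bound of this kind compares the values form the classes of an equivalence
  relation with open classes, so by connectedness there is one class; compactness makes the
  bound uniform.\<close>

lemma conformal_map_diameter:
  fixes V :: "'a::euclidean_space set"
  assumes V: "open V" "connected V" and J: "compact J" "J \<subseteq> V" "J \<noteq> {}"
  shows "\<exists>D>0. \<forall>f M. conformal_map V f \<longrightarrow> (\<forall>x\<in>V. deriv_norm f x \<le> M) \<longrightarrow>
           (\<forall>x\<in>J. \<forall>y\<in>J. dist (f x) (f y) \<le> D * M)"
proof -
  define bnd where "bnd = (\<lambda>x y L. \<forall>f M. conformal_map V f \<longrightarrow> (\<forall>x\<in>V. deriv_norm f x \<le> M) \<longrightarrow>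
                         dist (f x) (f y) \<le> L * M)"
  define R where "R = (\<lambda>x y. \<exists>L. bnd x y L)"
  have M0: "M \<ge> 0" if "conformal_map V f" "\<forall>x\<in>V. deriv_norm f x \<le> M" for f M
    using J that conformal_mapD(4)[OF that(1)] by (meson ex_in_conv less_eq_real_def order_trans subsetD)
  have Rsym: "R y x" if "R x y" for x y using that by (simp add: R_def bnd_def dist_commute)
  have Rtrans: "R x z" if xyz: "R x y" "R y z" for x y z
  proof -
    obtain L1 L2 where "bnd x y L1" "bnd y z L2" using xyz unfolding R_def by blast
    note L = this[unfolded bnd_def, rule_format]
    have "dist (f x) (f z) \<le> (L1 + L2) * M" if "conformal_map V f" "\<forall>x\<in>V. deriv_norm f x \<le> M" for f M
      using L(1)[of f M] L(2)[of f M] that dist_triangle[of "f x" "f z" "f y"] by (simp add: distrib_right)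
    then have "bnd x z (L1 + L2)" unfolding bnd_def by blast
    then show ?thesis unfolding R_def by blast
  qed
  have ballR: "dist (f x) (f y) \<le> e * M" if "ball x e \<subseteq> V" "y \<in> ball x e" "conformal_map V f" "\<forall>x\<in>V. deriv_norm f x \<le> M" for x y e f M
  proof -
    have e: "e > 0" using that(2) by (metis ball_eq_empty empty_iff not_le)
    have "norm (f x - f y) \<le> M * norm (x - y)"
      by (rule conformal_map_lipschitz[OF that(3) convex_ball that(1)]) (use that e in auto)
    also have "\<dots> \<le> M * e" using that(2) M0[OF that(3,4)] by (intro mult_left_mono) (auto simp: dist_norm)
    finally show ?thesis by (simp add: dist_norm mult.commute)
  qed
  have Rall: "R x y" if "x \<in> V" "y \<in> V" for x y
  proof (rule connected_equivalence_relation[OF V(2) that])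
    fix x assume x: "x \<in> V"
    then obtain e where e: "e > 0" "ball x e \<subseteq> V" using V(1) by (auto simp: open_contains_ball)
    have "bnd x y e" if "y \<in> ball x e" for y unfolding bnd_def using ballR[OF e(2) that] by blast
    then have "R x y" if "y \<in> ball x e" for y unfolding R_def using that by blast
    then show "\<exists>T. openin (top_of_set V) T \<and> x \<in> T \<and> (\<forall>y\<in>T. R x y)"
      using e by (intro exI[of _ "ball x e"]) (auto simp: openin_open_eq[OF V(1)])
  qed (use Rsym Rtrans in blast)+
  obtain x0 where x0: "x0 \<in> J" using J by blast
  have "\<exists>e. 0 < e \<and> ball x e \<subseteq> V" if "x \<in> J" for x
    using that V(1) J(2) by (meson open_contains_ball subsetD)
  then obtain e where e: "\<And>x. x \<in> J \<Longrightarrow> 0 < e x" "\<And>x. x \<in> J \<Longrightarrow> ball x (e x) \<subseteq> V" by metis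
  obtain T where T: "T \<subseteq> J" "finite T" "J \<subseteq> (\<Union>x\<in>T. ball x (e x))"
    using compactE_image[OF J(1), of J "\<lambda>x. ball x (e x)"] e by force
  have "\<forall>x\<in>T. R x x0" using Rall T(1) J(2) x0 by blast
  then obtain L where "\<forall>x\<in>T. bnd x x0 (L x)" unfolding R_def by (rule bchoice[THEN exE])
  then have L: "dist (f x) (f x0) \<le> L x * M" if "x \<in> T" "conformal_map V f" "\<forall>x\<in>V. deriv_norm f x \<le> M" for x f M
    using that unfolding bnd_def by blast
  define B where "B = (\<Sum>x\<in>T. \<bar>L x\<bar> + e x)"
  have B0: "B \<ge> 0" using e(1) T(1) unfolding B_def by (intro sum_nonneg) (auto simp: less_imp_le add_nonneg_nonneg)
  have near: "dist (f y) (f x0) \<le> B * M" if fM: "conformal_map V f" "\<forall>x\<in>V. deriv_norm f x \<le> M" and y: "y \<in> J" for f M y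
  proof -
    obtain x where x: "x \<in> T" "y \<in> ball x (e x)" using T(3) y by blast
    have "dist (f y) (f x0) \<le> dist (f x) (f y) + dist (f x) (f x0)" using dist_triangle[of "f y" "f x0" "f x"] by (simp add: dist_commute)
    also have "\<dots> \<le> e x * M + L x * M" using ballR[OF e(2) x(2) fM] L[OF x(1) fM] x(1) T(1) by (intro add_mono) auto
    also have "\<dots> \<le> (\<bar>L x\<bar> + e x) * M" using mult_right_mono[OF abs_ge_self[of "L x"] M0[OF fM]] by (simp add: algebra_simps)
    also have "\<dots> \<le> B * M"
      unfolding B_def using e(1) T(1) x(1)
      by (intro mult_right_mono M0[OF fM] member_le_sum T(2)) (auto simp: less_imp_le add_nonneg_nonneg)
    finally show ?thesis .
  qed
  have "dist (f x) (f y) \<le> (2 * B + 1) * M" if "conformal_map V f" "\<forall>x\<in>V. deriv_norm f x \<le> M" "x \<in> J" "y \<in> J" for f M x y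
    using near[OF that(1,2,3)] near[OF that(1,2,4)] dist_triangle[of "f x" "f y" "f x0"] M0[OF that(1,2)]
    by (simp add: dist_commute algebra_simps)
  moreover have "2 * B + 1 > 0" using B0 by simp
  ultimately show ?thesis by blast
qed

text \<open>On the closed ball around \<open>f x0\<close> up to the nearest boundary point of the image, the inverse map is
  Lipschitz with constant \<open>1 / m\<close>, and it maps this boundary point to a point at distance \<open>\<rho>\<close> from
  \<open>x0\<close>. So the boundary point has distance at least \<open>m * \<rho>\<close> from \<open>f x0\<close>.\<close>

lemma conformal_map_image_ball:
  fixes V :: "'a::euclidean_space set"
  assumes V: "open V" and f: "conformal_map V f" and \<rho>: "\<rho> > 0" "cball x0 \<rho> \<subseteq> V"
    and m: "m > 0" "\<And>x. x \<in> V \<Longrightarrow> m \<le> deriv_norm f x"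
  shows "ball (f x0) (m * \<rho>) \<subseteq> f ` ball x0 \<rho>"
proof
  fix y assume y: "y \<in> ball (f x0) (m * \<rho>)"
  define U where "U = f ` ball x0 \<rho>"
  have bV: "ball x0 \<rho> \<subseteq> V" using \<rho> ball_subset_cball by blast
  have cont: "continuous_on V f" by (rule conformal_map_continuous[OF f])
  have U: "open U" unfolding U_def
    using f bV cont by (intro invariance_of_domain) (auto simp: conformal_map_def intro: continuous_on_subset inj_on_subset)
  have clU: "closure U \<subseteq> f ` cball x0 \<rho>"
  proof (rule closure_minimal)
    show "U \<subseteq> f ` cball x0 \<rho>" unfolding U_def using ball_subset_cball by blast
    show "closed (f ` cball x0 \<rho>)"
      by (intro compact_imp_closed compact_continuous_image continuous_on_subset[OF cont] \<rho>(2)) simp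
  qed
  have fU: "f x0 \<in> U" using \<rho> by (simp add: U_def)
  show "y \<in> f ` ball x0 \<rho>"
  proof (rule ccontr)
    assume "y \<notin> f ` ball x0 \<rho>"
    then have "U \<noteq> UNIV" by (auto simp: U_def)
    then have "frontier U \<noteq> {}" using fU frontier_not_empty[of U] by blast
    then obtain z where z: "z \<in> frontier U" "\<And>w. w \<in> frontier U \<Longrightarrow> dist (f x0) z \<le> dist (f x0) w"
      using distance_attains_inf[of "frontier U" "f x0"] by auto
    define \<tau> where "\<tau> = dist (f x0) z"
    have "z \<notin> U" using z(1) U by (simp add: frontier_def interior_open)
    then have \<tau>0: "\<tau> > 0" using fU by (auto simp: \<tau>_def)
    have bU: "ball (f x0) \<tau> \<subseteq> U"
    proof (rule ccontr)
      assume "\<not> ball (f x0) \<tau> \<subseteq> U"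
      moreover have "f x0 \<in> ball (f x0) \<tau> \<inter> U" using fU \<tau>0 by simp
      ultimately have "ball (f x0) \<tau> \<inter> frontier U \<noteq> {}"
        by (intro connected_Int_frontier connected_ball) blast+
      then show False using z(2) by (force simp: \<tau>_def)
    qed
    have cb: "cball (f x0) \<tau> \<subseteq> f ` cball x0 \<rho>"
      using closure_mono[OF bU] clU \<tau>0 by (simp add: closure_ball)
    obtain q where q: "q \<in> cball x0 \<rho>" "z = f q" using clU z(1) by (auto simp: frontier_def)
    have "q \<notin> ball x0 \<rho>" using \<open>z \<notin> U\<close> q by (auto simp: U_def)
    then have dq: "dist x0 q = \<rho>" using q by simp
    obtain g where g: "\<And>x. x \<in> V \<Longrightarrow> g (f x) = x" "\<And>x. x \<in> V \<Longrightarrow> g differentiable (at (f x))"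
      using f by (auto simp: conformal_map_def)
    have "norm (g (f x0) - g z) \<le> (1 / m) * norm (f x0 - z)"
    proof (rule differentiable_bound[of "cball (f x0) \<tau>"])
      fix w assume "w \<in> cball (f x0) \<tau>"
      then obtain x where x: "x \<in> V" "w = f x" using cb \<rho>(2) by blast
      obtain G where G: "(g has_derivative G) (at w)" using g(2)[OF x(1)] x(2) by (auto simp: differentiable_def)
      define F where "F = frechet_derivative f (at x)"
      have "(g \<circ> f has_derivative (G \<circ> F)) (at x)"
        using diff_chain_at[OF conformal_mapD(2)[OF f x(1)], of g G] G x(2) by (simp add: F_def)
      moreover have "(g \<circ> f has_derivative (\<lambda>v. v)) (at x)"
        by (rule has_derivative_transform_within_open[OF has_derivative_ident V x(1)]) (simp add: g)
      ultimately have GF: "G \<circ> F = (\<lambda>v. v)" by (rule has_derivative_unique)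
      have lin: "linear F" using conformal_mapD(5)[OF f x(1)] by (simp add: F_def)
      have "inj F" by (metis GF inj_on_def o_apply)
      then have surj: "surj F" by (rule linear_inj_imp_surj[OF lin])
      have "norm (G v) \<le> (1 / m) * norm v" for v
      proof -
        obtain v' where v': "v = F v'" using surj by blast
        have "norm v = deriv_norm f x * norm v'" unfolding v' F_def by (rule conformal_mapD(3)[OF f x(1)])
        then have "m * norm v' \<le> norm v" using m(2)[OF x(1)] by (simp add: mult_right_mono)
        moreover have "G v = v'" using GF v' by (metis o_apply)
        ultimately show ?thesis using m(1) by (simp add: field_simps)
      qed
      then have "onorm G \<le> 1 / m" by (rule onorm_le)
      then show "onorm (frechet_derivative g (at w)) \<le> 1 / m" using frechet_derivative_at[OF G] by simp
      show "(g has_derivative frechet_derivative g (at w)) (at w within cball (f x0) \<tau>)"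
        using g(2)[OF x(1)] x(2) by (simp add: frechet_derivative_works has_derivative_at_withinI)
    qed (use \<tau>0 in \<open>auto simp: \<tau>_def\<close>)
    moreover have "x0 \<in> V" "q \<in> V" using \<rho> q(1) by auto
    then have "g (f x0) = x0" "g z = q" using g(1) q(2) by simp_all
    ultimately have "\<rho> \<le> \<tau> / m" using dq by (simp add: dist_norm \<tau>_def)
    then have "m * \<rho> \<le> \<tau>" using m(1) by (simp add: field_simps)
    then have "y \<in> U" using y bU by auto
    then show False using \<open>y \<notin> f ` ball x0 \<rho>\<close> by (simp add: U_def)
  qed
qed

text \<open>The Lipschitz bound is only known on \<open>J\<close>, so it bounds the derivative first in the interior of
  \<open>J\<close>, and then on \<open>J\<close> by continuity.\<close>

lemma deriv_norm_le_lipschitz: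
  fixes f :: "'a::euclidean_space \<Rightarrow> 'a"
  assumes f: "conformal_map V f" and J: "closure (interior J) = J" "J \<subseteq> V"
    and lip: "\<And>x y. x \<in> J \<Longrightarrow> y \<in> J \<Longrightarrow> norm (f x - f y) \<le> c * norm (x - y)" and x: "x \<in> J"
  shows "deriv_norm f x \<le> c"
proof -
  obtain b :: 'a where b: "b \<in> Basis" using nonempty_Basis by blast
  have int: "deriv_norm f y \<le> c" if y: "y \<in> interior J" for y
  proof -
    have yV: "y \<in> V" using y J(2) interior_subset by blast
    define F where "F = frechet_derivative f (at y)"
    have "norm (F b) \<le> c + e" if e: "e > 0" for e
    proof -
      obtain d where d: "d > 0" "\<And>z. norm (z - y) < d \<Longrightarrow> norm (f z - f y - F (z - y)) \<le> e * norm (z - y)"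
        using conformal_mapD(2)[OF f yV] e unfolding has_derivative_at_alt F_def by blast
      obtain d' where d': "d' > 0" "ball y d' \<subseteq> J" using y by (auto simp: mem_interior)
      define h where "h = min d d' / 2"
      have h: "h > 0" "h < d" "h < d'" using d(1) d'(1) by (auto simp: h_def)
      define z where "z = y + h *\<^sub>R b"
      have nz: "norm (z - y) = h" using h b by (simp add: z_def)
      have "z \<in> J" "y \<in> J" using d' h nz by (auto simp: dist_norm norm_minus_commute subset_eq)
      then have "norm (f z - f y) \<le> c * h" using lip[of z y] nz by simp
      moreover have "norm (f z - f y - F (z - y)) \<le> e * h" using d(2)[of z] nz h by simp
      ultimately have "norm (F (z - y)) \<le> (c + e) * h"
        using norm_triangle_ineq4[of "f z - f y" "f z - f y - F (z - y)"] by (simp add: algebra_simps)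
      moreover have "F (z - y) = h *\<^sub>R F b"
        using conformal_mapD(5)[OF f yV] by (simp add: F_def z_def linear_cmul)
      ultimately show ?thesis using h by simp
    qed
    then have "norm (F b) \<le> c" by (rule field_le_epsilon)
    moreover have "norm (F b) = deriv_norm f y * norm b" unfolding F_def by (rule conformal_mapD(3)[OF f yV])
    ultimately show ?thesis using b by simp
  qed
  have "continuous_on J (deriv_norm f)"
    using f J(2) by (auto simp: conformal_map_def intro: continuous_on_subset)
  then show ?thesis
    using continuous_le_on_closure[of "interior J" "deriv_norm f" x c] int x J(1) by simp
qed

lemma word_map_append: "word_map \<phi> l (u @ v) = word_map \<phi> l u \<circ> word_map \<phi> (l + length u) v"
  by (induction u arbitrary: l) (auto simp: o_assoc)

lemma word_map_conformal:
  assumes "\<And>k i. k \<ge> 1 \<Longrightarrow> i \<ge> 1 \<Longrightarrow> conformal_map V (\<phi> k i)" "l \<ge> 1" "set u \<subseteq> {1..}"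
  shows "conformal_map V (word_map \<phi> l u)"
  using assms(2,3)
proof (induction u arbitrary: l)
  case (Cons i u)
  have "conformal_map V (\<phi> l i)" using Cons.prems by (intro assms(1)) auto
  moreover have "conformal_map V (word_map \<phi> (Suc l) u)" using Cons.prems by (intro Cons.IH) auto
  ultimately show ?case unfolding word_map.simps by (rule conformal_map_comp)
qed (simp add: conformal_map_id)

lemma word_map_invariant:
  assumes "\<And>k i. k \<ge> 1 \<Longrightarrow> i \<ge> 1 \<Longrightarrow> \<phi> k i ` J \<subseteq> J" "l \<ge> 1" "set u \<subseteq> {1..}"
  shows "word_map \<phi> l u ` J \<subseteq> J"
  using assms(2,3)
proof (induction u arbitrary: l)
  case (Cons i u)
  have "word_map \<phi> (Suc l) u ` J \<subseteq> J" using Cons by auto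
  moreover have "\<phi> l i ` J \<subseteq> J" using Cons.prems by (intro assms(1)) auto
  ultimately show ?case by fastforce
qed simp

text \<open>The contraction ratio and the distortion constant are those of the system. The translations in the
  definition of the cylinders change neither diameters nor inner radii.\<close>

lemma conformal_cylinder_system:
  fixes J :: "'a::euclidean_space set"
  assumes nifs: "nonautonomous_ifs J \<phi> Jw" and conf: "conformal_system J \<phi>" and osc: "open_set_condition Jw"
  shows "\<exists>C c D a. cylinder_system (\<lambda>l u. sup_deriv_norm J (word_map \<phi> l u)) C c Jw D a"
proof -
  define N where "N = (\<lambda>l u. sup_deriv_norm J (word_map \<phi> l u))"
  note nifs' = nifs[unfolded nonautonomous_ifs_def]
  have J: "compact J" "interior J \<noteq> {}" "closure (interior J) = J" using nifs' by simp_all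
  have "\<forall>k\<ge>1. \<forall>i\<ge>1. \<phi> k i ` J \<subseteq> J" using nifs' by (elim conjE)
  then have maps: "\<phi> k i ` J \<subseteq> J" if "k \<ge> 1" "i \<ge> 1" for k i using that by simp
  have "\<forall>n. \<forall>u\<in>words n. closed (Jw u) \<and> Jw u \<subseteq> J" using nifs' by (elim conjE)
  then have closedJ: "closed (Jw u) \<and> Jw u \<subseteq> J" if "u \<in> words n" for u n using that by simp
  have "\<forall>k. \<forall>u\<in>words k. \<forall>i\<ge>1. Jw (u @ [i]) \<subseteq> Jw u" using nifs' by (elim conjE)
  then have nested: "Jw (u @ [i]) \<subseteq> Jw u" if "u \<in> words k" "i \<ge> 1" for k u i using that by simp
  have "\<forall>k. \<forall>u\<in>words k. \<exists>\<omega>. Jw u = (\<lambda>x. word_map \<phi> 1 u x + \<omega>) ` J" using nifs' by (elim conjE)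
  then have transl: "\<exists>\<omega>. Jw u = (\<lambda>x. word_map \<phi> 1 u x + \<omega>) ` J" if "u \<in> words k" for k u using that by blast
  have "\<exists>c. 0 < c \<and> c < 1 \<and>
        (\<forall>k\<ge>1. \<forall>i\<ge>1. \<forall>x\<in>J. \<forall>y\<in>J. norm (\<phi> k i x - \<phi> k i y) \<le> c * norm (x - y))"
    using nifs' by (elim conjE)
  then obtain c where c: "0 < c" "c < 1"
    and "\<forall>k\<ge>1. \<forall>i\<ge>1. \<forall>x\<in>J. \<forall>y\<in>J. norm (\<phi> k i x - \<phi> k i y) \<le> c * norm (x - y)"
    by (elim exE conjE) (rule that)
  then have contr: "norm (\<phi> k i x - \<phi> k i y) \<le> c * norm (x - y)"
    if "k \<ge> 1" "i \<ge> 1" "x \<in> J" "y \<in> J" for k i x y using that by simp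
  from conf obtain V C where V: "open V" "connected V" "J \<subseteq> V"
    and diffeo': "\<forall>k\<ge>1. \<forall>i\<ge>1. conformal_diffeo_into V (\<phi> k i)"
    and C: "C \<ge> 1" and dist': "\<forall>l\<ge>1. \<forall>n\<ge>1. \<forall>u\<in>words n. \<forall>x\<in>V. \<forall>y\<in>V.
           deriv_norm (word_map \<phi> l u) x \<le> C * deriv_norm (word_map \<phi> l u) y"
    unfolding conformal_system_def by (elim exE conjE) (rule that)
  have diffeo: "conformal_diffeo_into V (\<phi> k i)" if "k \<ge> 1" "i \<ge> 1" for k i using diffeo' that by simp
  have dist0: "deriv_norm (word_map \<phi> l u) x \<le> C * deriv_norm (word_map \<phi> l u) y"
    if "l \<ge> 1" "n \<ge> 1" "u \<in> words n" "x \<in> V" "y \<in> V" for l n u x y using dist' that by simp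
  have in_words: "u \<in> words (length u)" if "set u \<subseteq> {1..}" for u using that by (simp add: words_def)
  have cm: "conformal_map V (word_map \<phi> l u)" if "l \<ge> 1" "set u \<subseteq> {1..}" for l u
    using conformal_diffeo_imp_conformal_map[OF diffeo] that by (intro word_map_conformal)
  have inv: "word_map \<phi> l u x \<in> J" if "l \<ge> 1" "set u \<subseteq> {1..}" "x \<in> J" for l u x
  proof -
    have "word_map \<phi> l u ` J \<subseteq> J" by (rule word_map_invariant) (use maps that in auto)
    then show ?thesis using that(3) by blast
  qed
  have distortion: "deriv_norm (word_map \<phi> l u) x \<le> C * deriv_norm (word_map \<phi> l u) y"
    if "l \<ge> 1" "set u \<subseteq> {1..}" "x \<in> V" "y \<in> V" for l u x y
  proof (cases "u = []")
    case True
    then show ?thesis using C by (simp add: deriv_norm_id)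
  next
    case False
    then show ?thesis using dist0[OF that(1) _ in_words[OF that(2)] that(3,4)] by (simp add: Suc_le_eq)
  qed
  have J0: "J \<noteq> {}" using J(2) interior_subset by blast
  obtain x0 \<rho> where \<rho>: "\<rho> > 0" "cball x0 \<rho> \<subseteq> J"
    using J(2) open_contains_cball[of "interior J"] interior_subset[of J] by (metis ex_in_conv open_interior order_trans)
  have bdd: "bdd_above (deriv_norm (word_map \<phi> l u) ` J)" if "l \<ge> 1" "set u \<subseteq> {1..}" for l u
  proof -
    obtain y where y: "y \<in> J" using J0 by blast
    show ?thesis
      by (rule bdd_aboveI2[of _ _ "C * deriv_norm (word_map \<phi> l u) y"]) (use distortion[OF that] subsetD[OF V(3)] y in blast)
  qed
  have dn_le: "deriv_norm (word_map \<phi> l u) x \<le> N l u" if "l \<ge> 1" "set u \<subseteq> {1..}" "x \<in> J" for l u x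
    unfolding N_def sup_deriv_norm_def using that by (intro cSUP_upper bdd)
  have N_least: "N l u \<le> M" if "\<And>x. x \<in> J \<Longrightarrow> deriv_norm (word_map \<phi> l u) x \<le> M" for l u M
    unfolding N_def sup_deriv_norm_def using that J0 by (intro cSUP_least)
  have dn_ge: "N l u \<le> C * deriv_norm (word_map \<phi> l u) y" if "l \<ge> 1" "set u \<subseteq> {1..}" "y \<in> V" for l u y
    using distortion[OF that(1,2) _ that(3)] V(3) by (intro N_least) auto
  have dn_pos: "0 < deriv_norm (word_map \<phi> l u) x" if "l \<ge> 1" "set u \<subseteq> {1..}" "x \<in> V" for l u x
    using conformal_mapD(4)[OF cm[OF that(1,2)] that(3)] .
  have Npos: "0 < N l u" if "l \<ge> 1" "set u \<subseteq> {1..}" for l u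
  proof -
    obtain y where y: "y \<in> J" using J0 by blast
    then show ?thesis using dn_pos[OF that, of y] dn_le[OF that y] V(3) by fastforce
  qed
  have dn_append: "deriv_norm (word_map \<phi> l (u @ v)) x =
      deriv_norm (word_map \<phi> l u) (word_map \<phi> (l + length u) v x) * deriv_norm (word_map \<phi> (l + length u) v) x"
    if "l \<ge> 1" "set u \<subseteq> {1..}" "set v \<subseteq> {1..}" "x \<in> V" for l u v x
    unfolding word_map_append using that by (intro deriv_norm_comp[OF cm cm]) auto
  obtain D0 where D0: "D0 > 0" and D0': "\<forall>f M. conformal_map V f \<longrightarrow> (\<forall>x\<in>V. deriv_norm f x \<le> M) \<longrightarrow>
      (\<forall>x\<in>J. \<forall>y\<in>J. dist (f x) (f y) \<le> D0 * M)"
    using conformal_map_diameter[OF V(1,2) J(1) V(3) J0] by (elim exE conjE) (rule that)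
  have "cylinder_system N C c Jw (D0 * C) (\<rho> / C)"
  proof
    show "C \<ge> 1" "0 < c" "c < 1" by fact+
    show "0 < N l u" if "l \<ge> 1" "set u \<subseteq> {1..}" for l u by (rule Npos[OF that])
    show "N l [] = 1" for l using J0 by (simp add: N_def sup_deriv_norm_def deriv_norm_id)
    show "N l (u @ v) \<le> N l u * N (l + length u) v" if uv: "l \<ge> 1" "set u \<subseteq> {1..}" "set v \<subseteq> {1..}" for l u v
    proof (rule N_least)
      fix x assume x: "x \<in> J"
      have l': "l + length u \<ge> 1" using uv by simp
      show "deriv_norm (word_map \<phi> l (u @ v)) x \<le> N l u * N (l + length u) v"
        unfolding dn_append[OF uv subsetD[OF V(3) x]]
      proof (rule mult_mono)
        show "deriv_norm (word_map \<phi> l u) (word_map \<phi> (l + length u) v x) \<le> N l u"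
          by (rule dn_le[OF uv(1,2) inv[OF l' uv(3) x]])
        show "deriv_norm (word_map \<phi> (l + length u) v) x \<le> N (l + length u) v" by (rule dn_le[OF l' uv(3) x])
        show "0 \<le> N l u" using Npos[OF uv(1,2)] by simp
        show "0 \<le> deriv_norm (word_map \<phi> (l + length u) v) x" using dn_pos[OF l' uv(3) subsetD[OF V(3) x]] by simp
      qed
    qed
    show "N l u * N (l + length u) v \<le> C * N l (u @ v)" if uv: "l \<ge> 1" "set u \<subseteq> {1..}" "set v \<subseteq> {1..}" for l u v
    proof -
      have l': "l + length u \<ge> 1" using uv by simp
      have "N (l + length u) v \<le> C * N l (u @ v) / N l u"
      proof (rule N_least)
        fix x assume x: "x \<in> J"
        define y where "y = word_map \<phi> (l + length u) v x"
        have y: "y \<in> J" using inv[OF l' uv(3) x] by (simp add: y_def)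
        have "N l u * deriv_norm (word_map \<phi> (l + length u) v) x \<le>
            C * deriv_norm (word_map \<phi> l u) y * deriv_norm (word_map \<phi> (l + length u) v) x"
          using dn_ge[OF uv(1,2) subsetD[OF V(3) y]] dn_pos[OF l' uv(3) subsetD[OF V(3) x]]
          by (intro mult_right_mono) simp_all
        also have "\<dots> = C * deriv_norm (word_map \<phi> l (u @ v)) x"
          using dn_append[OF uv subsetD[OF V(3) x]] by (simp add: y_def)
        also have "\<dots> \<le> C * N l (u @ v)" using dn_le[of l "u @ v" x] uv x C by (intro mult_left_mono) auto
        finally show "deriv_norm (word_map \<phi> (l + length u) v) x \<le> C * N l (u @ v) / N l u"
          using Npos[OF uv(1,2)] by (simp add: field_simps)
      qed
      then show ?thesis using Npos[OF uv(1,2)] by (simp add: field_simps)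
    qed
    show "N l [j] \<le> c" if "l \<ge> 1" "j \<ge> 1" for l j
    proof (rule N_least)
      fix x assume "x \<in> J"
      then show "deriv_norm (word_map \<phi> l [j]) x \<le> c"
        using cm[of l "[j]"] that contr[OF that] by (intro deriv_norm_le_lipschitz[OF _ J(3) V(3)]) auto
    qed
    show "0 < D0 * C" "0 < \<rho> / C" using D0 \<rho> C by auto
    fix u :: "nat list" assume u: "set u \<subseteq> {1..}"
    obtain \<omega> where \<omega>: "Jw u = (\<lambda>x. word_map \<phi> 1 u x + \<omega>) ` J" using transl[OF in_words[OF u]] by blast
    show "compact (Jw u)"
      using closedJ[OF in_words[OF u]] J(1) by (metis compact_Int_closed inf.absorb_iff2)
    show "Jw (u @ [i]) \<subseteq> Jw u" if "i \<ge> 1" for i by (rule nested[OF in_words[OF u] that])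
    show "dist x y \<le> D0 * C * N 1 u" if xy: "x \<in> Jw u" "y \<in> Jw u" for x y
    proof -
      obtain x' y' where x': "x' \<in> J" "x = word_map \<phi> 1 u x' + \<omega>" and y': "y' \<in> J" "y = word_map \<phi> 1 u y' + \<omega>"
        using xy \<omega> by blast
      have "deriv_norm (word_map \<phi> 1 u) z \<le> C * N 1 u" if "z \<in> V" for z
      proof -
        have "deriv_norm (word_map \<phi> 1 u) z \<le> C * deriv_norm (word_map \<phi> 1 u) x'"
          using distortion[OF _ u that, of 1 x'] x' V(3) by auto
        also have "\<dots> \<le> C * N 1 u" using dn_le[OF _ u x'(1), of 1] C by (intro mult_left_mono) auto
        finally show ?thesis .
      qed
      then have "dist (word_map \<phi> 1 u x') (word_map \<phi> 1 u y') \<le> D0 * (C * N 1 u)"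
        using D0' x'(1) y'(1) cm[OF _ u, of 1] by simp
      then show ?thesis using x' y' by (simp add: dist_norm mult.assoc)
    qed
    show "\<exists>z. ball z (\<rho> / C * N 1 u) \<subseteq> Jw u"
    proof -
      have "ball (word_map \<phi> 1 u x0) (N 1 u / C * \<rho>) \<subseteq> word_map \<phi> 1 u ` ball x0 \<rho>"
        using cm[OF _ u, of 1] \<rho> V Npos[OF _ u, of 1] C dn_ge[OF _ u, of 1]
        by (intro conformal_map_image_ball[OF V(1)]) (auto simp: field_simps)
      also have "\<dots> \<subseteq> word_map \<phi> 1 u ` J" using \<rho>(2) ball_subset_cball by blast
      finally have sub: "ball (word_map \<phi> 1 u x0) (N 1 u / C * \<rho>) \<subseteq> word_map \<phi> 1 u ` J" .
      have "ball (word_map \<phi> 1 u x0 + \<omega>) (\<rho> / C * N 1 u) \<subseteq> Jw u"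
      proof
        fix p assume "p \<in> ball (word_map \<phi> 1 u x0 + \<omega>) (\<rho> / C * N 1 u)"
        then have "p - \<omega> \<in> ball (word_map \<phi> 1 u x0) (N 1 u / C * \<rho>)"
          by (simp add: dist_norm diff_add_eq mult.commute algebra_simps)
        then obtain x where "x \<in> J" "p - \<omega> = word_map \<phi> 1 u x" using sub by blast
        then show "p \<in> Jw u" unfolding \<omega> by (intro image_eqI[of _ _ x]) (auto simp: algebra_simps)
      qed
      then show ?thesis by blast
    qed
    show "interior (Jw (u @ [i])) \<inter> interior (Jw (u @ [j])) = {}" if "i \<ge> 1" "j \<ge> 1" "i \<noteq> j" for i j
      using osc in_words[OF u] that unfolding open_set_condition_def by blast
  qed
  then show ?thesis unfolding N_def by blast
qed

theorem theorem2p5: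
  fixes J :: "'a::euclidean_space set"
    and \<phi> :: "nat \<Rightarrow> nat \<Rightarrow> 'a \<Rightarrow> 'a"
    and Jw :: "nat list \<Rightarrow> 'a set"
  assumes "nonautonomous_ifs J \<phi> Jw"
    and "conformal_system J \<phi>"
    and "open_set_condition Jw"
    and "(\<lambda>k. ln (level_max_deriv J \<phi> k) / ln (max_deriv J \<phi> k)) \<longlonglongrightarrow> 0"
    and "\<And>t :: real. 0 < t \<Longrightarrow> t < real DIM('a) \<Longrightarrow>
           (\<forall>k\<ge>1. level_sum J \<phi> t k = \<infinity>) \<or> (\<forall>k\<ge>1. level_sum J \<phi> t k < \<infinity>)"
    and "\<And>t \<epsilon> :: real. 0 < t \<Longrightarrow> t < real DIM('a) \<Longrightarrow> 0 < \<epsilon> \<Longrightarrow>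
           (\<forall>k\<ge>1. level_sum J \<phi> t k < \<infinity>) \<Longrightarrow>
           (\<lambda>n. partial_level_sum J \<phi> t \<epsilon> n / level_sum J \<phi> t n) \<longlonglongrightarrow> 1"
    and "\<And>t \<epsilon> :: real. 0 < t \<Longrightarrow> t < real DIM('a) \<Longrightarrow> 0 < \<epsilon> \<Longrightarrow>
           (\<forall>k\<ge>1. level_sum J \<phi> t k = \<infinity>) \<Longrightarrow>
           (\<lambda>n. partial_level_sum J \<phi> t \<epsilon> n) \<longlonglongrightarrow> \<infinity>"
  shows "upper_box_dim (attractor Jw) \<ge> packing_dim (attractor Jw)
       \<and> packing_dim (attractor Jw) \<ge> upper_critical J \<phi>
       \<and> (emeasure lebesgue (frontier J) = 0 \<longrightarrow>
            hausdorff_dim (attractor Jw) = lower_critical J \<phi>)"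
proof -
  obtain C c D a where "cylinder_system (\<lambda>l u. sup_deriv_norm J (word_map \<phi> l u)) C c Jw D a"
    using conformal_cylinder_system[OF assms(1-3)] by blast
  then interpret cylinder_system "\<lambda>l u. sup_deriv_norm J (word_map \<phi> l u)" C c Jw D a .
  have eqs: "letter_sup = level_max_deriv J \<phi>" "word_sup = max_deriv J \<phi>"
    "letter_sum = level_sum J \<phi>" "full_sum = word_sum J \<phi>"
    by (auto simp: fun_eq_iff letter_sup_def level_max_deriv_def word_sup_def max_deriv_def
        letter_sum_def level_sum_def full_sum_def word_sum_def)
  have partial: "(\<Sum>j\<in>trunc \<epsilon> n. ennreal (sup_deriv_norm J (word_map \<phi> n [j]) powr t)) = partial_level_sum J \<phi> t \<epsilon> n" for t \<epsilon> n
    by (simp add: trunc_def partial_level_sum_def eqs)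
  interpret tame_cylinder_system "\<lambda>l u. sup_deriv_norm J (word_map \<phi> l u)" C c Jw D a
    by unfold_locales (simp_all only: eqs partial assms)
  have "upper_critical J \<phi> = Inf {ereal t | t. limsup (pressure_seq t) < 0}"
    "lower_critical J \<phi> = Inf {ereal t | t. liminf (pressure_seq t) < 0}"
    by (simp_all add: upper_critical_def upper_pressure_def lower_critical_def lower_pressure_def eqs)
  then show ?thesis
    using packing_dim_le_upper_box_dim[OF attractor_nonempty] packing_dim_ge
      hausdorff_dim_ge hausdorff_dim_le by (simp add: antisym)
qed

end
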